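(* Let $L$ be a vector field as in the context, with numbers $\mu$ and $\lambda$. Assume $\mu\neq0$ and that the pair $(\mu,\lambda)$ is nonresonant and satisfies the Diophantine condition $(\mathcal{DC})$. Then for every function $f(x,y)$ that is real analytic at $0\in\mathbb{R}^2$ there exist $\epsilon>0$ and a bounded function $w\in C^\infty(D(0,\epsilon)\setminus\{0\})$ such that $u=w/r^{\lambda-1}$ is a distribution solution of $Lu=f$ in the disc $D(0,\epsilon)$.
   Context: Setting: $L=A\partial_x+B\partial_y$ where $A,B\in C^\infty(\mathbb{R}^2\setminus\{0\},\mathbb{C})$ are homogeneous of degree $\lambda\in\mathbb{C}$, $\mathrm{Re}(\lambda)>1$ (i.e. $A(tx,ty)=t^\lambda A(x,y)$, $B(tx,ty)=t^\lambda B(x,y)$ for $t>0$). Put $a(\theta)=A(\cos\theta,\sin\theta)$, $b(\theta)=B(\cos\theta,\sin\theta)$, $p=b\cos\theta-a\sin\theta$, $q=i(a\cos\theta+b\sin\theta)$; in polar coordinates $L=r^{\lambda-1}(p(\theta)\partial_\theta-iq(\theta)r\partial_r)$. Standing assumptions: the set $\{\mathrm{Im}(A\overline{B})=0\}$ has empty interior in $\mathbb{R}^2$ (equivalently $\{\theta:\mathrm{Re}(q\overline p)=0\}$ has empty interior in $\mathbb{S}^1$), and $L\wedge(x\partial_x+y\partial_y)\neq0$ on $\mathbb{R}^2\setminus\{0\}$ (equivalently $p(\theta)\ne0$ for all $\theta$). Define $\mu=\frac1{2\pi}\int_0^{2\pi}\frac{q(\theta)}{p(\theta)}d\theta$; it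 is assumed (after a linear change of variables) that $\mathrm{Re}(\mu)\ge0$. $\mathbb{Z}^+$ denotes the positive integers. The pair $(\mu,\lambda)$ is resonant if there exist $l\in\mathbb{Z}^+$, $k\in\mathbb{Z}$ with $\mu\lambda=\mu l+k$; otherwise nonresonant. Condition $(\mathcal{DC})$: there exists $C>0$ such that $|1-e^{2\pi i\mu(j-\lambda)}|\ge C^j$ for every $j\in\mathbb{Z}^+$. Distribution equations: $Lu=f$ means $\langle u,{}^tL\Phi\rangle=\langle f,\Phi\rangle$ for all test functions $\Phi\in C_c^\infty$, where ${}^tL\Phi=-(L\Phi+(\mathrm{div}L)\Phi)$, $\mathrm{div}L=A_x+B_y$. Since ${}^tL\Phi$ is smooth away from $0$ but only finitely differentiable at $0$ (where it is $O(r^{\mathrm{Re}\lambda-1})$), a distribution singular at $0$ is paired with it through its natural extension (it has finite order, given by a regularized integral). When $w/r^{\lambda-1}$ is not locally integrable at $0$, "$u=w/r^{\lambda-1}$ is a distribution solution" means that $u$ is a distribution in the disc which coincides with the function $w/r^{\lambda-1}$ off $0$ and solves the equation. $D(0,\epsilon)$ is the open disc of center $0$ and radius $\epsilon$, and $r=\sqrt{x^2+y^2}$. *)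

theory Defs
  imports "HOL-Analysis.Analysis"
begin

type_synonym plane = "real \<times> real"

section \<open>Functions of class \<open>C\<^sup>k\<close> on open subsets of the plane\<close>

definition pdx :: "(plane \<Rightarrow> complex) \<Rightarrow> plane \<Rightarrow> complex" where
  "pdx f z = frechet_derivative f (at z) (1, 0)"

definition pdy :: "(plane \<Rightarrow> complex) \<Rightarrow> plane \<Rightarrow> complex" where
  "pdy f z = frechet_derivative f (at z) (0, 1)"

text \<open>Intended for open \<open>S\<close>. Differentiability is required because otherwise
  \<^const>\<open>frechet_derivative\<close> is meaningless.\<close>

fun Ck_on :: "nat \<Rightarrow> plane set \<Rightarrow> (plane \<Rightarrow> complex) \<Rightarrow> bool" where
  "Ck_on 0 S f \<longleftrightarrow> continuous_on S f"
| "Ck_on (Suc k) S f \<longleftrightarrow>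
     (\<forall>z\<in>S. f differentiable (at z)) \<and> Ck_on k S (pdx f) \<and> Ck_on k S (pdy f)"

definition smooth_on :: "plane set \<Rightarrow> (plane \<Rightarrow> complex) \<Rightarrow> bool" where
  "smooth_on S f \<longleftrightarrow> (\<forall>k. Ck_on k S f)"

definition real_analytic_at_0 :: "(plane \<Rightarrow> complex) \<Rightarrow> bool" where
  "real_analytic_at_0 f \<longleftrightarrow>
     (\<exists>\<rho>>0. \<exists>c :: nat \<Rightarrow> nat \<Rightarrow> complex. \<forall>x y. \<bar>x\<bar> < \<rho> \<and> \<bar>y\<bar> < \<rho> \<longrightarrow>
        ((\<lambda>(m, n). c m n * of_real x ^ m * of_real y ^ n) has_sum f (x, y)) UNIV)"

section \<open>Test functions and distributions\<close>

definition supp :: "(plane \<Rightarrow> complex) \<Rightarrow> plane set" where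
  "supp \<Phi> = closure {z. \<Phi> z \<noteq> 0}"

definition Ck_c :: "nat \<Rightarrow> plane set \<Rightarrow> (plane \<Rightarrow> complex) set" where
  "Ck_c k U = {\<Phi>. Ck_on k UNIV \<Phi> \<and> compact (supp \<Phi>) \<and> supp \<Phi> \<subseteq> U}"

definition Cinf_c :: "plane set \<Rightarrow> (plane \<Rightarrow> complex) set" where
  "Cinf_c U = {\<Phi>. smooth_on UNIV \<Phi> \<and> compact (supp \<Phi>) \<and> supp \<Phi> \<subseteq> U}"

definition Ck_norm :: "nat \<Rightarrow> (plane \<Rightarrow> complex) \<Rightarrow> real" where
  "Ck_norm k \<Phi> = (\<Sum>(i, j)\<in>{(i, j). i + j \<le> k}. SUP z. norm ((pdx ^^ i) ((pdy ^^ j) \<Phi>) z))"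

definition linear_functional_on ::
    "(plane \<Rightarrow> complex) set \<Rightarrow> ((plane \<Rightarrow> complex) \<Rightarrow> complex) \<Rightarrow> bool" where
  "linear_functional_on V T \<longleftrightarrow>
     (\<forall>\<Phi>\<in>V. \<forall>\<Psi>\<in>V. T (\<lambda>z. \<Phi> z + \<Psi> z) = T \<Phi> + T \<Psi>) \<and>
     (\<forall>\<Phi>\<in>V. \<forall>c. T (\<lambda>z. c * \<Phi> z) = c * T \<Phi>)"

definition distribution :: "plane set \<Rightarrow> ((plane \<Rightarrow> complex) \<Rightarrow> complex) \<Rightarrow> bool" where
  "distribution U u \<longleftrightarrow> linear_functional_on (Cinf_c U) u \<and>
     (\<forall>K. compact K \<and> K \<subseteq> U \<longrightarrow>
        (\<exists>N C. \<forall>\<Phi>\<in>Cinf_c U. supp \<Phi> \<subseteq> K \<longrightarrow> norm (u \<Phi>) \<le> C * Ck_norm N \<Phi>))"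

text \<open>A distribution of order at most \<open>N\<close> is the same as a continuous functional on \<open>C\<^sup>N\<close>
  functions of compact support: the extension of \<open>u\<close> exists and is unique, since the
  \<open>C\<^sup>\<infinity>\<close> test functions are dense. The predicate below says that \<open>T\<close> is this extension.\<close>

definition extends_to_order ::
    "nat \<Rightarrow> plane set \<Rightarrow> ((plane \<Rightarrow> complex) \<Rightarrow> complex) \<Rightarrow> ((plane \<Rightarrow> complex) \<Rightarrow> complex) \<Rightarrow> bool" where
  "extends_to_order N U u T \<longleftrightarrow> linear_functional_on (Ck_c N U) T \<and>
     (\<forall>K. compact K \<and> K \<subseteq> U \<longrightarrow>
        (\<exists>C. \<forall>\<Phi>\<in>Ck_c N U. supp \<Phi> \<subseteq> K \<longrightarrow> norm (T \<Phi>) \<le> C * Ck_norm N \<Phi>)) \<and>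
     (\<forall>\<Phi>\<in>Cinf_c U. T \<Phi> = u \<Phi>)"

definition locally_integrable :: "plane set \<Rightarrow> (plane \<Rightarrow> complex) \<Rightarrow> bool" where
  "locally_integrable U g \<longleftrightarrow> (\<forall>K. compact K \<and> K \<subseteq> U \<longrightarrow> set_integrable lborel K g)"

definition coincides_on ::
    "plane set \<Rightarrow> ((plane \<Rightarrow> complex) \<Rightarrow> complex) \<Rightarrow> (plane \<Rightarrow> complex) \<Rightarrow> bool" where
  "coincides_on U u g \<longleftrightarrow> locally_integrable U g \<and>
     (\<forall>\<Phi>\<in>Cinf_c U. u \<Phi> = (LINT z:U|lborel. g z * \<Phi> z))"

text \<open>A distribution on \<open>U\<close> given by a function \<open>g\<close> with a possible singularity at the origin.
  Some extension of \<open>g\<close> across the origin is allowed only when \<open>g\<close> is not locally integrable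
  there; otherwise \<open>u\<close> has to be the function \<open>g\<close> itself.\<close>

definition distribution_of_singular ::
    "plane set \<Rightarrow> ((plane \<Rightarrow> complex) \<Rightarrow> complex) \<Rightarrow> (plane \<Rightarrow> complex) \<Rightarrow> bool" where
  "distribution_of_singular U u g \<longleftrightarrow> distribution U u \<and> coincides_on (U - {0}) u g \<and>
     (locally_integrable U g \<longrightarrow> coincides_on U u g)"

section \<open>Homogeneous vector fields \<open>L = A \<partial>\<^sub>x + B \<partial>\<^sub>y\<close>\<close>

definition homogeneous :: "complex \<Rightarrow> (plane \<Rightarrow> complex) \<Rightarrow> bool" where
  "homogeneous lam A \<longleftrightarrow> (\<forall>z t. z \<noteq> 0 \<and> t > 0 \<longrightarrow> A (t *\<^sub>R z) = of_real t powr lam * A z)"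

definition vfield ::
    "(plane \<Rightarrow> complex) \<Rightarrow> (plane \<Rightarrow> complex) \<Rightarrow> (plane \<Rightarrow> complex) \<Rightarrow> plane \<Rightarrow> complex" where
  "vfield A B \<Phi> z = A z * pdx \<Phi> z + B z * pdy \<Phi> z"

definition divergence :: "(plane \<Rightarrow> complex) \<Rightarrow> (plane \<Rightarrow> complex) \<Rightarrow> plane \<Rightarrow> complex" where
  "divergence A B z = pdx A z + pdy B z"

text \<open>The coefficients are only given off the origin. For degree \<open>lam\<close> with \<open>Re lam > 1\<close> they and
  their first derivatives extend continuously by \<open>0\<close>, whence the value at the origin.\<close>

definition transpose_vfield ::
    "(plane \<Rightarrow> complex) \<Rightarrow> (plane \<Rightarrow> complex) \<Rightarrow> (plane \<Rightarrow> complex) \<Rightarrow> plane \<Rightarrow> complex" where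
  "transpose_vfield A B \<Phi> z =
     (if z = 0 then 0 else - (vfield A B \<Phi> z + divergence A B z * \<Phi> z))"

text \<open>\<open>Lu = f\<close> on \<open>U\<close>. The functions \<open>\<^sup>tL\<Phi>\<close> are in general only finitely differentiable at the
  origin, so \<open>u\<close> is required to have an order \<open>N\<close> for which all of them are of class \<open>C\<^sup>N\<close>, and is
  paired with them through its extension \<open>T\<close>.\<close>

definition distribution_solution ::
    "plane set \<Rightarrow> (plane \<Rightarrow> complex) \<Rightarrow> (plane \<Rightarrow> complex) \<Rightarrow>
      ((plane \<Rightarrow> complex) \<Rightarrow> complex) \<Rightarrow> (plane \<Rightarrow> complex) \<Rightarrow> bool" where
  "distribution_solution U A B u f \<longleftrightarrow> distribution U u \<and> locally_integrable U f \<and>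
     (\<exists>N T. extends_to_order N U u T \<and>
        (\<forall>\<Phi>\<in>Cinf_c U. transpose_vfield A B \<Phi> \<in> Ck_c N U \<and>
           T (transpose_vfield A B \<Phi>) = (LINT z:U|lborel. f z * \<Phi> z)))"

definition p_fun :: "(plane \<Rightarrow> complex) \<Rightarrow> (plane \<Rightarrow> complex) \<Rightarrow> real \<Rightarrow> complex" where
  "p_fun A B \<theta> = B (cos \<theta>, sin \<theta>) * of_real (cos \<theta>) - A (cos \<theta>, sin \<theta>) * of_real (sin \<theta>)"

definition q_fun :: "(plane \<Rightarrow> complex) \<Rightarrow> (plane \<Rightarrow> complex) \<Rightarrow> real \<Rightarrow> complex" where
  "q_fun A B \<theta> =
     \<i> * (A (cos \<theta>, sin \<theta>) * of_real (cos \<theta>) + B (cos \<theta>, sin \<theta>) * of_real (sin \<theta>))"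

definition mu :: "(plane \<Rightarrow> complex) \<Rightarrow> (plane \<Rightarrow> complex) \<Rightarrow> complex" where
  "mu A B = 1 / (2 * of_real pi) * integral {0..2 * pi} (\<lambda>\<theta>. q_fun A B \<theta> / p_fun A B \<theta>)"

definition resonant :: "complex \<Rightarrow> complex \<Rightarrow> bool" where
  "resonant \<mu> lam \<longleftrightarrow> (\<exists>(l::nat) (k::int). l > 0 \<and> \<mu> * lam = \<mu> * of_nat l + of_int k)"

definition DC :: "complex \<Rightarrow> complex \<Rightarrow> bool" where
  "DC \<mu> lam \<longleftrightarrow> (\<exists>C::real. C > 0 \<and>
     (\<forall>j::nat. j > 0 \<longrightarrow>
        norm (1 - exp (2 * of_real pi * \<i> * \<mu> * (of_nat j - lam))) \<ge> C ^ j))"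

end

theory Submission
  imports Defs
begin

text \<open>
  In polar coordinates a term \<open>r powr s * v(\<theta>)\<close> is mapped by \<open>L\<close> to
  \<open>r powr (lam - 1 + s) * (p * v' - \<i> * q * s * v)\<close>. Hence the homogeneous part \<open>f\<^sub>j\<close> of degree
  \<open>j\<close> of \<open>f\<close> is matched by \<open>s = j + 1 - lam\<close> and a \<open>2\<pi>\<close>-periodic solution \<open>v\<^sub>j\<close> of a linear equation
  whose monodromy is \<open>exp (2\<pi>\<i>\<mu>s)\<close>; the Diophantine condition gives \<open>\<bar>v\<^sub>j\<bar> \<le> K M\<^sup>j\<close>, so
  \<open>w = \<Sum> r\<^sup>j v\<^sub>j\<close> converges near the origin. The functions \<open>W\<^sub>n = \<Sum> j\<^sup>n r\<^sup>j v\<^sub>j\<close>,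
  with \<open>W\<^sub>0 = w\<close>, satisfy the Euler relation \<open>(x \<partial>\<^sub>x + y \<partial>\<^sub>y) W\<^sub>n = W\<^sub>n\<^sub>+\<^sub>1\<close> and a transport equation;
  these two determine the gradient of \<open>W\<^sub>n\<close> by \<open>W\<^sub>n\<close> and \<open>W\<^sub>n\<^sub>+\<^sub>1\<close>, so that all of them are smooth.
  The distribution is a finite part of \<open>w / r powr (lam - 1)\<close>. The function \<open>\<^sup>tL\<Phi>\<close> is of class
  \<open>C\<^sup>N\<close> with vanishing \<open>N\<close>-jet at the origin, so that the regularization is invisible and the equation
  reduces to the divergence theorem for fields with bounded first derivatives off the origin.
\<close>

section \<open>Calculus of \<open>C\<^sup>k\<close> functions\<close>

text \<open>The function w / r^(lam-1) may be as large as r^(1 - Re lam), so in general it has no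
  canonical extension across the origin, and an arbitrary one may satisfy the equation only up to a
  distribution supported there. An order N with N < Re lam - 1 <= N + 1 reconciles two demands. The
  second inequality makes the function times a Taylor remainder of order N at most a multiple of
  1/r, which is integrable in the plane. The strict one makes every transposed test function flat to
  order N, so that nothing is subtracted from it. Exponentially small divisors are harmless because
  a geometric loss only shrinks the disc of convergence of a series whose coefficients are
  themselves geometrically bounded. The weights j^n arise because r d/dr acts on the j-th term as
  multiplication by j, and the angular derivative brings in j + 1 - lam. Every derivative of w is
  thus controlled by weighted series of the same terms, and only sup bounds of the v_j are ever
  needed, never bounds of their derivatives.\<close>

lemma pdx_eq: "(f has_derivative D) (at z) \<Longrightarrow> pdx f z = D (1, 0)"
  and pdy_eq: "(f has_derivative D) (at z) \<Longrightarrow> pdy f z = D (0, 1)"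
  by (simp_all add: pdx_def pdy_def frechet_derivative_at[symmetric])

text \<open>\<open>pdx\<close> and \<open>pdy\<close> are the values of the total derivative on the
  basis vectors, and linearity recovers it from them. The product and chain rules below start from
  this form.\<close>

lemma has_derivative_pd:
  assumes "f differentiable (at z)"
  shows "(f has_derivative (\<lambda>h. of_real (fst h) * pdx f z + of_real (snd h) * pdy f z)) (at z)"
proof -
  have D: "(f has_derivative frechet_derivative f (at z)) (at z)"
    using assms frechet_derivative_works by blast
  then interpret linear "frechet_derivative f (at z)"
    using has_derivative_linear by blast
  have "frechet_derivative f (at z) h = of_real (fst h) * pdx f z + of_real (snd h) * pdy f z" for h
  proof -
    have "h = fst h *\<^sub>R (1, 0) + snd h *\<^sub>R (0, 1)" by (simp add: prod_eq_iff)
    then have "frechet_derivative f (at z) h = frechet_derivative f (at z) (fst h *\<^sub>R (1, 0) + snd h *\<^sub>R (0, 1))"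
      by simp
    then show ?thesis by (simp only: add scale pdx_def pdy_def scaleR_conv_of_real)
  qed
  then have "frechet_derivative f (at z) =
      (\<lambda>h. of_real (fst h) * pdx f z + of_real (snd h) * pdy f z)" by (rule ext)
  with D show ?thesis by simp
qed

lemma pd_cong_open:
  assumes "open S" "z \<in> S" "\<And>z. z \<in> S \<Longrightarrow> f z = g z"
  shows "pdx f z = pdx g z" "pdy f z = pdy g z"
    "f differentiable (at z) \<longleftrightarrow> g differentiable (at z)"
proof -
  have D: "(f has_derivative D) (at z) \<longleftrightarrow> (g has_derivative D) (at z)" for D
    using assms has_derivative_transform_within_open[of f D z UNIV S g]
      has_derivative_transform_within_open[of g D z UNIV S f] by auto
  then show "f differentiable (at z) \<longleftrightarrow> g differentiable (at z)"
    by (simp add: differentiable_def)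
  show "pdx f z = pdx g z" "pdy f z = pdy g z"
    using D by (simp_all add: pdx_def pdy_def frechet_derivative_def)
qed

lemma Ck_on_cong:
  assumes "open S" "\<And>z. z \<in> S \<Longrightarrow> f z = g z"
  shows "Ck_on k S f \<longleftrightarrow> Ck_on k S g"
  using assms(2)
proof (induction k arbitrary: f g)
  case 0
  then show ?case by (simp cong: continuous_on_cong)
next
  case (Suc k)
  have "Ck_on k S (pdx f) \<longleftrightarrow> Ck_on k S (pdx g)" "Ck_on k S (pdy f) \<longleftrightarrow> Ck_on k S (pdy g)"
    using Suc.prems pd_cong_open[OF assms(1)] by (intro Suc.IH; blast)+
  moreover have "\<forall>z\<in>S. f differentiable (at z) \<longleftrightarrow> g differentiable (at z)"
    using Suc.prems pd_cong_open[OF assms(1)] by blast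
  ultimately show ?case by auto
qed

lemma smooth_on_cong:
  "open S \<Longrightarrow> (\<And>z. z \<in> S \<Longrightarrow> f z = g z) \<Longrightarrow> smooth_on S f \<longleftrightarrow> smooth_on S g"
  unfolding smooth_on_def using Ck_on_cong by metis

lemma Ck_on_subset: "Ck_on k S f \<Longrightarrow> T \<subseteq> S \<Longrightarrow> Ck_on k T f"
  by (induction k arbitrary: f) (auto intro: continuous_on_subset)

lemma Ck_on_Suc_D: "Ck_on (Suc k) S f \<Longrightarrow> Ck_on k S f"
proof (induction k arbitrary: f)
  case 0
  then show ?case
    by (auto intro!: differentiable_imp_continuous_within continuous_at_imp_continuous_on)
next
  case (Suc k)
  have "\<forall>z\<in>S. f differentiable (at z)"
    using Suc.prems by simp
  moreover have "Ck_on k S (pdx f)" "Ck_on k S (pdy f)"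
    by (rule Suc.IH, use Suc.prems in simp)+
  ultimately show ?case by simp
qed

lemma Ck_on_le: "Ck_on k S f \<Longrightarrow> j \<le> k \<Longrightarrow> Ck_on j S f"
  by (induction k) (auto simp: le_Suc_eq dest: Ck_on_Suc_D simp del: Ck_on.simps)

lemma Ck_on_continuous: "Ck_on k S f \<Longrightarrow> continuous_on S f"
  using Ck_on_le[of k S f 0] by simp

lemma pd_add:
  assumes "f differentiable (at z)" "g differentiable (at z)"
  shows "pdx (\<lambda>z. f z + g z) z = pdx f z + pdx g z" "pdy (\<lambda>z. f z + g z) z = pdy f z + pdy g z"
  using has_derivative_add[OF assms[THEN has_derivative_pd]] by (simp_all add: pdx_eq pdy_eq)

lemma pd_mult:
  assumes "f differentiable (at z)" "g differentiable (at z)"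
  shows "pdx (\<lambda>z. f z * g z) z = f z * pdx g z + pdx f z * g z"
    "pdy (\<lambda>z. f z * g z) z = f z * pdy g z + pdy f z * g z"
  using has_derivative_mult[OF assms[THEN has_derivative_pd]] by (simp_all add: pdx_eq pdy_eq)

lemma pd_const [simp]: "pdx (\<lambda>z. c) = (\<lambda>z. 0)" "pdy (\<lambda>z. c) = (\<lambda>z. 0)"
  using pdx_eq[OF has_derivative_const] pdy_eq[OF has_derivative_const] by auto

lemma Ck_on_const: "Ck_on k S (\<lambda>z. c)"
  by (induction k arbitrary: c) auto

lemma Ck_on_add:
  assumes "open S" "Ck_on k S f" "Ck_on k S g"
  shows "Ck_on k S (\<lambda>z. f z + g z)"
  using assms(2,3)
proof (induction k arbitrary: f g)
  case 0
  then show ?case by (simp add: continuous_intros)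
next
  case (Suc k)
  have "Ck_on k S (pdx (\<lambda>z. f z + g z)) = Ck_on k S (\<lambda>z. pdx f z + pdx g z)"
    "Ck_on k S (pdy (\<lambda>z. f z + g z)) = Ck_on k S (\<lambda>z. pdy f z + pdy g z)"
    using Suc.prems pd_add by (intro Ck_on_cong[OF assms(1)]; simp)+
  moreover have "(\<lambda>z. f z + g z) differentiable (at z)" if "z \<in> S" for z
    using Suc.prems that by (intro differentiable_add) auto
  ultimately show ?case using Suc.prems Suc.IH unfolding Ck_on.simps by blast
qed

lemma Ck_on_mult:
  assumes "open S" "Ck_on k S f" "Ck_on k S g"
  shows "Ck_on k S (\<lambda>z. f z * g z)"
  using assms(2,3)
proof (induction k arbitrary: f g)
  case 0
  then show ?case by (simp add: continuous_intros)
next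
  case (Suc k)
  have *: "Ck_on k S (pdx (\<lambda>z. f z * g z)) = Ck_on k S (\<lambda>z. f z * pdx g z + pdx f z * g z)"
    "Ck_on k S (pdy (\<lambda>z. f z * g z)) = Ck_on k S (\<lambda>z. f z * pdy g z + pdy f z * g z)"
    using Suc.prems pd_mult by (intro Ck_on_cong[OF assms(1)]; simp)+
  have "Ck_on k S f" "Ck_on k S g" using Suc.prems Ck_on_Suc_D by blast+
  then have "Ck_on k S (\<lambda>z. f z * pdx g z + pdx f z * g z)"
    "Ck_on k S (\<lambda>z. f z * pdy g z + pdy f z * g z)"
    using Suc.prems by (auto intro!: Ck_on_add[OF assms(1) Suc.IH Suc.IH])
  moreover have "(\<lambda>z. f z * g z) differentiable (at z)" if "z \<in> S" for z
    using Suc.prems that by (intro differentiable_mult) auto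
  ultimately show ?case unfolding Ck_on.simps * by blast
qed

lemma Ck_on_inverse:
  assumes "open S" "Ck_on k S f" "\<And>z. z \<in> S \<Longrightarrow> f z \<noteq> 0"
  shows "Ck_on k S (\<lambda>z. inverse (f z))"
  using assms(2)
proof (induction k)
  case 0
  then show ?case using assms(3) by (simp add: continuous_intros)
next
  case (Suc k)
  have D: "((\<lambda>z. inverse (f z)) has_derivative
     (\<lambda>h. - (inverse (f z) * (of_real (fst h) * pdx f z + of_real (snd h) * pdy f z) * inverse (f z)))) (at z)"
    if "z \<in> S" for z
    using that Suc.prems assms(3) by (intro Deriv.has_derivative_inverse has_derivative_pd) auto
  have *: "Ck_on k S (pdx (\<lambda>z. inverse (f z))) = Ck_on k S (\<lambda>z. (-1) * (inverse (f z) * (pdx f z * inverse (f z))))"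
    "Ck_on k S (pdy (\<lambda>z. inverse (f z))) = Ck_on k S (\<lambda>z. (-1) * (inverse (f z) * (pdy f z * inverse (f z))))"
    using pdx_eq[OF D] pdy_eq[OF D] by (intro Ck_on_cong[OF assms(1)]; simp)+
  have "Ck_on k S f" using Suc.prems Ck_on_Suc_D by blast
  then have "Ck_on k S (\<lambda>z. inverse (f z))" using Suc.IH by blast
  then have "Ck_on k S (\<lambda>z. (-1) * (inverse (f z) * (pdx f z * inverse (f z))))"
    "Ck_on k S (\<lambda>z. (-1) * (inverse (f z) * (pdy f z * inverse (f z))))"
    using Suc.prems by (intro Ck_on_mult Ck_on_const assms(1); simp)+
  moreover have "(\<lambda>z. inverse (f z)) differentiable (at z)" if "z \<in> S" for z
    by (rule differentiableI[OF D[OF that]])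
  ultimately show ?case unfolding Ck_on.simps * by blast
qed

lemma smooth_on_const: "smooth_on S (\<lambda>z. c)"
  by (simp add: smooth_on_def Ck_on_const)

lemma smooth_on_add: "open S \<Longrightarrow> smooth_on S f \<Longrightarrow> smooth_on S g \<Longrightarrow> smooth_on S (\<lambda>z. f z + g z)"
  by (simp add: smooth_on_def Ck_on_add)

lemma smooth_on_mult: "open S \<Longrightarrow> smooth_on S f \<Longrightarrow> smooth_on S g \<Longrightarrow> smooth_on S (\<lambda>z. f z * g z)"
  by (simp add: smooth_on_def Ck_on_mult)

lemma smooth_on_minus: "open S \<Longrightarrow> smooth_on S f \<Longrightarrow> smooth_on S (\<lambda>z. - f z)"
  using smooth_on_mult[of S "\<lambda>z. -1" f] smooth_on_const[of S "-1"] by simp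

lemma smooth_on_diff: "open S \<Longrightarrow> smooth_on S f \<Longrightarrow> smooth_on S g \<Longrightarrow> smooth_on S (\<lambda>z. f z - g z)"
  using smooth_on_add[of S f "\<lambda>z. - g z"] smooth_on_minus by simp

lemma smooth_on_divide:
  "open S \<Longrightarrow> smooth_on S f \<Longrightarrow> smooth_on S g \<Longrightarrow> (\<And>z. z \<in> S \<Longrightarrow> g z \<noteq> 0) \<Longrightarrow>
    smooth_on S (\<lambda>z. f z / g z)"
  by (simp add: smooth_on_def divide_inverse Ck_on_mult Ck_on_inverse)

lemma smooth_on_subset: "smooth_on S f \<Longrightarrow> T \<subseteq> S \<Longrightarrow> smooth_on T f"
  by (auto simp: smooth_on_def intro: Ck_on_subset)

lemma smooth_onD:
  assumes "smooth_on S f"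
  shows "z \<in> S \<Longrightarrow> f differentiable (at z)" "smooth_on S (pdx f)" "smooth_on S (pdy f)"
    "continuous_on S f"
proof -
  have *: "Ck_on (Suc k) S f" for k using assms by (simp only: smooth_on_def)
  show "z \<in> S \<Longrightarrow> f differentiable (at z)" using *[of 0] unfolding Ck_on.simps by blast
  show "smooth_on S (pdx f)" "smooth_on S (pdy f)"
    using * unfolding Ck_on.simps smooth_on_def by blast+
  show "continuous_on S f" using Ck_on_continuous[OF *] by blast
qed

lemma has_derivative_coords:
  "((\<lambda>z::plane. of_real (fst z) :: complex) has_derivative (\<lambda>h. of_real (fst h))) (at z)"
  "((\<lambda>z::plane. of_real (snd z) :: complex) has_derivative (\<lambda>h. of_real (snd h))) (at z)"
  by (intro has_derivative_of_real has_derivative_fst has_derivative_snd has_derivative_ident)+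

lemmas differentiable_coords = has_derivative_coords[THEN differentiableI]

lemma pd_fst: "pdx (\<lambda>z. of_real (fst z)) = (\<lambda>z. 1)" "pdy (\<lambda>z. of_real (fst z)) = (\<lambda>z. 0)"
  and pd_snd: "pdx (\<lambda>z. of_real (snd z)) = (\<lambda>z. 0)" "pdy (\<lambda>z. of_real (snd z)) = (\<lambda>z. 1)"
  by (rule ext, simp add: pdx_eq[OF has_derivative_coords(1)] pdy_eq[OF has_derivative_coords(1)]
      pdx_eq[OF has_derivative_coords(2)] pdy_eq[OF has_derivative_coords(2)])+

lemma smooth_on_fst: "smooth_on S (\<lambda>z. of_real (fst z))"
  and smooth_on_snd: "smooth_on S (\<lambda>z. of_real (snd z))"
proof -
  have "Ck_on k S (\<lambda>z. of_real (fst z))" "Ck_on k S (\<lambda>z. of_real (snd z))" for k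
    using Ck_on_const differentiable_coords
    by (cases k; simp add: pd_fst pd_snd continuous_on_of_real continuous_on_fst continuous_on_snd)+
  then show "smooth_on S (\<lambda>z. of_real (fst z))" "smooth_on S (\<lambda>z. of_real (snd z))"
    by (auto simp: smooth_on_def)
qed

text \<open>The gradient is written as z times r^(c-2), not as a unit vector times r^(c-1):
  coordinates are smooth everywhere, so the family of all complex powers of r is closed under
  differentiation up to smooth factors. The induction in \<open>smooth_on_norm_powr\<close>, with
  \<open>c\<close> arbitrary, rests on this.\<close>

lemma norm_powr_has_derivative:
  fixes z :: plane and c :: complex
  assumes "z \<noteq> 0"
  shows "((\<lambda>z. of_real (norm z) powr c) has_derivative
    (\<lambda>h. c * of_real (norm z) powr (c - 2) * of_real (fst z * fst h + snd z * snd h))) (at z)"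
proof -
  have n: "norm z > 0" using assms by simp
  have 1: "((\<lambda>z. norm z) has_derivative (\<lambda>h. inner h (sgn z))) (at z)"
    using has_derivative_norm[OF assms] by simp
  have e: "of_real (norm z) powr c = exp (c * of_real (ln (norm z)))" if "z \<noteq> 0" for z :: plane
    using that by (simp add: powr_def Ln_of_real)
  have "((\<lambda>z. exp (c * of_real (ln (norm z)))) has_derivative
     (\<lambda>h. (c * of_real (inner h (sgn z) * inverse (norm z))) * exp (c * of_real (ln (norm z))))) (at z)"
    using has_derivative_compose[OF has_derivative_mult_right[OF has_derivative_of_real[OF
          DERIV_compose_FDERIV[where g=norm and x=z, OF DERIV_ln[OF n] 1]], of c]
        DERIV_exp[unfolded has_field_derivative_def]]
    by (simp add: mult.commute)
  moreover have "(c * of_real (inner h (sgn z) * inverse (norm z))) * exp (c * of_real (ln (norm z)))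
    = c * of_real (norm z) powr (c - 2) * of_real (fst z * fst h + snd z * snd h)" for h
  proof -
    have "of_real (norm z) powr (c - 2) = of_real (norm z) powr c / of_real (norm z)^2"
      using n by (simp add: powr_diff)
    moreover have "inner h (sgn z) * inverse (norm z) = (fst z * fst h + snd z * snd h) / (norm z)\<^sup>2"
      using n by (simp add: sgn_div_norm inner_prod_def power2_eq_square field_simps)
    ultimately show ?thesis using e[OF assms] by (simp add: field_simps)
  qed
  ultimately have "((\<lambda>z. exp (c * of_real (ln (norm z)))) has_derivative
    (\<lambda>h. c * of_real (norm z) powr (c - 2) * of_real (fst z * fst h + snd z * snd h))) (at z)"
    by (simp only:)
  then show ?thesis
    by (rule has_derivative_transform_within_open[of _ _ _ _ "UNIV - {0}"]) (use assms e in auto)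
qed

lemma pd_norm_powr:
  fixes z :: plane
  assumes "z \<noteq> 0"
  shows "pdx (\<lambda>z. of_real (norm z) powr c) z = c * of_real (fst z) * of_real (norm z) powr (c - 2)"
    "pdy (\<lambda>z. of_real (norm z) powr c) z = c * of_real (snd z) * of_real (norm z) powr (c - 2)"
  using norm_powr_has_derivative[OF assms, of c] by (simp_all add: pdx_eq pdy_eq)

lemma smooth_on_norm_powr: "smooth_on (UNIV - {0::plane}) (\<lambda>z. of_real (norm z) powr c)"
proof -
  have D: "(\<lambda>z. of_real (norm z) powr c) differentiable (at z)" if "z \<noteq> 0" for z :: plane and c :: complex
    using norm_powr_has_derivative[OF that] unfolding differentiable_def by blast
  have "Ck_on k (UNIV - {0::plane}) (\<lambda>z. of_real (norm z) powr c)" for k c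
  proof (induction k arbitrary: c)
    case 0
    then show ?case using D
      by (auto intro!: differentiable_imp_continuous_within continuous_at_imp_continuous_on)
  next
    case (Suc k)
    have "Ck_on k (UNIV - {0::plane}) (\<lambda>z. c * of_real (fst z) * of_real (norm z) powr (c - 2))"
      "Ck_on k (UNIV - {0::plane}) (\<lambda>z. c * of_real (snd z) * of_real (norm z) powr (c - 2))"
      using smooth_on_fst smooth_on_snd
      by (auto intro!: Ck_on_mult Ck_on_const Suc.IH open_delete simp: smooth_on_def)
    moreover have "Ck_on k (UNIV - {0::plane}) (pdx (\<lambda>z. of_real (norm z) powr c)) =
        Ck_on k (UNIV - {0}) (\<lambda>z. c * of_real (fst z) * of_real (norm z) powr (c - 2))"
      "Ck_on k (UNIV - {0::plane}) (pdy (\<lambda>z. of_real (norm z) powr c)) =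
        Ck_on k (UNIV - {0}) (\<lambda>z. c * of_real (snd z) * of_real (norm z) powr (c - 2))"
      by (intro Ck_on_cong; simp add: pd_norm_powr open_delete)+
    ultimately show ?case using D by auto
  qed
  then show ?thesis by (simp add: smooth_on_def)
qed

section \<open>Periodic solutions of the angular equation\<close>

text \<open>Based on \<open>closed_segment\<close>, so that no order of \<open>a\<close> and
  \<open>b\<close> is required; it is applied on either side of 0.\<close>

lemma vector_derivative_bound:
  fixes f :: "real \<Rightarrow> 'a::real_normed_vector"
  assumes "\<And>t. t \<in> closed_segment a b \<Longrightarrow> (f has_vector_derivative f' t) (at t)"
    and "\<And>t. t \<in> closed_segment a b \<Longrightarrow> norm (f' t) \<le> C"
  shows "norm (f b - f a) \<le> C * \<bar>b - a\<bar>"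
proof -
  have "norm (f b - f a) \<le> C * norm (b - a)"
  proof (rule differentiable_bound[of "closed_segment a b" f "\<lambda>t h. h *\<^sub>R f' t" C b a])
    show "(f has_derivative (\<lambda>h. h *\<^sub>R f' t)) (at t within closed_segment a b)"
      if "t \<in> closed_segment a b" for t
      using assms(1)[OF that] by (auto simp: has_vector_derivative_def intro: has_derivative_at_withinI)
    show "onorm (\<lambda>h. h *\<^sub>R f' t) \<le> C" if "t \<in> closed_segment a b" for t
      using mult_left_mono[OF assms(2)[OF that] abs_ge_zero]
      by (intro onorm_le) (simp add: mult.commute)
  qed auto
  then show ?thesis by simp
qed

lemma continuous_antiderivative:
  fixes f :: "real \<Rightarrow> complex"
  assumes "continuous_on UNIV f"
  obtains F where "\<And>t. (F has_vector_derivative f t) (at t)" "F a = 0"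
proof -
  have "\<exists>F. \<forall>x. -\<infinity> < ereal x \<longrightarrow> ereal x < \<infinity> \<longrightarrow> (F has_vector_derivative f x) (at x)"
    using assms by (intro einterval_antiderivative) (auto simp: continuous_on_eq_continuous_at)
  then obtain F where F: "\<And>x. (F has_vector_derivative f x) (at x)" by auto
  show ?thesis
  proof (rule that[of "\<lambda>t. F t - F a"])
    show "((\<lambda>t. F t - F a) has_vector_derivative f t) (at t)" for t
      using has_vector_derivative_diff[OF F has_vector_derivative_const] by simp
  qed simp
qed

lemma same_vector_derivative_diff:
  fixes F G :: "real \<Rightarrow> complex"
  assumes "\<And>t. (F has_vector_derivative f t) (at t)" "\<And>t. (G has_vector_derivative f t) (at t)"
  shows "F t - G t = F a - G a"
proof -
  have "norm ((F t - G t) - (F a - G a)) \<le> 0 * \<bar>t - a\<bar>"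
    by (rule vector_derivative_bound[where f'="\<lambda>t. 0"])
      (use has_vector_derivative_diff[OF assms] in simp_all)
  then show ?thesis by simp
qed

lemma has_vector_derivative_shift:
  assumes "\<And>t. (F has_vector_derivative f t) (at t)"
  shows "((\<lambda>t. F (t + c)) has_vector_derivative f (t + c)) (at (t::real))"
  using vector_diff_chain_at[of "\<lambda>t. t + c" 1 t F "f (t + c)"] assms
    has_vector_derivative_add[OF has_vector_derivative_id has_vector_derivative_const[of c]]
  by (simp add: o_def)

text \<open>Variation of constants with the integral taken over one period. \<open>E\<close> solves
  the homogeneous equation and has multiplier \<open>e\<close> over a period; the increment over a
  period of an antiderivative of G/E has multiplier 1/e, so its product with \<open>E\<close> is
  periodic. No initial value has to be fitted, and the only small divisor is 1/e - 1. The bound is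
  stated on \<open>{-pi..pi}\<close> because this contains the values of \<open>Arg\<close>.\<close>

lemma periodic_ode:
  fixes k G :: "real \<Rightarrow> complex" and s \<mu> :: complex
  assumes k: "continuous_on UNIV k" "\<And>t. k (t + 2 * pi) = k t" "\<And>t. norm (k t) \<le> K"
    and G: "continuous_on UNIV G" "\<And>t. G (t + 2 * pi) = G t" "\<And>t. norm (G t) \<le> M"
    and mu: "\<mu> = 1 / (2 * of_real pi) * integral {0..2 * pi} k"
    and nz: "exp (2 * of_real pi * \<i> * \<mu> * s) \<noteq> 1"
  shows "\<exists>v. (\<forall>t. (v has_vector_derivative \<i> * s * k t * v t + G t) (at t)) \<and>
    (\<forall>t. v (t + 2 * pi) = v t) \<and>
    (\<forall>t\<in>{-pi..pi}. norm (v t) \<le> 2 * pi * M * exp (norm s * (6 * pi * K + 2 * pi * norm \<mu>)) /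
       norm (1 - exp (2 * of_real pi * \<i> * \<mu> * s)))"
proof -
  obtain Q where Q: "\<And>t. (Q has_vector_derivative k t) (at t)" and Q0: "Q 0 = 0"
    using continuous_antiderivative[OF k(1)] by metis
  define e where "e = exp (2 * of_real pi * \<i> * \<mu> * s)"
  have e: "e \<noteq> 0" "e \<noteq> 1" using nz by (auto simp: e_def)
  define E where "E t = exp (\<i> * s * Q t)" for t
  \<comment> \<open>Periodicity of \<open>k\<close> makes the increment of \<open>Q\<close> over a
    period constant; at t = 0 it is the integral that defines \<mu>.\<close>
  have Qper: "Q (t + 2 * pi) = Q t + 2 * of_real pi * \<mu>" for t
  proof -
    have "((\<lambda>t. Q (t + 2 * pi)) has_vector_derivative k t) (at t)" for t
      using has_vector_derivative_shift[OF Q, of "2 * pi" t] k(2) by simp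
    from same_vector_derivative_diff[OF this Q, of t 0] Q0
    have "Q (t + 2 * pi) - Q t = Q (2 * pi)" by simp
    moreover have "(k has_integral (Q (2 * pi) - Q 0)) {0..2 * pi}"
      by (intro fundamental_theorem_of_calculus) (auto intro: has_vector_derivative_at_within Q)
    then have "integral {0..2 * pi} k = Q (2 * pi)" using Q0 by (simp add: integral_unique)
    then have "2 * of_real pi * \<mu> = Q (2 * pi)" by (simp add: mu)
    ultimately show ?thesis by (simp add: algebra_simps)
  qed
  have E: "(E has_vector_derivative \<i> * s * k t * E t) (at t)" for t
  proof -
    have "((\<lambda>t. \<i> * s * Q t) has_vector_derivative \<i> * s * k t) (at t)"
      by (rule has_vector_derivative_mult_right[OF Q])
    from field_vector_diff_chain_at[OF this DERIV_exp] show ?thesis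
      by (simp add: o_def E_def[abs_def])
  qed
  have Enz: "E t \<noteq> 0" for t by (simp add: E_def)
  have Eper: "E (t + 2 * pi) = e * E t" for t
    unfolding E_def e_def Qper by (simp add: ring_distribs exp_add mult_ac)
  have contE: "continuous_on UNIV E"
    using E by (auto intro!: continuous_at_imp_continuous_on has_vector_derivative_continuous)
  obtain H where H: "\<And>t. (H has_vector_derivative G t / E t) (at t)" and "H 0 = 0"
    using continuous_antiderivative[of "\<lambda>t. G t / E t"] G(1) contE Enz
    by (metis continuous_on_divide)
  define D where "D t = H (t + 2 * pi) - H t" for t
  \<comment> \<open>\<open>D\<close> has derivative \<open>1 / e - 1\<close> times G/E; this
    constant normalizes it to G/E.\<close>
  define c where "c = 1 / (1 / e - 1)"
  have D: "(D has_vector_derivative (1 / e - 1) * (G t / E t)) (at t)" for t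
  proof -
    have "(D has_vector_derivative G (t + 2 * pi) / E (t + 2 * pi) - G t / E t) (at t)"
      unfolding D_def[abs_def] by (intro has_vector_derivative_diff has_vector_derivative_shift H)
    moreover have "G (t + 2 * pi) / E (t + 2 * pi) - G t / E t = (1 / e - 1) * (G t / E t)"
      using e Enz[of t] unfolding Eper G(2) by (simp add: field_simps)
    ultimately show ?thesis by (simp only:)
  qed
  have Dper: "D (t + 2 * pi) = D t / e" for t
  proof -
    have "((\<lambda>t. H (t + 2 * pi)) has_vector_derivative (G t / E t) / e) (at t)" for t
      using has_vector_derivative_shift[OF H, of "2 * pi" t] unfolding Eper G(2) by (simp add: mult.commute[of e])
    moreover have "((\<lambda>t. H t / e) has_vector_derivative (G t / E t) / e) (at t)" for t
      using has_vector_derivative_divide[OF H] by blast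
    ultimately have "H (t + 2 * pi + 2 * pi) - H (t + 2 * pi) / e = H (t + 2 * pi) - H t / e"
      using same_vector_derivative_diff[of "\<lambda>t. H (t + 2 * pi)" "\<lambda>t. (G t / E t) / e" "\<lambda>t. H t / e" "t + 2 * pi" t]
      by simp
    then show ?thesis by (simp add: D_def diff_divide_distrib) (simp add: algebra_simps)
  qed
  have c: "c * (1 / e - 1) = 1" using e by (simp add: c_def field_simps)
  define v where "v t = c * (E t * D t)" for t
  have v1: "(v has_vector_derivative \<i> * s * k t * v t + G t) (at t)" for t
  proof -
    have "(v has_vector_derivative c * (E t * ((1 / e - 1) * (G t / E t)) + \<i> * s * k t * E t * D t)) (at t)"
      unfolding v_def[abs_def]
      by (intro has_vector_derivative_mult_right has_vector_derivative_mult E D)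
    moreover have "c * (E t * ((1 / e - 1) * (G t / E t)) + \<i> * s * k t * E t * D t)
      = (c * (1 / e - 1)) * G t + \<i> * s * k t * v t"
    proof -
      have "E t * ((1 / e - 1) * (G t / E t)) = (1 / e - 1) * G t" using Enz[of t] by simp
      then show ?thesis by (simp only: v_def distrib_left) (simp only: mult_ac)
    qed
    ultimately show ?thesis using c by (simp add: add.commute)
  qed
  have v2: "v (t + 2 * pi) = v t" for t using e by (simp add: v_def Eper Dper)
  \<comment> \<open>For t in \<open>{-pi..pi}\<close> the period starting at t ends at most at 3 pi,
    where \<open>Q\<close> is bounded by 3 pi K. The bound enters twice, for \<open>E\<close> and
    for its reciprocal, whence the 6 pi K in the exponent.\<close>
  define B where "B = exp (norm s * (3 * pi * K))"
  have K0: "K \<ge> 0" using k(3)[of 0] norm_ge_zero order_trans by blast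
  have M0: "M \<ge> 0" using G(3)[of 0] norm_ge_zero order_trans by blast
  have EB: "norm (E t) \<le> B" "norm (1 / E t) \<le> B" if "\<bar>t\<bar> \<le> 3 * pi" for t
  proof -
    have "norm (Q t - Q 0) \<le> K * \<bar>t - 0\<bar>"
      by (rule vector_derivative_bound[OF Q k(3)])
    also have "\<dots> \<le> K * (3 * pi)" using that K0 by (intro mult_left_mono) auto
    finally have "norm (\<i> * s * Q t) \<le> norm s * (3 * pi * K)"
      using Q0 by (simp add: norm_mult mult_left_mono mult.commute)
    then have "exp (norm (\<i> * s * Q t)) \<le> B" "exp (norm (- (\<i> * s * Q t))) \<le> B"
      by (simp_all only: B_def exp_le_cancel_iff norm_minus_cancel)
    from order_trans[OF norm_exp this(1)] order_trans[OF norm_exp this(2)]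
    show "norm (E t) \<le> B" "norm (1 / E t) \<le> B"
      by (simp_all only: E_def exp_minus inverse_eq_divide)
  qed
  have v3: "norm (v t) \<le> 2 * pi * M * exp (norm s * (6 * pi * K + 2 * pi * norm \<mu>)) / norm (1 - e)"
    if "t \<in> {-pi..pi}" for t
  proof -
    have "norm (H (t + 2 * pi) - H t) \<le> (M * B) * \<bar>t + 2 * pi - t\<bar>"
    proof (rule vector_derivative_bound[OF H])
      fix u assume "u \<in> closed_segment t (t + 2 * pi)"
      then have "\<bar>u\<bar> \<le> 3 * pi" using that by (auto simp: closed_segment_eq_real_ivl split: if_splits)
      from mult_mono[OF G(3)[of u] EB(2)[OF this]] M0
      show "norm (G u / E u) \<le> M * B" by (simp add: norm_divide)
    qed
    then have DB: "norm (D t) \<le> 2 * pi * M * B" by (simp add: D_def mult_ac)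
    have "\<bar>t\<bar> \<le> 3 * pi" using that by auto
    then have "norm (E t * D t) \<le> B * (2 * pi * M * B)"
      unfolding norm_mult using DB EB(1) by (intro mult_mono) (auto simp: B_def)
    moreover have "norm c \<le> exp (norm s * (2 * pi * norm \<mu>)) / norm (1 - e)"
    proof -
      have "c = e / (1 - e)" using e by (simp add: c_def field_simps)
      moreover have "norm e \<le> exp (norm s * (2 * pi * norm \<mu>))"
        unfolding e_def by (rule order_trans[OF norm_exp]) (simp add: norm_mult)
      ultimately show ?thesis by (simp add: norm_divide divide_right_mono)
    qed
    ultimately have "norm (v t) \<le> exp (norm s * (2 * pi * norm \<mu>)) / norm (1 - e) * (B * (2 * pi * M * B))"
      unfolding v_def norm_mult[of c] by (intro mult_mono) auto
    also have "\<dots> = 2 * pi * M * exp (norm s * (6 * pi * K + 2 * pi * norm \<mu>)) / norm (1 - e)"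
    proof -
      have "exp (norm s * (6 * pi * K + 2 * pi * norm \<mu>)) = exp (norm s * (2 * pi * norm \<mu>)) * B * B"
        by (simp add: B_def algebra_simps flip: exp_add)
      then show ?thesis by simp
    qed
    finally show ?thesis .
  qed
  show ?thesis
    using v1 v2 v3 unfolding e_def by blast
qed

section \<open>The polar angle as a function on the plane\<close>

definition cpx :: "plane \<Rightarrow> complex" where
  "cpx z = of_real (fst z) + \<i> * of_real (snd z)"

lemma cpx_has_derivative: "(cpx has_derivative cpx) (at z)"
proof -
  have "((\<lambda>z. of_real (fst z) + \<i> * of_real (snd z)) has_derivative
      (\<lambda>h. of_real (fst h) + \<i> * of_real (snd h))) (at z)"
    by (intro has_derivative_add has_derivative_mult_right has_derivative_coords)
  then show ?thesis by (simp add: cpx_def[abs_def])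
qed

lemma norm_cpx: "norm (cpx z) = norm z"
  by (cases z) (simp add: cpx_def norm_complex_def norm_Pair cmod_def)

lemma cpx_eq_0 [simp]: "cpx z = 0 \<longleftrightarrow> z = 0"
  using norm_cpx[of z] by (metis norm_eq_zero)

lemma cpx_Arg: "z \<noteq> 0 \<Longrightarrow> z = norm z *\<^sub>R (cos (Arg (cpx z)), sin (Arg (cpx z)))"
proof -
  assume "z \<noteq> 0"
  then have "cpx z = of_real (norm z) * exp (\<i> * of_real (Arg (cpx z)))"
    using Arg_eq[of "cpx z"] by (simp add: norm_cpx)
  then have "cpx z = rcis (norm z) (Arg (cpx z))" by (simp add: rcis_def cis_conv_exp)
  then have "Re (cpx z) = norm z * cos (Arg (cpx z))" "Im (cpx z) = norm z * sin (Arg (cpx z))"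
    by (metis Re_rcis, metis Im_rcis)
  then show ?thesis by (simp add: cpx_def prod_eq_iff)
qed

lemma periodic_int:
  fixes v :: "real \<Rightarrow> 'a"
  assumes "\<And>t. v (t + 2 * pi) = v t"
  shows "v (t + 2 * pi * of_int n) = v t"
proof -
  have *: "v (t + 2 * pi * of_nat m) = v t" for t m
  proof (induction m)
    case (Suc m)
    then show ?case using assms[of "t + 2 * pi * of_nat m"] by (simp add: algebra_simps)
  qed simp
  show ?thesis
  proof (cases "n \<ge> 0")
    case True
    then show ?thesis using *[of t "nat n"] by simp
  next
    case False
    then show ?thesis using *[of "t + 2 * pi * of_int n" "nat (- n)"] by simp
  qed
qed

text \<open>\<open>Arg\<close> jumps on the negative real axis, but \<open>v\<close> does not see
  multiples of 2 pi. Near \<open>z\<close> the angle is replaced by the branch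
  \<open>\<phi>\<close>, obtained by rotating \<open>z\<close> with \<open>u\<close> to the positive
  real axis, where \<open>Ln\<close> is differentiable. The scalar factor in the derivative is
  d\<theta> = (x dy - y dx) / r^2.\<close>

lemma angular_has_derivative:
  fixes v v' :: "real \<Rightarrow> complex"
  assumes v: "\<And>t. (v has_vector_derivative v' t) (at t)"
    and per: "\<And>t. v (t + 2 * pi) = v t" and z: "z \<noteq> 0"
  shows "((\<lambda>z. v (Arg (cpx z))) has_derivative
    (\<lambda>h. of_real ((fst z * snd h - snd z * fst h) / (norm z)\<^sup>2) * v' (Arg (cpx z)))) (at z)"
proof -
  define t where "t = Arg (cpx z)"
  define u where "u = exp (- (\<i> * of_real t))"
  define \<phi> where "\<phi> z' = t + Im (Ln (cpx z' * u))" for z'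
  have u: "cpx z * u = of_real (norm z)"
  proof -
    have "exp (\<i> * of_real t) * u = 1" by (simp add: u_def exp_minus)
    moreover have "cpx z = of_real (norm z) * exp (\<i> * of_real t)"
      using Arg_eq[of "cpx z"] z by (simp add: t_def norm_cpx)
    ultimately show ?thesis by (metis mult.assoc mult.right_neutral)
  qed
  have v\<phi>: "v (\<phi> z') = v (Arg (cpx z'))" if "z' \<noteq> 0" for z'
  proof -
    have nz: "cpx z' * u \<noteq> 0" using that by (simp add: u_def)
    have "of_real (norm z') * exp (\<i> * of_real (\<phi> z')) = cpx z'"
    proof -
      have "cpx z' * u = of_real (norm z') * exp (\<i> * of_real (Im (Ln (cpx z' * u))))"
        using Arg_eq[OF nz] Arg_eq_Im_Ln[OF nz] by (simp add: norm_mult norm_cpx u_def)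
      then have "of_real (norm z') * exp (\<i> * of_real (\<phi> z')) = exp (\<i> * of_real t) * (cpx z' * u)"
        by (simp add: \<phi>_def algebra_simps exp_add)
      also have "\<dots> = cpx z'" by (simp add: u_def exp_minus)
      finally show ?thesis .
    qed
    also have "\<dots> = of_real (norm z') * exp (\<i> * of_real (Arg (cpx z')))"
      using Arg_eq[of "cpx z'"] that by (simp add: norm_cpx)
    finally have "exp (\<i> * of_real (\<phi> z')) = exp (\<i> * of_real (Arg (cpx z')))" using that by simp
    then obtain n :: int where "\<i> * of_real (\<phi> z') = \<i> * of_real (Arg (cpx z')) + of_real (of_int (2 * n) * pi) * \<i>"
      by (auto simp: exp_eq)
    then have "\<i> * of_real (\<phi> z') = \<i> * of_real (Arg (cpx z') + 2 * pi * of_int n)"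
      by (simp add: algebra_simps)
    then have "\<phi> z' = Arg (cpx z') + 2 * pi * of_int n"
      by (metis complex_i_not_zero mult_cancel_left of_real_eq_iff)
    then show ?thesis using periodic_int[of v, OF per] by simp
  qed
  have "((\<lambda>z'. Ln (cpx z' * u)) has_derivative (\<lambda>h. inverse (cpx z * u) * (cpx h * u))) (at z)"
  proof -
    have "cpx z * u \<notin> \<real>\<^sub>\<le>\<^sub>0" using u z by (simp add: complex_nonpos_Reals_iff)
    then have "(Ln has_derivative (*) (inverse (cpx z * u))) (at (cpx z * u))"
      using has_field_derivative_Ln has_field_derivative_def by (metis inverse_eq_divide)
    from has_derivative_compose[OF has_derivative_mult_left[OF cpx_has_derivative] this]
    show ?thesis .
  qed
  from has_derivative_Im[OF this]
  have d\<phi>: "(\<phi> has_derivative (\<lambda>h. (fst z * snd h - snd z * fst h) / (norm z)\<^sup>2)) (at z)"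
  proof -
    assume 1: "((\<lambda>z'. Im (Ln (cpx z' * u))) has_derivative (\<lambda>h. Im (inverse (cpx z * u) * (cpx h * u)))) (at z)"
    have "Im (inverse (cpx z * u) * (cpx h * u)) = (fst z * snd h - snd z * fst h) / (norm z)\<^sup>2" for h
    proof -
      have "inverse (cpx z * u) * (cpx h * u) = cpx h / cpx z" using z by (simp add: u_def field_simps)
      moreover have "(norm z)\<^sup>2 = (fst z)\<^sup>2 + (snd z)\<^sup>2" by (cases z) (simp add: norm_Pair)
      ultimately show ?thesis by (simp add: Im_divide cpx_def mult.commute)
    qed
    with 1 have "((\<lambda>z'. Im (Ln (cpx z' * u))) has_derivative (\<lambda>h. (fst z * snd h - snd z * fst h) / (norm z)\<^sup>2)) (at z)"
      by (simp only:)
    from has_derivative_add[OF has_derivative_const this, of t]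
    show ?thesis by (simp add: \<phi>_def[abs_def])
  qed
  have \<phi>z: "\<phi> z = t" using u z by (simp add: \<phi>_def)
  have "((\<lambda>z'. v (\<phi> z')) has_derivative
     (\<lambda>h. ((fst z * snd h - snd z * fst h) / (norm z)\<^sup>2) *\<^sub>R v' t)) (at z)"
    using has_derivative_compose[OF d\<phi>, of v "\<lambda>h. h *\<^sub>R v' t"] v[of t] \<phi>z
    by (simp add: has_vector_derivative_def)
  then have "((\<lambda>z'. v (Arg (cpx z'))) has_derivative
     (\<lambda>h. ((fst z * snd h - snd z * fst h) / (norm z)\<^sup>2) *\<^sub>R v' t)) (at z)"
    by (rule has_derivative_transform_within_open[of _ _ _ _ "UNIV - {0}"]) (use z v\<phi> in auto)
  then show ?thesis by (simp only: scaleR_conv_of_real t_def)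
qed

section \<open>Series of differentiable functions and power series\<close>

text \<open>The Weierstrass test gives uniform convergence of both series of partial derivatives on
  the ball. The error of the differential in direction h is at most |h| times the sum of the two
  partial errors, since each coordinate of h is at most |h|; hence \<open>e / 2\<close> for
  each.\<close>

lemma suminf_pd:
  fixes F :: "nat \<Rightarrow> plane \<Rightarrow> complex"
  assumes r: "r > 0" and b: "summable b"
    and F: "\<And>j z'. z' \<in> ball z r \<Longrightarrow> F j differentiable (at z')"
    and bd: "\<And>j z'. z' \<in> ball z r \<Longrightarrow> norm (F j z') \<le> b j"
      "\<And>j z'. z' \<in> ball z r \<Longrightarrow> norm (pdx (F j) z') \<le> b j"
      "\<And>j z'. z' \<in> ball z r \<Longrightarrow> norm (pdy (F j) z') \<le> b j"
  shows "(\<lambda>z. \<Sum>j. F j z) differentiable (at z)"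
    "pdx (\<lambda>z. \<Sum>j. F j z) z = (\<Sum>j. pdx (F j) z)"
    "pdy (\<lambda>z. \<Sum>j. F j z) z = (\<Sum>j. pdy (F j) z)"
proof -
  define S where "S = ball z r"
  have zS: "z \<in> S" using r by (simp add: S_def)
  define D where "D j z' h = of_real (fst h) * pdx (F j) z' + of_real (snd h) * pdy (F j) z'"
    for j z' and h :: plane
  define E where "E z' h = of_real (fst h) * (\<Sum>j. pdx (F j) z') + of_real (snd h) * (\<Sum>j. pdy (F j) z')"
    for z' and h :: plane
  have ux: "uniform_limit S (\<lambda>n z. \<Sum>j<n. pdx (F j) z) (\<lambda>z. \<Sum>j. pdx (F j) z) sequentially"
    and uy: "uniform_limit S (\<lambda>n z. \<Sum>j<n. pdy (F j) z) (\<lambda>z. \<Sum>j. pdy (F j) z) sequentially"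
    using bd b by (auto intro!: Weierstrass_m_test simp: S_def simp del: mem_ball)
  have "\<exists>g. \<forall>x\<in>S. (\<lambda>n. F n x) sums g x \<and> (g has_derivative E x) (at x within S)"
  proof (rule has_derivative_series[of S F D E z "\<Sum>j. F j z"])
    show "(F n has_derivative D n x) (at x within S)" if "x \<in> S" for n x
      using has_derivative_pd[OF F[of x n]] that
      by (auto simp: D_def[abs_def] S_def intro: has_derivative_at_withinI)
    show "(\<lambda>n. F n z) sums (\<Sum>j. F j z)"
      by (rule summable_sums, rule summable_comparison_test'[OF b]) (use bd(1) r in auto)
    fix e :: real assume e: "e > 0"
    from e have "e / 2 > 0" by simp
    with uniform_limitD[OF ux, of "e/2"] uniform_limitD[OF uy, of "e/2"]
    have "\<forall>\<^sub>F n in sequentially. (\<forall>x\<in>S. dist (\<Sum>j<n. pdx (F j) x) (\<Sum>j. pdx (F j) x) < e / 2) \<and>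
      (\<forall>x\<in>S. dist (\<Sum>j<n. pdy (F j) x) (\<Sum>j. pdy (F j) x) < e / 2)"
      by (simp add: eventually_conj)
    then show "\<forall>\<^sub>F n in sequentially. \<forall>x\<in>S. \<forall>h. norm ((\<Sum>i<n. D i x h) - E x h) \<le> e * norm h"
    proof (eventually_elim, intro ballI allI)
      fix n x and h :: plane
      assume *: "(\<forall>x\<in>S. dist (\<Sum>j<n. pdx (F j) x) (\<Sum>j. pdx (F j) x) < e / 2) \<and>
        (\<forall>x\<in>S. dist (\<Sum>j<n. pdy (F j) x) (\<Sum>j. pdy (F j) x) < e / 2)" and "x \<in> S"
      let ?X = "(\<Sum>j<n. pdx (F j) x) - (\<Sum>j. pdx (F j) x)"
      let ?Y = "(\<Sum>j<n. pdy (F j) x) - (\<Sum>j. pdy (F j) x)"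
      have "norm ?X \<le> e / 2" "norm ?Y \<le> e / 2"
        using * \<open>x \<in> S\<close> by (auto simp: dist_norm less_imp_le)
      moreover have "(\<Sum>i<n. D i x h) - E x h = of_real (fst h) * ?X + of_real (snd h) * ?Y"
        by (simp add: D_def E_def sum.distrib sum_distrib_left algebra_simps)
      moreover have "norm (fst h) \<le> norm h" "norm (snd h) \<le> norm h"
        by (metis norm_fst_le prod.collapse) (metis norm_snd_le prod.collapse)
      moreover have "norm (of_real a * w :: complex) \<le> norm h * (e / 2)"
        if "norm w \<le> e / 2" "norm a \<le> norm h" for a :: real and w
        using that unfolding norm_mult norm_of_real by (intro mult_mono) auto
      ultimately have "norm ((\<Sum>i<n. D i x h) - E x h) \<le> norm h * (e / 2) + norm h * (e / 2)"
        by (metis norm_triangle_le add_mono)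
      then show "norm ((\<Sum>i<n. D i x h) - E x h) \<le> e * norm h" by (simp add: mult.commute)
    qed
  qed (use zS S_def in auto)
  then obtain g where g: "\<And>x. x \<in> S \<Longrightarrow> (\<lambda>n. F n x) sums g x"
    "(g has_derivative E z) (at z within S)" using zS by blast
  then have "(g has_derivative E z) (at z)"
    using zS at_within_open[of z S] by (simp add: S_def)
  then have D: "((\<lambda>z. \<Sum>j. F j z) has_derivative E z) (at z)"
    by (rule has_derivative_transform_within_open[of _ _ _ _ S]) (use zS g(1) sums_unique in \<open>auto simp: S_def\<close>)
  then show "(\<lambda>z. \<Sum>j. F j z) differentiable (at z)" by (rule differentiableI)
  from pdx_eq[OF D] pdy_eq[OF D]
  show "pdx (\<lambda>z. \<Sum>j. F j z) z = (\<Sum>j. pdx (F j) z)" "pdy (\<lambda>z. \<Sum>j. F j z) z = (\<Sum>j. pdy (F j) z)"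
    by (simp_all add: E_def)
qed

section \<open>Homogeneous polynomials and power series in two variables\<close>

definition hpoly :: "(nat \<Rightarrow> nat \<Rightarrow> complex) \<Rightarrow> nat \<Rightarrow> plane \<Rightarrow> complex" where
  "hpoly c j z = (\<Sum>m\<le>j. c m (j - m) * of_real (fst z) ^ m * of_real (snd z) ^ (j - m))"

text \<open>A plain geometric bound on the coefficients would lose some radius at each
  differentiation. Decay faster than every power of the degree is preserved at the same \<rho> by
  \<open>coeff_dx\<close>, \<open>coeff_dy\<close> and \<open>coeff_euler\<close>, so that
  inductions on the order of smoothness stay on one disc.\<close>

definition rapid_decay :: "real \<Rightarrow> (nat \<Rightarrow> nat \<Rightarrow> complex) \<Rightarrow> bool" where
  "rapid_decay \<rho> c \<longleftrightarrow> (\<forall>d. \<exists>K. \<forall>m n. real (m + n + 1) ^ d * norm (c m n) * \<rho> ^ (m + n) \<le> K)"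

definition coeff_dx :: "(nat \<Rightarrow> nat \<Rightarrow> complex) \<Rightarrow> nat \<Rightarrow> nat \<Rightarrow> complex" where
  "coeff_dx c m n = of_nat (Suc m) * c (Suc m) n"

definition coeff_dy :: "(nat \<Rightarrow> nat \<Rightarrow> complex) \<Rightarrow> nat \<Rightarrow> nat \<Rightarrow> complex" where
  "coeff_dy c m n = of_nat (Suc n) * c m (Suc n)"

text \<open>Coefficients after \<open>k\<close> applications of the Euler operator, which multiplies
  the part of degree j by j.\<close>

definition coeff_euler :: "nat \<Rightarrow> (nat \<Rightarrow> nat \<Rightarrow> complex) \<Rightarrow> nat \<Rightarrow> nat \<Rightarrow> complex" where
  "coeff_euler k c m n = of_nat (m + n) ^ k * c m n"

lemma hpoly_scale: "hpoly c j (r *\<^sub>R z) = of_real r ^ j * hpoly c j z"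
proof -
  have "of_real r ^ m * of_real r ^ (j - m) = (of_real r ^ j :: complex)" if "m \<le> j" for m
    using that by (simp flip: power_add)
  then show ?thesis
    by (auto simp: hpoly_def sum_distrib_left power_mult_distrib intro!: sum.cong)
qed

lemma hpoly_euler: "hpoly (coeff_euler k c) j z = of_nat j ^ k * hpoly c j z"
  by (auto simp: hpoly_def coeff_euler_def sum_distrib_left mult_ac intro!: sum.cong)

lemma hpoly_has_derivative:
  "(hpoly c j has_derivative (\<lambda>h. \<Sum>m\<le>j. c m (j - m) *
     (of_real (fst z) ^ m * (of_nat (j - m) * of_real (snd h) * of_real (snd z) ^ (j - m - 1)) +
      (of_nat m * of_real (fst h) * of_real (fst z) ^ (m - 1)) * of_real (snd z) ^ (j - m)))) (at z)"
  unfolding hpoly_def[abs_def] mult.assoc[of "c _ _"]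
  by (intro has_derivative_sum has_derivative_mult_right has_derivative_mult has_derivative_power
      has_derivative_coords)

lemma hpoly_differentiable: "hpoly c j differentiable (at z)"
  by (rule differentiableI[OF hpoly_has_derivative])

lemma pd_hpoly_0: "pdx (hpoly c 0) z = 0" "pdy (hpoly c 0) z = 0"
  by (simp_all add: pdx_eq[OF hpoly_has_derivative] pdy_eq[OF hpoly_has_derivative])

lemma pdx_hpoly_Suc: "pdx (hpoly c (Suc j)) z = hpoly (coeff_dx c) j z"
  unfolding pdx_eq[OF hpoly_has_derivative] sum.atMost_Suc_shift
  by (auto simp: hpoly_def coeff_dx_def mult_ac intro!: sum.cong)

lemma pdy_hpoly_Suc: "pdy (hpoly c (Suc j)) z = hpoly (coeff_dy c) j z"
  unfolding pdy_eq[OF hpoly_has_derivative] sum.atMost_Suc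
  by (auto simp: hpoly_def coeff_dy_def Suc_diff_le mult_ac intro!: sum.cong)

text \<open>The factor produced by differentiation is at most m + n + 2 and is paid for by passing
  from \<open>d\<close> to \<open>Suc d\<close>; the shift of the coefficient by one degree costs a
  factor 1/\<rho>.\<close>

lemma rapid_decay_dx: "\<rho> > 0 \<Longrightarrow> rapid_decay \<rho> c \<Longrightarrow> rapid_decay \<rho> (coeff_dx c)"
  and rapid_decay_dy: "\<rho> > 0 \<Longrightarrow> rapid_decay \<rho> c \<Longrightarrow> rapid_decay \<rho> (coeff_dy c)"
proof -
  assume \<rho>: "\<rho> > 0" and "rapid_decay \<rho> c"
  then have *: "\<exists>K. \<forall>m n. real (m + n + 1) ^ Suc d * norm (c m n) * \<rho> ^ (m + n) \<le> K" for d
    unfolding rapid_decay_def by blast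
  have le: "real (m + n + 1) ^ d * (real l * a) * \<rho> ^ (m + n) \<le> K / \<rho>"
    if "real (m + n + 2) ^ Suc d * a * \<rho> ^ (m + n + 1) \<le> K" "a \<ge> 0" "l \<le> m + n + 2" for m n d l a K
  proof -
    have "real (m + n + 1) ^ d * (real l * a) \<le> real (m + n + 2) ^ d * (real (m + n + 2) * a)"
      using that by (intro mult_mono power_mono mult_right_mono) auto
    then have "real (m + n + 1) ^ d * (real l * a) * \<rho> ^ (m + n) \<le>
        real (m + n + 2) ^ d * (real (m + n + 2) * a) * \<rho> ^ (m + n)"
      using \<rho> by (intro mult_right_mono) auto
    also have "\<dots> = real (m + n + 2) ^ Suc d * a * \<rho> ^ (m + n + 1) / \<rho>" using \<rho> by simp
    also have "\<dots> \<le> K / \<rho>" using that \<rho> by (intro divide_right_mono) auto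
    finally show ?thesis .
  qed
  show "rapid_decay \<rho> (coeff_dx c)"
    unfolding rapid_decay_def
  proof
    fix d
    obtain K where K: "\<And>m n. real (m + n + 1) ^ Suc d * norm (c m n) * \<rho> ^ (m + n) \<le> K"
      using *[of d] by blast
    have "real (m + n + 1) ^ d * norm (coeff_dx c m n) * \<rho> ^ (m + n) \<le> K / \<rho>" for m n
      using le[of m n d "norm (c (Suc m) n)" K "Suc m"] K[of "Suc m" n]
      unfolding coeff_dx_def norm_mult norm_of_nat by (simp add: add_ac)
    then show "\<exists>K. \<forall>m n. real (m + n + 1) ^ d * norm (coeff_dx c m n) * \<rho> ^ (m + n) \<le> K" by blast
  qed
  show "rapid_decay \<rho> (coeff_dy c)"
    unfolding rapid_decay_def
  proof
    fix d
    obtain K where K: "\<And>m n. real (m + n + 1) ^ Suc d * norm (c m n) * \<rho> ^ (m + n) \<le> K"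
      using *[of d] by blast
    have "real (m + n + 1) ^ d * norm (coeff_dy c m n) * \<rho> ^ (m + n) \<le> K / \<rho>" for m n
      using le[of m n d "norm (c m (Suc n))" K "Suc n"] K[of m "Suc n"]
      unfolding coeff_dy_def norm_mult norm_of_nat by (simp add: add_ac)
    then show "\<exists>K. \<forall>m n. real (m + n + 1) ^ d * norm (coeff_dy c m n) * \<rho> ^ (m + n) \<le> K" by blast
  qed
qed

lemma rapid_decay_euler:
  assumes "\<rho> > 0" "rapid_decay \<rho> c"
  shows "rapid_decay \<rho> (coeff_euler k c)"
  unfolding rapid_decay_def
proof
  fix d
  obtain K where K: "\<And>m n. real (m + n + 1) ^ (d + k) * norm (c m n) * \<rho> ^ (m + n) \<le> K"
    using assms(2) unfolding rapid_decay_def by blast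
  have "real (m + n + 1) ^ d * norm (coeff_euler k c m n) * \<rho> ^ (m + n) \<le> K" for m n
  proof -
    have "norm (coeff_euler k c m n) = real (m + n) ^ k * norm (c m n)"
      by (simp add: coeff_euler_def norm_mult norm_power flip: of_nat_add)
    also have "\<dots> \<le> real (m + n + 1) ^ k * norm (c m n)"
      by (intro mult_right_mono power_mono) auto
    finally have "real (m + n + 1) ^ d * norm (coeff_euler k c m n) * \<rho> ^ (m + n) \<le>
      real (m + n + 1) ^ d * (real (m + n + 1) ^ k * norm (c m n)) * \<rho> ^ (m + n)"
      using assms(1) by (intro mult_right_mono mult_left_mono) auto
    also have "\<dots> = real (m + n + 1) ^ (d + k) * norm (c m n) * \<rho> ^ (m + n)"
      by (simp only: power_add[of _ d k] mult.assoc)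
    finally show ?thesis using K[of m n] by linarith
  qed
  then show "\<exists>K. \<forall>m n. real (m + n + 1) ^ d * norm (coeff_euler k c m n) * \<rho> ^ (m + n) \<le> K" by blast
qed

lemma hpoly_bound:
  assumes "\<And>m n. m + n = j \<Longrightarrow> norm (c m n) \<le> C"
  shows "norm (hpoly c j z) \<le> real (j + 1) * C * norm z ^ j"
proof -
  have "norm (c m (j - m) * of_real (fst z) ^ m * of_real (snd z) ^ (j - m)) \<le> C * norm z ^ j"
    if "m \<le> j" for m
  proof -
    have "norm (fst z) \<le> norm z" "norm (snd z) \<le> norm z"
      by (metis norm_fst_le prod.collapse) (metis norm_snd_le prod.collapse)
    then have "norm (c m (j - m)) * (\<bar>fst z\<bar> ^ m * \<bar>snd z\<bar> ^ (j - m)) \<le> C * (norm z ^ m * norm z ^ (j - m))"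
      using assms[of m "j - m"] that order_trans[OF norm_ge_zero assms[of m "j - m"]]
      by (intro mult_mono power_mono) auto
    then show ?thesis using that by (simp add: norm_mult norm_power mult.assoc flip: power_add)
  qed
  then have "norm (hpoly c j z) \<le> (\<Sum>m\<le>j. C * norm z ^ j)"
    unfolding hpoly_def by (intro sum_norm_le) auto
  then show ?thesis by simp
qed

lemma hpoly_rapid_bound:
  assumes "\<rho> > 0" "rapid_decay \<rho> c"
  obtains K where "\<And>j z. z \<in> ball 0 \<rho> \<Longrightarrow> norm (hpoly c j z) \<le> K * (1 / real (Suc j) ^ 2)" "K \<ge> 0"
proof -
  \<comment> \<open>Exponent 3: one power compensates for the j + 1 monomials of degree j, the other
    two leave a summable majorant.\<close>
  obtain K where K: "\<And>m n. real (m + n + 1) ^ 3 * norm (c m n) * \<rho> ^ (m + n) \<le> K"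
    using assms(2) unfolding rapid_decay_def by blast
  have K0: "K \<ge> 0" by (rule order_trans[OF _ K[of 0 0]]) simp
  have "norm (hpoly c j z) \<le> K * (1 / real (Suc j) ^ 2)" if "z \<in> ball 0 \<rho>" for j z
  proof -
    have "norm (hpoly c j z) \<le> real (j + 1) * (K / (real (j + 1) ^ 3 * \<rho> ^ j)) * norm z ^ j"
      using K assms(1) by (intro hpoly_bound) (auto simp: field_simps)
    also have "\<dots> \<le> real (j + 1) * (K / (real (j + 1) ^ 3 * \<rho> ^ j)) * \<rho> ^ j"
      using that K0 assms(1) by (intro mult_left_mono power_mono) auto
    also have "\<dots> = K * (1 / real (Suc j) ^ 2)"
    proof -
      have "n * (K / (n ^ 3 * r)) * r = K * (1 / n ^ 2)" if "n \<noteq> 0" "r \<noteq> 0" for n r :: real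
        using that by (simp add: power2_eq_square power3_eq_cube)
      from this[of "real (j + 1)" "\<rho> ^ j"] assms(1) show ?thesis by simp
    qed
    finally show ?thesis .
  qed
  with K0 show ?thesis using that by blast
qed

lemma summable_inverse_Suc_square: "summable (\<lambda>j. 1 / real (Suc j) ^ 2)"
  using inverse_power_summable[of 2, where 'a=real] summable_Suc_iff[of "\<lambda>n. inverse (real n ^ 2)"]
  by (simp add: inverse_eq_divide)

lemma summable_hpoly:
  assumes "\<rho> > 0" "rapid_decay \<rho> c" "z \<in> ball 0 \<rho>"
  shows "summable (\<lambda>j. hpoly c j z)"
proof -
  obtain K where K: "\<And>j z. z \<in> ball 0 \<rho> \<Longrightarrow> norm (hpoly c j z) \<le> K * (1 / real (Suc j) ^ 2)"
    using hpoly_rapid_bound[OF assms(1,2)] by blast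
  show ?thesis
    by (rule summable_comparison_test'[OF summable_mult[OF summable_inverse_Suc_square, of K]])
      (use K[OF assms(3)] in auto)
qed

lemma psum_pd:
  assumes \<rho>: "\<rho> > 0" and c: "rapid_decay \<rho> c" and z: "z \<in> ball 0 \<rho>"
  shows "(\<lambda>z. \<Sum>j. hpoly c j z) differentiable (at z)"
    "pdx (\<lambda>z. \<Sum>j. hpoly c j z) z = (\<Sum>j. hpoly (coeff_dx c) j z)"
    "pdy (\<lambda>z. \<Sum>j. hpoly c j z) z = (\<Sum>j. hpoly (coeff_dy c) j z)"
proof -
  note cx = rapid_decay_dx[OF \<rho> c] and cy = rapid_decay_dy[OF \<rho> c]
  obtain r where r: "r > 0" "ball z r \<subseteq> ball 0 \<rho>" using z open_ball open_contains_ball by meson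
  obtain K where K: "\<And>j z. z \<in> ball 0 \<rho> \<Longrightarrow> norm (hpoly c j z) \<le> K * (1 / real (Suc j) ^ 2)" "K \<ge> 0"
    using hpoly_rapid_bound[OF \<rho> c] by blast
  obtain X where X: "\<And>j z. z \<in> ball 0 \<rho> \<Longrightarrow> norm (hpoly (coeff_dx c) j z) \<le> X * (1 / real (Suc j) ^ 2)" "X \<ge> 0"
    using hpoly_rapid_bound[OF \<rho> cx] by blast
  obtain Y where Y: "\<And>j z. z \<in> ball 0 \<rho> \<Longrightarrow> norm (hpoly (coeff_dy c) j z) \<le> Y * (1 / real (Suc j) ^ 2)" "Y \<ge> 0"
    using hpoly_rapid_bound[OF \<rho> cy] by blast
  \<comment> \<open>The derivative of the part of degree j is the part of degree j - 1 of the
    differentiated series, whence 1/j^2 in the second summand. At j = 0 that quotient is 0 by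
    convention, and so is the derivative.\<close>
  define b where "b j = K * (1 / real (Suc j) ^ 2) + (X + Y) * (1 / real j ^ 2)" for j
  have "summable (\<lambda>j. 1 / real j ^ 2)"
    using inverse_power_summable[of 2, where 'a=real] by (simp add: inverse_eq_divide)
  then have b: "summable b" unfolding b_def
    by (intro summable_add summable_mult summable_inverse_Suc_square)
  have sub: "z' \<in> ball 0 \<rho>" if "z' \<in> ball z r" for z' using r that by blast
  have 1: "norm (hpoly c j z') \<le> b j" if "z' \<in> ball z r" for j z'
    using K(1)[OF sub[OF that], of j] X Y by (simp add: b_def add_increasing2)
  have 2: "norm (pdx (hpoly c j) z') \<le> b j" "norm (pdy (hpoly c j) z') \<le> b j" if "z' \<in> ball z r" for j z'
  proof -
    have "norm (pdx (hpoly c j) z') \<le> b j \<and> norm (pdy (hpoly c j) z') \<le> b j"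
    proof (cases j)
      case 0
      then show ?thesis using K by (simp add: pd_hpoly_0 b_def)
    next
      case (Suc i)
      have "X * (1 / real (Suc i) ^ 2) \<le> b j" "Y * (1 / real (Suc i) ^ 2) \<le> b j"
        using K(2) X(2) Y(2) by (simp_all add: b_def Suc add_divide_distrib)
      then show ?thesis
        using X(1)[OF sub[OF that], of i] Y(1)[OF sub[OF that], of i]
        by (simp only: Suc pdx_hpoly_Suc pdy_hpoly_Suc) linarith
    qed
    then show "norm (pdx (hpoly c j) z') \<le> b j" "norm (pdy (hpoly c j) z') \<le> b j" by auto
  qed
  note pd = suminf_pd[of r b z "hpoly c", OF r(1) b hpoly_differentiable 1 2]
  have "z \<in> ball z r" using r by simp
  then have "summable (\<lambda>j. pdx (hpoly c j) z)" "summable (\<lambda>j. pdy (hpoly c j) z)"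
    using summable_comparison_test'[OF b, of 0 "\<lambda>j. pdx (hpoly c j) z"]
      summable_comparison_test'[OF b, of 0 "\<lambda>j. pdy (hpoly c j) z"] 2[of z] by (simp_all del: mem_ball)
  \<comment> \<open>Splitting off the vanishing derivative of the constant term realigns degree j +
    1 with degree j.\<close>
  from suminf_split_head[OF this(1)] suminf_split_head[OF this(2)] pd
  show "(\<lambda>z. \<Sum>j. hpoly c j z) differentiable (at z)"
    "pdx (\<lambda>z. \<Sum>j. hpoly c j z) z = (\<Sum>j. hpoly (coeff_dx c) j z)"
    "pdy (\<lambda>z. \<Sum>j. hpoly c j z) z = (\<Sum>j. hpoly (coeff_dy c) j z)"
    by (simp_all add: pd_hpoly_0 pdx_hpoly_Suc pdy_hpoly_Suc)
qed

lemma smooth_on_psum: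
  assumes \<rho>: "\<rho> > 0" and "rapid_decay \<rho> c"
  shows "smooth_on (ball 0 \<rho>) (\<lambda>z. \<Sum>j. hpoly c j z)"
proof -
  have "Ck_on k (ball 0 \<rho>) (\<lambda>z. \<Sum>j. hpoly c j z)" for k
    using assms(2)
  proof (induction k arbitrary: c)
    case 0
    then show ?case using psum_pd(1)[OF \<rho>]
      by (auto intro!: differentiable_imp_continuous_within continuous_at_imp_continuous_on)
  next
    case (Suc k)
    have "Ck_on k (ball 0 \<rho>) (pdx (\<lambda>z. \<Sum>j. hpoly c j z)) \<longleftrightarrow>
        Ck_on k (ball 0 \<rho>) (\<lambda>z. \<Sum>j. hpoly (coeff_dx c) j z)"
      "Ck_on k (ball 0 \<rho>) (pdy (\<lambda>z. \<Sum>j. hpoly c j z)) \<longleftrightarrow>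
        Ck_on k (ball 0 \<rho>) (\<lambda>z. \<Sum>j. hpoly (coeff_dy c) j z)"
      by (rule Ck_on_cong[OF open_ball], rule psum_pd[OF \<rho> Suc.prems], assumption)+
    with Suc.IH[OF rapid_decay_dx[OF \<rho> Suc.prems]] Suc.IH[OF rapid_decay_dy[OF \<rho> Suc.prems]]
      psum_pd(1)[OF \<rho> Suc.prems]
    show ?case by simp
  qed
  then show ?thesis by (simp add: smooth_on_def)
qed

text \<open>The decay is split as x^j = s^j s^j with s = sqrt x: one factor absorbs a single power
  of j + 1, the other feeds the induction hypothesis, which is therefore taken for arbitrary
  x.\<close>

lemma poly_times_geometric_bounded:
  fixes x :: real
  assumes "0 \<le> x" "x < 1"
  shows "\<exists>K. \<forall>j. real (Suc j) ^ d * x ^ j \<le> K"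
  using assms
proof (induction d arbitrary: x)
  case 0
  then have "\<forall>j. real (Suc j) ^ 0 * x ^ j \<le> 1" by (simp add: power_le_one)
  then show ?case by blast
next
  case (Suc d)
  define s where "s = sqrt x"
  have s: "0 \<le> s" "s < 1" "x ^ j = s ^ j * s ^ j" for j
    using Suc.prems by (auto simp: s_def simp flip: power_mult_distrib)
  obtain K where K: "\<And>j. real (Suc j) ^ d * s ^ j \<le> K" using Suc.IH s by blast
  have "(\<lambda>n. real n * s ^ n + s ^ n) \<longlonglongrightarrow> 0 + 0"
    using s by (intro tendsto_add powser_times_n_limit_0 LIMSEQ_power_zero) auto
  then have "Bseq (\<lambda>n. real (Suc n) * s ^ n)"
    by (intro convergent_imp_Bseq convergentI) (auto simp: algebra_simps)
  then obtain L where L: "\<And>n. norm (real (Suc n) * s ^ n) \<le> L" by (auto simp: Bseq_def)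
  have "real (Suc j) ^ Suc d * x ^ j \<le> L * K" for j
  proof -
    have "(real (Suc j) * s ^ j) * (real (Suc j) ^ d * s ^ j) \<le> L * K"
      using s(1) L[of j] K[of j] order_trans[OF norm_ge_zero L[of j]] by (intro mult_mono) auto
    then show ?thesis by (simp add: s(3) mult_ac)
  qed
  then show ?case by blast
qed

section \<open>The formal solution\<close>

lemma norm_plane_sq: "(of_real ((norm (z::plane))\<^sup>2) :: complex) =
    of_real (fst z) * of_real (fst z) + of_real (snd z) * of_real (snd z)"
  by (cases z) (simp add: norm_Pair power2_eq_square)

lemma smooth_on_inverse_norm_sq: "smooth_on (UNIV - {0::plane}) (\<lambda>z. 1 / of_real ((norm z)\<^sup>2))"
proof -
  have "smooth_on (UNIV - {0::plane}) (\<lambda>z. of_real ((norm z)\<^sup>2))"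
    unfolding norm_plane_sq
    by (intro smooth_on_add smooth_on_mult smooth_on_fst smooth_on_snd) (auto simp: open_delete)
  then show ?thesis
    by (intro smooth_on_divide smooth_on_const) (auto simp: open_delete)
qed

lemma abs_fst_le_norm: "\<bar>fst z\<bar> \<le> norm (z::plane)" and abs_snd_le_norm: "\<bar>snd z\<bar> \<le> norm (z::plane)"
  by (metis norm_fst_le prod.collapse real_norm_def) (metis norm_snd_le prod.collapse real_norm_def)

text \<open>The interface between the angular equation and the plane: \<open>g j\<close> stands for
  r^j v_j(\<theta>), and \<open>k\<close>, \<open>m\<close> for q/p and 1/p extended with degree 0.
  The two real factors over r^2 in \<open>g_deriv\<close> are dr/r and d\<theta>, so it says that r
  d/dr multiplies \<open>g j\<close> by j and that d/d\<theta> acts by the angular equation.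
  Smoothness of the sums is derived from this formula and from size bounds, without returning to the
  angle.\<close>

locale formal_solution =
  fixes g :: "nat \<Rightarrow> plane \<Rightarrow> complex" and c :: "nat \<Rightarrow> nat \<Rightarrow> complex"
    and k m :: "plane \<Rightarrow> complex" and lam :: complex and \<rho> K M Kk Km :: real
  assumes rho: "\<rho> > 0" and decay: "rapid_decay \<rho> c"
    and smooth_k: "smooth_on (UNIV - {0}) k" and smooth_m: "smooth_on (UNIV - {0}) m"
    and k_bound: "\<And>z. z \<noteq> 0 \<Longrightarrow> norm (k z) \<le> Kk" and m_bound: "\<And>z. z \<noteq> 0 \<Longrightarrow> norm (m z) \<le> Km"
    and M_pos: "M > 0"
    and g_bound: "\<And>j z. z \<noteq> 0 \<Longrightarrow> norm (g j z) \<le> K * M ^ j * norm z ^ j"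
    and g_deriv: "\<And>j z. z \<noteq> 0 \<Longrightarrow> (g j has_derivative
       (\<lambda>h. (of_real (fst z * fst h + snd z * snd h) * (of_nat j * g j z) +
          of_real (fst z * snd h - snd z * fst h) *
            (\<i> * (of_nat j + 1 - lam) * k z * g j z + m z * hpoly c j z)) / of_real ((norm z)\<^sup>2))) (at z)"
begin

text \<open>The second radius gives M |z| <= 1/2, so that the terms decay at least like 2^-j; the
  first keeps the power series with coefficients \<open>c\<close> convergent.\<close>

definition eps :: real where "eps = min \<rho> (1 / (2 * M))"

definition W :: "nat \<Rightarrow> plane \<Rightarrow> complex" where "W n z = (\<Sum>j. of_nat j ^ n * g j z)"

definition P :: "nat \<Rightarrow> plane \<Rightarrow> complex" where "P n z = (\<Sum>j. hpoly (coeff_euler n c) j z)"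

lemma eps_pos: "eps > 0" using rho M_pos by (simp add: eps_def)

lemma term_bound:
  obtains C where "\<And>j z. z \<in> ball 0 eps - {0} \<Longrightarrow> norm (of_nat j ^ n * g j z) \<le> C * (1 / real (Suc j) ^ 2)"
    "C \<ge> 0"
proof -
  \<comment> \<open>\<open>n\<close> powers for the weight j^n and two more for a summable
    majorant.\<close>
  obtain B where B: "\<And>j. real (Suc j) ^ (n + 2) * (1/2) ^ j \<le> B"
    using poly_times_geometric_bounded[of "1/2" "n + 2"] by auto
  have K0: "K \<ge> 0"
    using order_trans[OF norm_ge_zero g_bound[of "(1,0)" 0]] by (simp add: zero_prod_def)
  have "norm (of_nat j ^ n * g j z) \<le> (K * B) * (1 / real (Suc j) ^ 2)" if "z \<in> ball 0 eps - {0}" for j z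
  proof -
    have "M * norm z \<le> 1 / 2" using that M_pos by (auto simp: eps_def field_simps)
    then have "(M * norm z) ^ j \<le> (1/2) ^ j" using M_pos by (intro power_mono) auto
    then have "norm (g j z) \<le> K * (1/2) ^ j"
      using g_bound[of z j] that K0 mult_left_mono[of "(M * norm z) ^ j" "(1/2) ^ j" K]
      by (simp add: power_mult_distrib mult.assoc)
    then have "norm (of_nat j ^ n * g j z) \<le> real (Suc j) ^ n * (K * (1/2) ^ j)"
      unfolding norm_mult norm_power norm_of_nat by (intro mult_mono power_mono) auto
    also have "\<dots> = K * (real (Suc j) ^ (n + 2) * (1/2) ^ j) * (1 / real (Suc j) ^ 2)"
    proof -
      have "a ^ n * (K * h) = K * (a ^ (n + 2) * h) * (1 / a ^ 2)" if "a \<noteq> 0" for a h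
        using that by (simp add: power2_eq_square)
      then show ?thesis by (metis of_nat_eq_0_iff nat.distinct(2))
    qed
    also have "\<dots> \<le> (K * B) * (1 / real (Suc j) ^ 2)"
      using K0 B[of j] by (intro mult_right_mono mult_left_mono) auto
    finally show ?thesis .
  qed
  moreover have "K * B \<ge> 0" using K0 order_trans[OF _ B[of 0]] by simp
  ultimately show ?thesis using that by blast
qed

lemma W_sums: "z \<in> ball 0 eps - {0} \<Longrightarrow> (\<lambda>j. of_nat j ^ n * g j z) sums W n z"
proof -
  assume z: "z \<in> ball 0 eps - {0}"
  obtain C where C: "\<And>j z. z \<in> ball 0 eps - {0} \<Longrightarrow> norm (of_nat j ^ n * g j z) \<le> C * (1 / real (Suc j) ^ 2)"
    using term_bound by blast
  have "summable (\<lambda>j. of_nat j ^ n * g j z)"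
    by (rule summable_comparison_test'[OF summable_mult[OF summable_inverse_Suc_square, of C]])
      (use C[OF z] in auto)
  then show ?thesis unfolding W_def by (rule summable_sums)
qed

lemma W_bound: obtains C where "\<And>z. z \<in> ball 0 eps - {0} \<Longrightarrow> norm (W n z) \<le> C"
proof -
  obtain C where C: "\<And>j z. z \<in> ball 0 eps - {0} \<Longrightarrow> norm (of_nat j ^ n * g j z) \<le> C * (1 / real (Suc j) ^ 2)"
    using term_bound by blast
  have "norm (W n z) \<le> (\<Sum>j. C * (1 / real (Suc j) ^ 2))" if "z \<in> ball 0 eps - {0}" for z
    unfolding W_def
    by (rule norm_suminf_le[OF C[OF that] summable_mult[OF summable_inverse_Suc_square]])
  then show ?thesis using that by blast
qed

lemma P_sums: "z \<in> ball 0 eps \<Longrightarrow> (\<lambda>j. of_nat j ^ n * hpoly c j z) sums P n z"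
  using summable_sums[OF summable_hpoly[OF rho rapid_decay_euler[OF rho decay], of z n]]
  by (simp add: P_def hpoly_euler eps_def)

lemma P_bound: obtains C where "\<And>z. z \<in> ball 0 eps \<Longrightarrow> norm (P n z) \<le> C"
proof -
  obtain C where C: "\<And>j z. z \<in> ball 0 \<rho> \<Longrightarrow> norm (hpoly (coeff_euler n c) j z) \<le> C * (1 / real (Suc j) ^ 2)"
    using hpoly_rapid_bound[OF rho rapid_decay_euler[OF rho decay]] by blast
  have "norm (P n z) \<le> (\<Sum>j. C * (1 / real (Suc j) ^ 2))" if "z \<in> ball 0 eps" for z
    unfolding P_def
    by (rule norm_suminf_le[OF C summable_mult[OF summable_inverse_Suc_square]])
      (use that in \<open>simp add: eps_def\<close>)
  then show ?thesis using that by blast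
qed

lemma smooth_on_P: "smooth_on (ball 0 eps) (P n)"
proof -
  have "ball 0 eps \<subseteq> ball (0::plane) \<rho>" by (intro subset_ball) (simp add: eps_def)
  then show ?thesis
    using smooth_on_subset[OF smooth_on_psum[OF rho rapid_decay_euler[OF rho decay]]]
    by (simp add: P_def[abs_def])
qed

lemma term_pd:
  assumes "z \<noteq> 0"
  defines "T \<equiv> \<lambda>j n z. \<i> * k z * (of_nat j ^ Suc n * g j z) + \<i> * (1 - lam) * k z * (of_nat j ^ n * g j z)
      + m z * (of_nat j ^ n * hpoly c j z)"
  shows "(\<lambda>z. of_nat j ^ n * g j z) differentiable (at z)"
    "pdx (\<lambda>z. of_nat j ^ n * g j z) z =
      (of_real (fst z) * (of_nat j ^ Suc n * g j z) - of_real (snd z) * T j n z) / of_real ((norm z)\<^sup>2)"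
    "pdy (\<lambda>z. of_nat j ^ n * g j z) z =
      (of_real (snd z) * (of_nat j ^ Suc n * g j z) + of_real (fst z) * T j n z) / of_real ((norm z)\<^sup>2)"
proof -
  note D = has_derivative_mult_right[OF g_deriv[OF assms(1)], of "of_nat j ^ n" j]
  show "(\<lambda>z. of_nat j ^ n * g j z) differentiable (at z)"
    by (rule differentiableI[OF D])
  \<comment> \<open>The factor j + 1 - lam is split into j, which raises the weight from n to n + 1,
    and the constant 1 - lam.\<close>
  have T: "T j n z = of_nat j ^ n * (\<i> * (of_nat j + 1 - lam) * k z * g j z + m z * hpoly c j z)"
    by (simp add: T_def algebra_simps)
  show "pdx (\<lambda>z. of_nat j ^ n * g j z) z =
      (of_real (fst z) * (of_nat j ^ Suc n * g j z) - of_real (snd z) * T j n z) / of_real ((norm z)\<^sup>2)"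
    unfolding pdx_eq[OF D] T by (simp add: algebra_simps diff_divide_distrib)
  show "pdy (\<lambda>z. of_nat j ^ n * g j z) z =
      (of_real (snd z) * (of_nat j ^ Suc n * g j z) + of_real (fst z) * T j n z) / of_real ((norm z)\<^sup>2)"
    unfolding pdy_eq[OF D] T by (simp add: algebra_simps add_divide_distrib)
qed

text \<open>The angular derivative of \<open>W n\<close>, as \<open>W (Suc n)\<close> is the radial
  one. It is built from functions already in the family, so no new series appears.\<close>

definition V :: "nat \<Rightarrow> plane \<Rightarrow> complex" where
  "V n z = \<i> * k z * W (Suc n) z + \<i> * (1 - lam) * k z * W n z + m z * P n z"

text \<open>This is the polar formula for the gradient. Its division by r^2 rules out uniform bounds
  near 0, so the termwise differentiation is carried out on a ball about \<open>z\<close> that stays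
  away from the origin.\<close>

lemma pd_W:
  assumes z: "z \<in> ball 0 eps - {0}"
  shows "W n differentiable (at z)"
    "pdx (W n) z = (of_real (fst z) * W (Suc n) z - of_real (snd z) * V n z) / of_real ((norm z)\<^sup>2)"
    "pdy (W n) z = (of_real (snd z) * W (Suc n) z + of_real (fst z) * V n z) / of_real ((norm z)\<^sup>2)"
proof -
  define S where "S = ball 0 eps - {0::plane}"
  define T where "T = (\<lambda>j z. \<i> * k z * (of_nat j ^ Suc n * g j z) + \<i> * (1 - lam) * k z * (of_nat j ^ n * g j z)
      + m z * (of_nat j ^ n * hpoly c j z))"
  define X where "X = (\<lambda>j z. (of_real (fst z) * (of_nat j ^ Suc n * g j z) - of_real (snd z) * T j z) /
    (of_real ((norm z)\<^sup>2) :: complex))"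
  define Y where "Y = (\<lambda>j z. (of_real (snd z) * (of_nat j ^ Suc n * g j z) + of_real (fst z) * T j z) /
    (of_real ((norm z)\<^sup>2) :: complex))"
  have X: "pdx (\<lambda>z. of_nat j ^ n * g j z) z = X j z" and Y: "pdy (\<lambda>z. of_nat j ^ n * g j z) z = Y j z"
    if "z \<noteq> 0" for j z
    using term_pd(2,3)[OF that] by (simp_all add: X_def Y_def T_def)
  obtain B0 where B0: "\<And>j z. z \<in> S \<Longrightarrow> norm (of_nat j ^ n * g j z) \<le> B0 * (1 / real (Suc j) ^ 2)" "B0 \<ge> 0"
    using term_bound unfolding S_def by blast
  obtain B1 where B1: "\<And>j z. z \<in> S \<Longrightarrow> norm (of_nat j ^ Suc n * g j z) \<le> B1 * (1 / real (Suc j) ^ 2)" "B1 \<ge> 0"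
    using term_bound unfolding S_def by blast
  obtain B2 where "\<And>j z. z \<in> ball 0 \<rho> \<Longrightarrow> norm (hpoly (coeff_euler n c) j z) \<le> B2 * (1 / real (Suc j) ^ 2)"
    and B2': "B2 \<ge> 0"
    using hpoly_rapid_bound[OF rho rapid_decay_euler[OF rho decay]] by blast
  then have B2: "norm (of_nat j ^ n * hpoly c j z) \<le> B2 * (1 / real (Suc j) ^ 2)" if "z \<in> S" for j z
    using that by (simp add: S_def eps_def hpoly_euler)
  define q where "q j = 1 / real (Suc j) ^ 2" for j
  define BT where "BT = Kk * B1 + norm (1 - lam) * Kk * B0 + Km * B2"
  have pos: "Kk \<ge> 0" "Km \<ge> 0"
    using order_trans[OF norm_ge_zero k_bound[of "(1,0)"]] order_trans[OF norm_ge_zero m_bound[of "(1,0)"]]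
    by (simp_all add: zero_prod_def)
  have BT: "norm (T j z) \<le> BT * q j" if "z \<in> S" for j z
  proof -
    have z0: "z \<noteq> 0" using that by (simp add: S_def)
    have "norm (\<i> * k z * (of_nat j ^ Suc n * g j z)) \<le> Kk * (B1 * q j)"
      using mult_mono[OF k_bound[OF z0] B1(1)[OF that, of j]] pos
      by (simp add: norm_mult q_def)
    moreover have "norm (\<i> * (1 - lam) * k z * (of_nat j ^ n * g j z)) \<le> norm (1 - lam) * (Kk * (B0 * q j))"
      using mult_left_mono[OF mult_mono[OF k_bound[OF z0] B0(1)[OF that, of j]], of "norm (1 - lam)"] pos
      by (simp add: norm_mult q_def mult.assoc)
    moreover have "norm (m z * (of_nat j ^ n * hpoly c j z)) \<le> Km * (B2 * q j)"
      using mult_mono[OF m_bound[OF z0] B2[OF that, of j]] pos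
      by (simp add: norm_mult q_def)
    ultimately have "norm (T j z) \<le> Kk * (B1 * q j) + norm (1 - lam) * (Kk * (B0 * q j)) + Km * (B2 * q j)"
      unfolding T_def by (intro norm_triangle_le add_mono)
    then show ?thesis by (simp add: BT_def algebra_simps)
  qed
  have XY: "norm (X j z) \<le> (B1 + BT) * q j / norm z" "norm (Y j z) \<le> (B1 + BT) * q j / norm z"
    if "z \<in> S" for j z
  proof -
    have 1: "norm (of_nat j ^ Suc n * g j z) \<le> B1 * q j" using B1(1)[OF that] by (simp add: q_def)
    have 2: "norm (of_real a * u :: complex) \<le> norm z * b" if "\<bar>a\<bar> \<le> norm z" "norm u \<le> b" for a u b
      using that unfolding norm_mult norm_of_real by (intro mult_mono) auto
    have nz: "norm z > 0" using that by (simp add: S_def)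
    have 3: "norm (u / of_real ((norm z)\<^sup>2) :: complex) \<le> (B1 + BT) * q j / norm z"
      if "norm u \<le> norm z * (B1 * q j) + norm z * (BT * q j)" for u
    proof -
      have "norm u / (norm z)\<^sup>2 \<le> (norm z * (B1 * q j) + norm z * (BT * q j)) / (norm z)\<^sup>2"
        using that by (intro divide_right_mono) auto
      also have "\<dots> = (B1 + BT) * q j / norm z" using nz by (simp add: power2_eq_square field_simps)
      finally show ?thesis by (simp add: norm_divide norm_power)
    qed
    show "norm (X j z) \<le> (B1 + BT) * q j / norm z" unfolding X_def
      by (intro 3 order_trans[OF norm_triangle_ineq4] add_mono 2 1 BT \<open>z \<in> S\<close> abs_fst_le_norm abs_snd_le_norm)
    show "norm (Y j z) \<le> (B1 + BT) * q j / norm z" unfolding Y_def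
      by (intro 3 norm_triangle_le add_mono 2 1 BT \<open>z \<in> S\<close> abs_fst_le_norm abs_snd_le_norm)
  qed
  have "open S" by (simp add: S_def open_delete)
  then obtain r0 where r0: "r0 > 0" "ball z r0 \<subseteq> S"
    using z open_contains_ball unfolding S_def by meson
  \<comment> \<open>Points within |z|/2 of \<open>z\<close> have norm at least |z|/2, which replaces
    the variable factor 1/|z'| by a constant in the majorant \<open>b\<close>.\<close>
  define r where "r = min r0 (norm z / 2)"
  have nz: "norm z > 0" using z by simp
  have r: "r > 0" using r0 nz by (simp add: r_def)
  have rS: "z' \<in> S" "norm z' \<ge> norm z / 2" if "z' \<in> ball z r" for z'
  proof -
    show "z' \<in> S" using that r0 by (auto simp: r_def)
    have "norm (z - z') < norm z / 2" using that by (simp add: r_def dist_norm)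
    then show "norm z' \<ge> norm z / 2" using norm_triangle_ineq2[of z z'] by simp
  qed
  define b where "b j = (B0 + (B1 + BT) * (2 / norm z)) * q j" for j
  have BT0: "BT \<ge> 0" unfolding BT_def using pos B0 B1 B2' by simp
  have q0: "q j \<ge> 0" for j by (simp add: q_def)
  have sb: "summable b" unfolding b_def q_def by (intro summable_mult summable_inverse_Suc_square)
  have b1: "norm (of_nat j ^ n * g j z') \<le> b j" if "z' \<in> ball z r" for j z'
  proof -
    have "norm (of_nat j ^ n * g j z') \<le> B0 * q j" using B0(1)[OF rS(1)[OF that]] by (simp add: q_def)
    also have "\<dots> \<le> b j" using BT0 B1(2) nz q0[of j] by (simp add: b_def mult_right_mono)
    finally show ?thesis .
  qed
  have b2: "(B1 + BT) * q j / norm z' \<le> b j" if "z' \<in> ball z r" for j z'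
  proof -
    have "norm z' > 0" using rS(2)[OF that] nz by linarith
    then have "(B1 + BT) * q j / norm z' \<le> (B1 + BT) * q j / (norm z / 2)"
      using rS(2)[OF that] nz BT0 B1(2) q0[of j] by (intro divide_left_mono mult_pos_pos) auto
    also have "\<dots> \<le> b j" using B0(2) q0[of j] by (simp add: b_def algebra_simps)
    finally show ?thesis .
  qed
  have S0: "z' \<noteq> 0" if "z' \<in> ball z r" for z' using rS(1)[OF that] by (simp add: S_def)
  note pd = suminf_pd[of r b z "\<lambda>j z. of_nat j ^ n * g j z", OF r sb term_pd(1)[OF S0] b1]
  have pdb: "norm (pdx (\<lambda>z. of_nat j ^ n * g j z) z') \<le> b j" "norm (pdy (\<lambda>z. of_nat j ^ n * g j z) z') \<le> b j"
    if "z' \<in> ball z r" for j z'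
    unfolding X[OF S0[OF that]] Y[OF S0[OF that]]
    using order_trans[OF XY(1)[OF rS(1)[OF that]] b2[OF that]] order_trans[OF XY(2)[OF rS(1)[OF that]] b2[OF that]]
    by blast+
  have Tsum: "(\<lambda>j. T j z) sums V n z"
    unfolding T_def V_def using z by (intro sums_add sums_mult W_sums P_sums) auto
  have Xsum: "(\<lambda>j. X j z) sums ((of_real (fst z) * W (Suc n) z - of_real (snd z) * V n z) / of_real ((norm z)\<^sup>2))"
    unfolding X_def using z by (intro sums_divide sums_diff sums_mult W_sums Tsum)
  have Ysum: "(\<lambda>j. Y j z) sums ((of_real (snd z) * W (Suc n) z + of_real (fst z) * V n z) / of_real ((norm z)\<^sup>2))"
    unfolding Y_def using z by (intro sums_divide sums_add sums_mult W_sums Tsum)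
  have z0: "z \<noteq> 0" using z by simp
  have Weq: "W n = (\<lambda>z. \<Sum>j. of_nat j ^ n * g j z)" by (simp add: W_def[abs_def])
  show "W n differentiable (at z)" unfolding Weq by (rule pd(1)[OF _ _ pdb]) auto
  show "pdx (W n) z = (of_real (fst z) * W (Suc n) z - of_real (snd z) * V n z) / of_real ((norm z)\<^sup>2)"
    using pd(2)[OF _ _ pdb] sums_unique[OF Xsum] by (simp only: Weq X[OF z0])
  show "pdy (W n) z = (of_real (snd z) * W (Suc n) z + of_real (fst z) * V n z) / of_real ((norm z)\<^sup>2)"
    using pd(3)[OF _ _ pdb] sums_unique[OF Ysum] by (simp only: Weq Y[OF z0])
qed

text \<open>The gradient of \<open>W n\<close> involves \<open>W n\<close> and
  \<open>W (Suc n)\<close> with smooth coefficients, so class \<open>l\<close> for all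
  \<open>n\<close> at once yields class \<open>Suc l\<close> for all \<open>n\<close>; for a single
  \<open>n\<close> the induction would not close.\<close>

lemma smooth_on_W: "smooth_on (ball 0 eps - {0}) (W n)"
proof -
  let ?S = "ball 0 eps - {0::plane}"
  have S: "open ?S" by (simp add: open_delete)
  have sub: "smooth_on (UNIV - {0}) f \<Longrightarrow> Ck_on l ?S f" for f l
    using Ck_on_subset[of l "UNIV - {0}" f ?S] by (auto simp: smooth_on_def)
  have "Ck_on l ?S (W n)" for l
  proof (induction l arbitrary: n)
    case 0
    show ?case unfolding Ck_on.simps
      by (intro continuous_at_imp_continuous_on ballI differentiable_imp_continuous_within pd_W(1))
  next
    case (Suc l)
    have P: "Ck_on l ?S (P n)" using Ck_on_subset smooth_on_P unfolding smooth_on_def by blast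
    have V: "Ck_on l ?S (V n)" unfolding V_def[abs_def]
      by (intro Ck_on_add Ck_on_mult Ck_on_const S Suc.IH P sub[OF smooth_k] sub[OF smooth_m])
    have D: "Ck_on l ?S (\<lambda>z. 1 / of_real ((norm z)\<^sup>2))" by (rule sub[OF smooth_on_inverse_norm_sq])
    have xy: "Ck_on l ?S (\<lambda>z. of_real (fst z))" "Ck_on l ?S (\<lambda>z. of_real (snd z))"
      using smooth_on_fst smooth_on_snd by (auto simp: smooth_on_def)
    have "Ck_on l ?S (\<lambda>z. (of_real (fst z) * W (Suc n) z + (- 1) * (of_real (snd z) * V n z)) * (1 / of_real ((norm z)\<^sup>2)))"
      "Ck_on l ?S (\<lambda>z. (of_real (snd z) * W (Suc n) z + of_real (fst z) * V n z) * (1 / of_real ((norm z)\<^sup>2)))"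
      by (intro Ck_on_add Ck_on_mult Ck_on_const S Suc.IH V D xy)+
    moreover have "Ck_on l ?S (pdx (W n)) \<longleftrightarrow>
       Ck_on l ?S (\<lambda>z. (of_real (fst z) * W (Suc n) z + (- 1) * (of_real (snd z) * V n z)) * (1 / of_real ((norm z)\<^sup>2)))"
      by (rule Ck_on_cong[OF S]) (simp add: pd_W(2))
    moreover have "Ck_on l ?S (pdy (W n)) \<longleftrightarrow>
       Ck_on l ?S (\<lambda>z. (of_real (snd z) * W (Suc n) z + of_real (fst z) * V n z) * (1 / of_real ((norm z)\<^sup>2)))"
      by (rule Ck_on_cong[OF S]) (simp add: pd_W(3))
    ultimately show ?case using pd_W(1)[of _ n] unfolding Ck_on.simps by blast
  qed
  then show ?thesis by (simp add: smooth_on_def)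
qed

text \<open>\<open>W (Suc n)\<close> and \<open>V n\<close> are bounded, and the factors x/r^2 and
  y/r^2 leave 1/r. At this rate the gradient of w / r^(lam-1) is of size r^(-Re lam), which
  coefficients of degree lam compensate.\<close>

lemma pd_W_bound:
  obtains C where "\<And>z. z \<in> ball 0 eps - {0} \<Longrightarrow> norm (pdx (W n) z) \<le> C / norm z"
    "\<And>z. z \<in> ball 0 eps - {0} \<Longrightarrow> norm (pdy (W n) z) \<le> C / norm z"
proof -
  let ?S = "ball 0 eps - {0::plane}"
  obtain B0 where B0: "\<And>z. z \<in> ?S \<Longrightarrow> norm (W n z) \<le> B0" using W_bound by blast
  obtain B1 where B1: "\<And>z. z \<in> ?S \<Longrightarrow> norm (W (Suc n) z) \<le> B1" using W_bound by blast
  obtain B2 where B2: "\<And>z. z \<in> ball 0 eps \<Longrightarrow> norm (P n z) \<le> B2" using P_bound by blast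
  define BT where "BT = Kk * B1 + norm (1 - lam) * Kk * B0 + Km * B2"
  have BT: "norm (V n z) \<le> BT" if "z \<in> ?S" for z
  proof -
    have z0: "z \<noteq> 0" "z \<in> ball 0 eps" using that by auto
    have pos: "Kk \<ge> 0" "Km \<ge> 0"
      using order_trans[OF norm_ge_zero k_bound[OF z0(1)]] order_trans[OF norm_ge_zero m_bound[OF z0(1)]] .
    have "norm (\<i> * k z * W (Suc n) z) \<le> Kk * B1"
      using mult_mono[OF k_bound[OF z0(1)] B1[OF that]] pos by (simp add: norm_mult)
    moreover have "norm (\<i> * (1 - lam) * k z * W n z) \<le> norm (1 - lam) * (Kk * B0)"
      using mult_left_mono[OF mult_mono[OF k_bound[OF z0(1)] B0[OF that]], of "norm (1 - lam)"] pos
      by (simp add: norm_mult mult.assoc)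
    moreover have "norm (m z * P n z) \<le> Km * B2"
      using mult_mono[OF m_bound[OF z0(1)] B2[OF z0(2)]] pos by (simp add: norm_mult)
    ultimately have "norm (V n z) \<le> Kk * B1 + norm (1 - lam) * (Kk * B0) + Km * B2"
      unfolding V_def by (intro norm_triangle_le add_mono)
    then show ?thesis by (simp add: BT_def mult.assoc)
  qed
  have *: "norm (pdx (W n) z) \<le> (B1 + BT) / norm z" "norm (pdy (W n) z) \<le> (B1 + BT) / norm z"
    if "z \<in> ?S" for z
  proof -
    have 2: "norm (of_real a * u :: complex) \<le> norm z * b" if "\<bar>a\<bar> \<le> norm z" "norm u \<le> b" for a u b
      using that unfolding norm_mult norm_of_real by (intro mult_mono) auto
    have nz: "norm z > 0" using that by simp
    have 3: "norm (u / of_real ((norm z)\<^sup>2) :: complex) \<le> (B1 + BT) / norm z"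
      if "norm u \<le> norm z * B1 + norm z * BT" for u
    proof -
      have "norm u / (norm z)\<^sup>2 \<le> (norm z * B1 + norm z * BT) / (norm z)\<^sup>2"
        using that by (intro divide_right_mono) auto
      also have "\<dots> = (B1 + BT) / norm z" using nz by (simp add: power2_eq_square field_simps)
      finally show ?thesis by (simp add: norm_divide norm_power)
    qed
    show "norm (pdx (W n) z) \<le> (B1 + BT) / norm z" unfolding pd_W(2)[OF that]
      by (intro 3 order_trans[OF norm_triangle_ineq4] add_mono 2 B1 BT \<open>z \<in> ?S\<close> abs_fst_le_norm abs_snd_le_norm)
    show "norm (pdy (W n) z) \<le> (B1 + BT) / norm z" unfolding pd_W(3)[OF that]
      by (intro 3 norm_triangle_le add_mono 2 B1 BT \<open>z \<in> ?S\<close> abs_fst_le_norm abs_snd_le_norm)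
  qed
  then show ?thesis using that by blast
qed

end

section \<open>Expansion of the right-hand side by degree\<close>

lemma real_analytic_expansion:
  assumes "real_analytic_at_0 f"
  obtains \<rho> c where "\<rho> > 0" "rapid_decay \<rho> c" "\<And>z. z \<in> ball 0 \<rho> \<Longrightarrow> f z = (\<Sum>j. hpoly c j z)"
proof -
  obtain r c where r: "r > 0" and f: "\<And>x y. \<bar>x\<bar> < r \<Longrightarrow> \<bar>y\<bar> < r \<Longrightarrow>
      ((\<lambda>(m, n). c m n * of_real x ^ m * of_real y ^ n) has_sum f (x, y)) UNIV"
    using assms unfolding real_analytic_at_0_def by blast
  \<comment> \<open>Convergence at (r/2, r/2) bounds |c m n| (r/2)^(m+n). Halving the radius once
    more leaves 2^-(m+n), which beats every power of the degree.\<close>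
  define \<rho> where "\<rho> = r / 4"
  have \<rho>: "\<rho> > 0" using r by (simp add: \<rho>_def)
  have "((\<lambda>(m, n). c m n * of_real (r/2) ^ m * of_real (r/2) ^ n) has_sum f (r/2, r/2)) UNIV"
    using r by (intro f) auto
  then have "(\<lambda>(m, n). c m n * of_real (r/2) ^ m * of_real (r/2) ^ n) summable_on UNIV"
    by (auto simp: summable_on_def)
  then have "(\<lambda>p. norm ((\<lambda>(m, n). c m n * of_real (r/2) ^ m * of_real (r/2) ^ n) p)) summable_on UNIV"
    using summable_on_iff_abs_summable_on_complex by blast
  from finite_sum_le_infsum[OF this, of "{(m, n)}" for m n] obtain C where
    C: "\<And>m n. norm (c m n * of_real (r/2) ^ m * of_real (r/2) ^ n) \<le> C" by auto
  have C': "norm (c m n) * (r/2) ^ (m + n) \<le> C" for m n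
    using C[of m n] r by (simp add: norm_mult norm_power power_add norm_divide mult.assoc)
  have C0: "C \<ge> 0" using C[of 0 0] norm_ge_zero order_trans by blast
  have "rapid_decay \<rho> c"
    unfolding rapid_decay_def
  proof
    fix d
    obtain K where K: "\<And>j. real (Suc j) ^ d * (1/2) ^ j \<le> K"
      using poly_times_geometric_bounded[of "1/2" d] by auto
    have "real (m + n + 1) ^ d * norm (c m n) * \<rho> ^ (m + n) \<le> K * C" for m n
    proof -
      have "\<rho> ^ (m + n) = (1/2) ^ (m + n) * (r/2) ^ (m + n)"
        by (simp add: \<rho>_def flip: power_mult_distrib)
      then have "real (m + n + 1) ^ d * norm (c m n) * \<rho> ^ (m + n) =
          (real (Suc (m + n)) ^ d * (1/2) ^ (m + n)) * (norm (c m n) * (r/2) ^ (m + n))"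
        by simp
      also have "\<dots> \<le> K * C"
        using K[of "m + n"] C'[of m n] r order_trans[OF _ K[of 0]]
        by (intro mult_mono) auto
      finally show ?thesis .
    qed
    then show "\<exists>K. \<forall>m n. real (m + n + 1) ^ d * norm (c m n) * \<rho> ^ (m + n) \<le> K" by blast
  qed
  moreover have "f z = (\<Sum>j. hpoly c j z)" if "z \<in> ball 0 \<rho>" for z
  proof -
    have "((\<lambda>(m, n). c m n * of_real (fst z) ^ m * of_real (snd z) ^ n) has_sum f (fst z, snd z)) UNIV"
      using that abs_fst_le_norm[of z] abs_snd_le_norm[of z] r by (intro f) (auto simp: \<rho>_def)
    \<comment> \<open>\<open>has_sum\<close> is unconditional, so the double series may be regrouped
      along the finite diagonals m + n = j.\<close>
    also have "?this \<longleftrightarrow> ((\<lambda>(j, m). c m (j - m) * of_real (fst z) ^ m * of_real (snd z) ^ (j - m)) has_sum f z)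
       (Sigma UNIV (\<lambda>j. {..j}))"
      by (rule has_sum_reindex_bij_witness[where i="\<lambda>(j, m). (m, j - m)" and j="\<lambda>(m, n). (m + n, m)"]) auto
    finally have "((\<lambda>j. hpoly c j z) has_sum f z) UNIV"
      by (rule has_sum_SigmaD) (simp add: hpoly_def has_sum_finiteI)
    then show ?thesis using has_sum_imp_sums sums_unique by blast
  qed
  ultimately show ?thesis using that \<rho> by blast
qed

section \<open>Homogeneous functions\<close>

lemma homogeneous_pd:
  assumes "smooth_on (UNIV - {0}) A" "homogeneous lam A"
  shows "homogeneous (lam - 1) (pdx A)" "homogeneous (lam - 1) (pdy A)"
proof -
  have *: "pdx A (t *\<^sub>R z) = of_real t powr (lam - 1) * pdx A z \<and>
      pdy A (t *\<^sub>R z) = of_real t powr (lam - 1) * pdy A z" if z: "z \<noteq> 0" and t: "t > 0" for z t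
  proof -
    have tz: "t *\<^sub>R z \<noteq> 0" using z t by simp
    define D where "D = (\<lambda>h. of_real (fst h) * pdx A (t *\<^sub>R z) + of_real (snd h) * pdy A (t *\<^sub>R z))"
    have "(A has_derivative D) (at (t *\<^sub>R z))"
      unfolding D_def by (rule has_derivative_pd) (use smooth_onD(1)[OF assms(1)] tz in auto)
    then have "((\<lambda>z. A (t *\<^sub>R z)) has_derivative (\<lambda>h. D (t *\<^sub>R h))) (at z)"
      by (rule has_derivative_compose[rotated]) (rule has_derivative_scaleR_right[OF has_derivative_ident])
    then have 1: "((\<lambda>z. of_real t powr lam * A z) has_derivative (\<lambda>h. D (t *\<^sub>R h))) (at z)"
      by (rule has_derivative_transform_within_open[of _ _ _ _ "UNIV - {0}"])
        (use z t assms(2) in \<open>auto simp: homogeneous_def open_delete\<close>)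
    have 2: "((\<lambda>z. of_real t powr lam * A z) has_derivative
        (\<lambda>h. of_real t powr lam * (of_real (fst h) * pdx A z + of_real (snd h) * pdy A z))) (at z)"
      by (intro has_derivative_mult_right has_derivative_pd) (use smooth_onD(1)[OF assms(1)] z in auto)
    \<comment> \<open>The same function of z has been differentiated by the chain rule and through
      homogeneity. The chain rule contributes a factor t, so the degree drops by one.\<close>
    from 1 2 have "(\<lambda>h. D (t *\<^sub>R h)) =
        (\<lambda>h. of_real t powr lam * (of_real (fst h) * pdx A z + of_real (snd h) * pdy A z))"
      by (rule has_derivative_unique)
    from fun_cong[OF this, of "(1,0)"] fun_cong[OF this, of "(0,1)"]
    show ?thesis using t by (simp add: D_def powr_diff field_simps)
  qed
  then show "homogeneous (lam - 1) (pdx A)" "homogeneous (lam - 1) (pdy A)"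
    by (auto simp: homogeneous_def)
qed

text \<open>Compactness of the unit circle bounds \<open>A\<close> there; scaling from
  \<open>sgn z\<close> transfers the bound, since t^lam has modulus t^(Re lam).\<close>

lemma homogeneous_bound:
  assumes "continuous_on (UNIV - {0}) A" "homogeneous lam A"
  obtains C where "C \<ge> 0" "\<And>z. z \<noteq> 0 \<Longrightarrow> norm (A z) \<le> C * norm z powr Re lam"
proof -
  have "compact (A ` sphere 0 1)"
    by (intro compact_continuous_image continuous_on_subset[OF assms(1)]) auto
  then obtain C where C: "\<And>z. z \<in> sphere 0 1 \<Longrightarrow> norm (A z) \<le> C"
    using compact_imp_bounded bounded_iff by (metis imageI)
  have "norm (A z) \<le> C * norm z powr Re lam" if "z \<noteq> 0" for z
  proof -
    have n: "norm z > 0" using that by simp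
    have "A (norm z *\<^sub>R sgn z) = of_real (norm z) powr lam * A (sgn z)"
      using assms(2) that unfolding homogeneous_def by (metis n sgn_zero_iff)
    then have "norm (A z) = norm z powr Re lam * norm (A (sgn z))"
      using n by (simp add: sgn_div_norm norm_mult norm_powr_real_powr)
    also have "\<dots> \<le> norm z powr Re lam * C"
      using C[of "sgn z"] that by (intro mult_left_mono) (auto simp: norm_sgn)
    finally show ?thesis by (simp add: mult.commute)
  qed
  moreover have "C \<ge> 0" using order_trans[OF norm_ge_zero C[of "(1,0)"]] by (simp add: norm_Pair)
  ultimately show ?thesis using that by blast
qed

section \<open>Polar form of the vector field\<close>

locale homogeneous_field =
  fixes A B :: "plane \<Rightarrow> complex" and lam :: complex
  assumes lam: "Re lam > 1"
    and smooth_A: "smooth_on (UNIV - {0}) A" and smooth_B: "smooth_on (UNIV - {0}) B"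
    and hom_A: "homogeneous lam A" and hom_B: "homogeneous lam B"
    and transversal: "\<And>x y. (x, y) \<noteq> 0 \<Longrightarrow> A (x, y) * of_real y - B (x, y) * of_real x \<noteq> 0"
begin

text \<open>On the unit circle \<open>wedge\<close> is p and \<open>radial\<close> is -\<i> q. Both
  are kept as functions of the plane, homogeneous of degree lam + 1, so that their smoothness
  follows from that of \<open>A\<close> and \<open>B\<close> without charts of the circle.\<close>

definition wedge :: "plane \<Rightarrow> complex" where
  "wedge z = B z * of_real (fst z) - A z * of_real (snd z)"

definition radial :: "plane \<Rightarrow> complex" where
  "radial z = A z * of_real (fst z) + B z * of_real (snd z)"

text \<open>\<open>kk\<close> and \<open>mm\<close> extend q/p and 1/p from the circle with degree
  0; the power of r in \<open>mm\<close> makes up for the degree lam + 1 of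
  \<open>wedge\<close>.\<close>

definition kk :: "plane \<Rightarrow> complex" where "kk z = \<i> * radial z / wedge z"

definition mm :: "plane \<Rightarrow> complex" where "mm z = of_real (norm z) powr (lam + 1) / wedge z"

lemma wedge_nz: "z \<noteq> 0 \<Longrightarrow> wedge z \<noteq> 0"
  using transversal[of "fst z" "snd z"] by (auto simp: wedge_def)

lemma smooth_wedge: "smooth_on (UNIV - {0}) wedge"
  and smooth_radial: "smooth_on (UNIV - {0}) radial"
  unfolding wedge_def[abs_def] radial_def[abs_def]
  by (intro smooth_on_add smooth_on_diff smooth_on_mult smooth_A smooth_B smooth_on_fst smooth_on_snd
      open_delete open_UNIV)+

lemma smooth_kk: "smooth_on (UNIV - {0}) kk" and smooth_mm: "smooth_on (UNIV - {0}) mm"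
  unfolding kk_def[abs_def] mm_def[abs_def]
  by (intro smooth_on_divide smooth_on_mult smooth_on_const smooth_wedge smooth_radial
      smooth_on_norm_powr open_delete open_UNIV; simp add: wedge_nz)+

lemma hom_wedge: "z \<noteq> 0 \<Longrightarrow> t > 0 \<Longrightarrow> wedge (t *\<^sub>R z) = of_real t powr lam * of_real t * wedge z"
  and hom_radial: "z \<noteq> 0 \<Longrightarrow> t > 0 \<Longrightarrow> radial (t *\<^sub>R z) = of_real t powr lam * of_real t * radial z"
  using hom_A[unfolded homogeneous_def, rule_format, of z t] hom_B[unfolded homogeneous_def, rule_format, of z t]
  by (simp_all add: wedge_def radial_def algebra_simps)

lemma hom_kk: "z \<noteq> 0 \<Longrightarrow> t > 0 \<Longrightarrow> kk (t *\<^sub>R z) = kk z"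
  by (simp add: kk_def hom_wedge hom_radial)

lemma hom_mm: "z \<noteq> 0 \<Longrightarrow> t > 0 \<Longrightarrow> mm (t *\<^sub>R z) = mm z"
  by (simp add: mm_def hom_wedge powr_times_real powr_add)

lemma homogeneous_kk: "homogeneous 0 kk" and homogeneous_mm: "homogeneous 0 mm"
  by (simp_all add: homogeneous_def hom_kk hom_mm)

definition circ :: "real \<Rightarrow> plane" where "circ t = (cos t, sin t)"

lemma circ: "circ t \<noteq> 0" "norm (circ t) = 1" "circ (t + 2 * pi) = circ t" "continuous_on S circ"
proof -
  show n: "norm (circ t) = 1" by (simp add: circ_def norm_Pair)
  show "circ t \<noteq> 0" using n by force
  show "circ (t + 2 * pi) = circ t" by (simp add: circ_def)
  show "continuous_on S circ" unfolding circ_def[abs_def] by (intro continuous_intros)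
qed

lemma continuous_on_circ:
  assumes "smooth_on (UNIV - {0}) h"
  shows "continuous_on UNIV (\<lambda>t. h (circ t))"
  by (rule continuous_on_compose2[OF smooth_onD(4)[OF assms] circ(4)]) (auto simp: circ(1))

lemma mu_eq: "mu A B = 1 / (2 * of_real pi) * integral {0..2 * pi} (\<lambda>t. kk (circ t))"
  by (simp add: mu_def kk_def radial_def wedge_def circ_def q_fun_def p_fun_def)

text \<open>Every factor in the bound of \<open>periodic_ode\<close> is at most geometric in the
  degree j: the coefficients of the polynomial, the exponential of |s j|, and the reciprocal of the
  divisor 1 - e, which \<open>DC\<close> controls.\<close>

lemma exists_formal_solution:
  assumes DC: "DC (mu A B) lam" and rho: "\<rho> > 0" and decay: "rapid_decay \<rho> c"
  shows "\<exists>g K M Kk Km. formal_solution g c kk mm lam \<rho> K M Kk Km"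
proof -
  define \<mu> where "\<mu> = mu A B"
  obtain Kk where "\<And>z. z \<noteq> 0 \<Longrightarrow> norm (kk z) \<le> Kk * norm z powr Re 0"
    using homogeneous_bound[OF smooth_onD(4)[OF smooth_kk] homogeneous_kk] by blast
  then have Kk: "\<And>z. z \<noteq> 0 \<Longrightarrow> norm (kk z) \<le> Kk" by fastforce
  obtain Km where Km: "Km \<ge> 0" "\<And>z. z \<noteq> 0 \<Longrightarrow> norm (mm z) \<le> Km * norm z powr Re 0"
    using homogeneous_bound[OF smooth_onD(4)[OF smooth_mm] homogeneous_mm] by blast
  then have Km: "Km \<ge> 0" "\<And>z. z \<noteq> 0 \<Longrightarrow> norm (mm z) \<le> Km" by fastforce+
  obtain C where C: "C > 0" "\<And>j::nat. j > 0 \<Longrightarrow>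
      norm (1 - exp (2 * of_real pi * \<i> * \<mu> * (of_nat j - lam))) \<ge> C ^ j"
    using DC unfolding DC_def \<mu>_def by blast
  obtain K1 where K1: "\<And>m n. real (m + n + 1) ^ 1 * norm (c m n) * \<rho> ^ (m + n) \<le> K1"
    using decay unfolding rapid_decay_def by blast
  have K10: "K1 \<ge> 0" by (rule order_trans[OF _ K1[of 0 0]]) simp
  define s where "s j = of_nat j + 1 - lam" for j
  define G where "G j t = mm (circ t) * hpoly c j (circ t)" for j t
  have hp: "norm (hpoly c j (circ t)) \<le> K1 / \<rho> ^ j" for j t
  proof -
    have "norm (hpoly c j (circ t)) \<le> real (j + 1) * (K1 / (real (j + 1) * \<rho> ^ j)) * norm (circ t) ^ j"
    proof (rule hpoly_bound)
      show "norm (c m n) \<le> K1 / (real (j + 1) * \<rho> ^ j)" if "m + n = j" for m n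
        using K1[of m n] that rho by (subst pos_le_divide_eq) (auto simp: mult_ac add_pos_nonneg simp del: of_nat_add)
    qed
    then show ?thesis by (simp add: circ(2))
  qed
  have G: "norm (G j t) \<le> Km * (K1 / \<rho> ^ j)" for j t
    unfolding G_def norm_mult using hp Km circ(1) by (intro mult_mono) auto
  \<comment> \<open>\<open>DC\<close> speaks of positive indices; because of the shift by one in
    \<open>s j\<close>, degree j meets index j + 1, so degree 0 is covered.\<close>
  have nz: "norm (1 - exp (2 * of_real pi * \<i> * \<mu> * s j)) \<ge> C ^ Suc j" for j
    using C(2)[of "Suc j"] by (simp add: s_def add.commute)
  have "\<exists>v. (\<forall>t. (v has_vector_derivative \<i> * s j * kk (circ t) * v t + G j t) (at t)) \<and>
    (\<forall>t. v (t + 2 * pi) = v t) \<and>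
    (\<forall>t\<in>{-pi..pi}. norm (v t) \<le> 2 * pi * (Km * (K1 / \<rho> ^ j)) * exp (norm (s j) * (6 * pi * Kk + 2 * pi * norm \<mu>)) /
       norm (1 - exp (2 * of_real pi * \<i> * \<mu> * s j)))" for j
  proof (rule periodic_ode)
    show "continuous_on UNIV (\<lambda>t. kk (circ t))" by (rule continuous_on_circ[OF smooth_kk])
    have "continuous_on UNIV (hpoly c j)"
      using hpoly_differentiable[of c j]
      by (intro continuous_at_imp_continuous_on ballI differentiable_imp_continuous_within) auto
    then have "continuous_on UNIV (\<lambda>t. hpoly c j (circ t))"
      by (rule continuous_on_compose2[OF _ circ(4)]) auto
    then show "continuous_on UNIV (G j)" unfolding G_def[abs_def]
      by (intro continuous_on_mult continuous_on_circ[OF smooth_mm])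
    have "C ^ Suc j > 0" using C by simp
    then have "norm (1 - exp (2 * of_real pi * \<i> * \<mu> * s j)) > 0" using nz[of j] by linarith
    then show "exp (2 * of_real pi * \<i> * \<mu> * s j) \<noteq> 1" by auto
    show "kk (circ (t + 2 * pi)) = kk (circ t)" "G j (t + 2 * pi) = G j t" for t
      by (simp_all only: circ(3) G_def)
    show "norm (kk (circ t)) \<le> Kk" "norm (G j t) \<le> Km * (K1 / \<rho> ^ j)" for t
      using Kk[OF circ(1)] G by blast+
    show "\<mu> = 1 / (2 * of_real pi) * integral {0..2 * pi} (\<lambda>t. kk (circ t))"
      unfolding \<mu>_def by (rule mu_eq)
  qed
  then obtain v where v: "\<And>j t. (v j has_vector_derivative \<i> * s j * kk (circ t) * v j t + G j t) (at t)"
    "\<And>j t. v j (t + 2 * pi) = v j t"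
    "\<And>j t. t \<in> {-pi..pi} \<Longrightarrow> norm (v j t) \<le> 2 * pi * (Km * (K1 / \<rho> ^ j)) *
      exp (norm (s j) * (6 * pi * Kk + 2 * pi * norm \<mu>)) / norm (1 - exp (2 * of_real pi * \<i> * \<mu> * s j))"
    by metis
  define R where "R = 6 * pi * Kk + 2 * pi * norm \<mu>"
  have "Kk \<ge> 0" using order_trans[OF norm_ge_zero Kk[OF circ(1)]] .
  then have R: "R \<ge> 0" by (simp add: R_def)
  define K where "K = 2 * pi * (Km * K1) * exp ((1 + norm lam) * R) / C"
  define M where "M = exp R / (\<rho> * C)"
  define th where "th z = Arg (cpx z)" for z
  have vb: "norm (v j (th z)) \<le> K * M ^ j" for j z
  proof -
    have "th z \<in> {-pi..pi}" using mpi_less_Arg[of "cpx z"] Arg_le_pi[of "cpx z"] by (auto simp: th_def)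
    then have "norm (v j (th z)) \<le> 2 * pi * (Km * (K1 / \<rho> ^ j)) * exp (norm (s j) * R) /
        norm (1 - exp (2 * of_real pi * \<i> * \<mu> * s j))"
      using v(3) by (simp add: R_def)
    also have "\<dots> \<le> 2 * pi * (Km * (K1 / \<rho> ^ j)) * exp ((real j + (1 + norm lam)) * R) / C ^ Suc j"
    proof (intro frac_le mult_left_mono nz)
      have "norm (s j) \<le> norm (of_nat j + 1 :: complex) + norm lam"
        unfolding s_def by (rule norm_triangle_ineq4)
      also have "norm (of_nat j + 1 :: complex) = real j + 1"
        by (metis norm_of_nat of_nat_Suc add.commute)
      finally have "norm (s j) * R \<le> (real j + (1 + norm lam)) * R"
        using R by (intro mult_right_mono) auto
      then show "exp (norm (s j) * R) \<le> exp ((real j + (1 + norm lam)) * R)" by simp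
    qed (use Km K10 rho C in auto)
    also have "exp ((real j + (1 + norm lam)) * R) = exp R ^ j * exp ((1 + norm lam) * R)"
      unfolding distrib_right[of "real j"] exp_add by (simp add: exp_of_nat_mult)
    also have "2 * pi * (Km * (K1 / \<rho> ^ j)) * (exp R ^ j * exp ((1 + norm lam) * R)) / C ^ Suc j = K * M ^ j"
      by (simp add: K_def M_def power_divide power_mult_distrib mult_ac)
    finally show ?thesis .
  qed
  define g where "g j z = of_real (norm z) ^ j * v j (th z)" for j z
  have polar: "z = norm z *\<^sub>R circ (th z)" if "z \<noteq> 0" for z
    using cpx_Arg[OF that] by (simp add: circ_def th_def)
  have "formal_solution g c kk mm lam \<rho> K M Kk Km"
  proof
    show "M > 0" using rho C by (simp add: M_def)
    show "norm (g j z) \<le> K * M ^ j * norm z ^ j" for j z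
      using mult_right_mono[OF vb[of j z], of "norm z ^ j"] by (simp add: g_def norm_mult norm_power mult.commute)
    fix j and z :: plane
    assume z: "z \<noteq> 0"
    have n: "norm z > 0" using z by simp
    \<comment> \<open>Off the origin r^j is the complex power with exponent j, which treats j = 0
      together with the other degrees.\<close>
    have D1: "((\<lambda>z. complex_of_real (norm z) ^ j) has_derivative
       (\<lambda>h. of_nat j * (of_real (norm z) ^ j / of_real ((norm z)\<^sup>2)) * of_real (fst z * fst h + snd z * snd h))) (at z)"
    proof -
      have "of_real (norm z) powr (of_nat j - 2) = (of_real (norm z) ^ j / of_real ((norm z)\<^sup>2) :: complex)"
        using n by (simp add: powr_diff)
      with norm_powr_has_derivative[OF z, of "of_nat j"]
      have "((\<lambda>z. complex_of_real (norm z) powr of_nat j) has_derivative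
       (\<lambda>h. of_nat j * (of_real (norm z) ^ j / of_real ((norm z)\<^sup>2)) * of_real (fst z * fst h + snd z * snd h))) (at z)"
        by (simp only:)
      then show ?thesis
        by (rule has_derivative_transform_within_open[of _ _ _ _ "UNIV - {0}"])
          (use z in \<open>auto simp: open_delete\<close>)
    qed
    have D2: "((\<lambda>z. v j (th z)) has_derivative (\<lambda>h. of_real ((fst z * snd h - snd z * fst h) / (norm z)\<^sup>2) *
      (\<i> * s j * kk (circ (th z)) * v j (th z) + G j (th z)))) (at z)"
      unfolding th_def by (rule angular_has_derivative[OF v(1,2) z])
    have k: "kk (circ (th z)) = kk z" using polar[OF z] hom_kk[OF circ(1) n] by metis
    have G: "of_real (norm z) ^ j * G j (th z) = mm z * hpoly c j z"
    proof -
      have "mm (circ (th z)) = mm z" using polar[OF z] hom_mm[OF circ(1) n] by metis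
      moreover have "of_real (norm z) ^ j * hpoly c j (circ (th z)) = hpoly c j z"
        using polar[OF z] hpoly_scale[of c j "norm z" "circ (th z)"] by simp
      ultimately show ?thesis by (simp add: G_def mult.left_commute)
    qed
    have e: "of_real (norm z) ^ j * (of_real (a / (norm z)\<^sup>2) * (\<i> * s j * kk z * v j (th z) + G j (th z))) +
        of_nat j * (of_real (norm z) ^ j / of_real ((norm z)\<^sup>2)) * of_real b * v j (th z) =
       (of_real b * (of_nat j * g j z) + of_real a * (\<i> * (of_nat j + 1 - lam) * kk z * g j z + mm z * hpoly c j z)) /
        of_real ((norm z)\<^sup>2)" for a b
    proof -
      have "N * (a / Q * (\<i> * s * k * v + G)) + J * (N / Q) * b * v =
          (b * (J * (N * v)) + a * (\<i> * s * k * (N * v) + N * G)) / Q" for N a Q s k v G J b :: complex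
        by (simp add: algebra_simps add_divide_distrib)
      then show ?thesis unfolding G[symmetric] g_def s_def of_real_divide .
    qed
    from has_derivative_mult[OF D1 D2]
    show "(g j has_derivative
       (\<lambda>h. (of_real (fst z * fst h + snd z * snd h) * (of_nat j * g j z) +
          of_real (fst z * snd h - snd z * fst h) *
            (\<i> * (of_nat j + 1 - lam) * kk z * g j z + mm z * hpoly c j z)) / of_real ((norm z)\<^sup>2))) (at z)"
      unfolding k e by (simp only: g_def[abs_def])
  qed (use rho decay smooth_kk smooth_mm Kk Km in auto)
  then show ?thesis by blast
qed

end

text \<open>L w is (radial * r d/dr w + wedge * d/d\<theta> w) / r^2. Since wedge * \<i> * kk = -
  radial, the contributions of \<open>W 1\<close> cancel. What is left is a multiple of w, which the
  division by r^(lam-1) will remove, and the power series with the factor wedge * mm / r^2 =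
  r^(lam-1).\<close>

lemma (in homogeneous_field) formal_solution_transport:
  assumes F: "formal_solution g c kk mm lam \<rho> K M Kk Km"
    and z: "z \<in> ball 0 (formal_solution.eps \<rho> M) - {0}"
  defines "w \<equiv> formal_solution.W g 0"
  shows "A z * pdx w z + B z * pdy w z =
    (lam - 1) * radial z / of_real ((norm z)\<^sup>2) * w z + of_real (norm z) powr (lam - 1) * (\<Sum>j. hpoly c j z)"
proof -
  interpret F: formal_solution g c kk mm lam \<rho> K M Kk Km by (rule F)
  have z0: "z \<noteq> 0" using z by simp
  have n: "(of_real (norm z))\<^sup>2 \<noteq> (0 :: complex)" using z0 by simp
  have P: "F.P 0 z = (\<Sum>j. hpoly c j z)" by (simp add: F.P_def hpoly_euler)
  have m: "wedge z * mm z = of_real (norm z) powr (lam - 1) * of_real ((norm z)\<^sup>2)"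
  proof -
    have "of_real (norm z) powr ((lam - 1) + 2) = of_real (norm z) powr (lam - 1) * of_real ((norm z)\<^sup>2)"
      unfolding powr_add using z0 by simp
    then show ?thesis using wedge_nz[OF z0] by (simp add: mm_def add.commute)
  qed
  have k: "wedge z * (\<i> * kk z) = - radial z" using wedge_nz[OF z0] by (simp add: kk_def)
  have "A z * pdx w z + B z * pdy w z = (radial z * F.W 1 z + wedge z * F.V 0 z) / of_real ((norm z)\<^sup>2)"
    unfolding w_def F.pd_W(2)[OF z] F.pd_W(3)[OF z]
    by (simp add: radial_def wedge_def algebra_simps flip: add_divide_distrib)
  also have "wedge z * F.V 0 z = wedge z * (\<i> * kk z) * F.W 1 z + wedge z * (\<i> * kk z) * (1 - lam) * F.W 0 z +
      wedge z * mm z * F.P 0 z"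
    by (simp add: F.V_def algebra_simps)
  also have "(radial z * F.W 1 z + \<dots>) / of_real ((norm z)\<^sup>2) =
      (lam - 1) * radial z / of_real ((norm z)\<^sup>2) * w z + of_real (norm z) powr (lam - 1) * (\<Sum>j. hpoly c j z)"
    unfolding k m P w_def using z0 by (simp add: field_simps)
  finally show ?thesis .
qed

section \<open>Functions with a singularity of finite order at the origin\<close>

text \<open>Symbol estimates: size r^s near the origin, with one power lost per derivative.
  Homogeneous and globally smooth functions satisfy them, and sums and products inherit them, so the
  transposed field can be treated factor by factor. The value at 0 is left free.\<close>

fun sing_order :: "nat \<Rightarrow> real \<Rightarrow> (plane \<Rightarrow> complex) \<Rightarrow> bool" where
  "sing_order 0 s h \<longleftrightarrow> (\<exists>K. \<forall>z\<in>ball 0 1 - {0}. norm (h z) \<le> K * norm z powr s)"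
| "sing_order (Suc n) s h \<longleftrightarrow>
     sing_order 0 s h \<and> sing_order n (s - 1) (pdx h) \<and> sing_order n (s - 1) (pdy h)"

lemma sing_order_0I: "(\<And>z. z \<in> ball 0 1 - {0} \<Longrightarrow> norm (h z) \<le> K * norm z powr s) \<Longrightarrow> sing_order 0 s h"
  unfolding sing_order.simps by blast

lemma sing_order_0E:
  assumes "sing_order 0 s h"
  obtains K where "K \<ge> 0" "\<And>z. z \<in> ball 0 1 - {0} \<Longrightarrow> norm (h z) \<le> K * norm z powr s"
proof -
  obtain K where K: "\<And>z. z \<in> ball 0 1 - {0} \<Longrightarrow> norm (h z) \<le> K * norm z powr s"
    using assms unfolding sing_order.simps by blast
  have "norm (h z) \<le> max K 0 * norm z powr s" if "z \<in> ball 0 1 - {0}" for z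
    using K[OF that] by (rule order_trans) (intro mult_right_mono; simp)
  then show ?thesis using that[of "max K 0"] by simp
qed

lemma sing_order_imp_0: "sing_order n s h \<Longrightarrow> sing_order 0 s h"
  by (cases n) (simp_all only: sing_order.simps(2) simp_thms)

lemma sing_order_Suc_D: "sing_order (Suc n) s h \<Longrightarrow> sing_order n s h"
proof (induction n arbitrary: s h)
  case 0
  then show ?case by (rule sing_order_imp_0)
next
  case (Suc n)
  then show ?case unfolding sing_order.simps(2)[of "Suc n"] sing_order.simps(2)[of n s h] by blast
qed

lemma sing_order_mono: "sing_order n s h \<Longrightarrow> s' \<le> s \<Longrightarrow> sing_order n s' h"
proof (induction n arbitrary: s s' h)
  case 0
  obtain K where K: "K \<ge> 0" "\<And>z. z \<in> ball 0 1 - {0} \<Longrightarrow> norm (h z) \<le> K * norm z powr s"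
    using sing_order_0E[OF 0(1)] by blast
  have "norm (h z) \<le> K * norm z powr s'" if z: "z \<in> ball 0 1 - {0}" for z
    using K(2)[OF z] by (rule order_trans) (use z 0 K in \<open>auto intro!: mult_left_mono powr_mono'\<close>)
  then show ?case by (rule sing_order_0I)
next
  case (Suc n)
  have "sing_order 0 s' h"
  proof -
    obtain K where K: "K \<ge> 0" "\<And>z. z \<in> ball 0 1 - {0} \<Longrightarrow> norm (h z) \<le> K * norm z powr s"
      using sing_order_0E[OF sing_order_imp_0[OF Suc.prems(1)]] by blast
    have "norm (h z) \<le> K * norm z powr s'" if z: "z \<in> ball 0 1 - {0}" for z
      using K(2)[OF z] by (rule order_trans) (use z Suc.prems K in \<open>auto intro!: mult_left_mono powr_mono'\<close>)
    then show ?thesis by (rule sing_order_0I)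
  qed
  then show ?case using Suc.prems Suc.IH[of "s - 1" _ "s' - 1"] unfolding sing_order.simps(2) by auto
qed

lemma sing_order_cong:
  assumes "\<And>z. z \<noteq> 0 \<Longrightarrow> f z = g z"
  shows "sing_order n s f \<longleftrightarrow> sing_order n s g"
  using assms
proof (induction n arbitrary: s f g)
  case 0
  then show ?case by simp
next
  case (Suc n)
  have pd: "pdx f z = pdx g z" "pdy f z = pdy g z" if "z \<noteq> 0" for z
    using pd_cong_open[of "UNIV - {0}" z f g] that Suc.prems by (auto simp: open_delete)
  show ?case unfolding sing_order.simps(2)
    using Suc.IH[of "pdx f" "pdx g"] Suc.IH[of "pdy f" "pdy g"] pd Suc.prems by simp
qed

lemma sing_order_add:
  assumes "smooth_on (UNIV - {0}) f" "smooth_on (UNIV - {0}) g"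
    and "sing_order n s f" "sing_order n s g"
  shows "sing_order n s (\<lambda>z. f z + g z)"
  using assms
proof (induction n arbitrary: s f g)
  case 0
  obtain K where K: "\<And>z. z \<in> ball 0 1 - {0} \<Longrightarrow> norm (f z) \<le> K * norm z powr s"
    using sing_order_0E[OF 0(3)] by blast
  obtain L where L: "\<And>z. z \<in> ball 0 1 - {0} \<Longrightarrow> norm (g z) \<le> L * norm z powr s"
    using sing_order_0E[OF 0(4)] by blast
  have "norm (f z + g z) \<le> (K + L) * norm z powr s" if "z \<in> ball 0 1 - {0}" for z
    using norm_triangle_mono[OF K[OF that] L[OF that]] by (simp add: distrib_right)
  then show ?case by (rule sing_order_0I)
next
  case (Suc n)
  note fg = Suc.prems(3,4)[unfolded sing_order.simps(2)]
  obtain K where K: "\<And>z. z \<in> ball 0 1 - {0} \<Longrightarrow> norm (f z) \<le> K * norm z powr s"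
    using fg(1) sing_order_0E by blast
  obtain L where L: "\<And>z. z \<in> ball 0 1 - {0} \<Longrightarrow> norm (g z) \<le> L * norm z powr s"
    using fg(2) sing_order_0E by blast
  have "norm (f z + g z) \<le> (K + L) * norm z powr s" if "z \<in> ball 0 1 - {0}" for z
    using norm_triangle_mono[OF K[OF that] L[OF that]] by (simp add: distrib_right)
  then have "sing_order 0 s (\<lambda>z. f z + g z)" by (rule sing_order_0I)
  moreover have "sing_order n (s - 1) (pdx (\<lambda>z. f z + g z)) \<longleftrightarrow> sing_order n (s - 1) (\<lambda>z. pdx f z + pdx g z)"
    "sing_order n (s - 1) (pdy (\<lambda>z. f z + g z)) \<longleftrightarrow> sing_order n (s - 1) (\<lambda>z. pdy f z + pdy g z)"
    by (rule sing_order_cong, rule pd_add; (rule smooth_onD(1)[OF Suc.prems(1)] smooth_onD(1)[OF Suc.prems(2)]; simp))+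
  moreover have "sing_order n (s - 1) (\<lambda>z. pdx f z + pdx g z)" "sing_order n (s - 1) (\<lambda>z. pdy f z + pdy g z)"
    by (rule Suc.IH; use smooth_onD(2,3) Suc.prems(1,2) fg in blast)+
  ultimately show ?case unfolding sing_order.simps(2) by blast
qed

lemma sing_order_mult:
  assumes "smooth_on (UNIV - {0}) f" "smooth_on (UNIV - {0}) g"
    and "sing_order n s f" "sing_order n t g"
  shows "sing_order n (s + t) (\<lambda>z. f z * g z)"
  using assms
proof (induction n arbitrary: s t f g)
  case 0
  obtain K where K: "K \<ge> 0" "\<And>z. z \<in> ball 0 1 - {0} \<Longrightarrow> norm (f z) \<le> K * norm z powr s"
    using sing_order_0E[OF 0(3)] by blast
  obtain L where L: "L \<ge> 0" "\<And>z. z \<in> ball 0 1 - {0} \<Longrightarrow> norm (g z) \<le> L * norm z powr t"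
    using sing_order_0E[OF 0(4)] by blast
  have "norm (f z * g z) \<le> (K * L) * norm z powr (s + t)" if "z \<in> ball 0 1 - {0}" for z
    using mult_mono[OF K(2)[OF that] L(2)[OF that]] K(1) by (simp add: norm_mult powr_add mult_ac)
  then show ?case by (rule sing_order_0I)
next
  case (Suc n)
  have U: "open (UNIV - {0::plane})" by (simp add: open_delete)
  note fg = Suc.prems(3,4)[unfolded sing_order.simps(2)]
  obtain K where K: "K \<ge> 0" "\<And>z. z \<in> ball 0 1 - {0} \<Longrightarrow> norm (f z) \<le> K * norm z powr s"
    using fg(1) sing_order_0E by blast
  obtain L where L: "L \<ge> 0" "\<And>z. z \<in> ball 0 1 - {0} \<Longrightarrow> norm (g z) \<le> L * norm z powr t"
    using fg(2) sing_order_0E by blast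
  have "norm (f z * g z) \<le> (K * L) * norm z powr (s + t)" if "z \<in> ball 0 1 - {0}" for z
    using mult_mono[OF K(2)[OF that] L(2)[OF that]] K(1) by (simp add: norm_mult powr_add mult_ac)
  then have "sing_order 0 (s + t) (\<lambda>z. f z * g z)" by (rule sing_order_0I)
  moreover have "sing_order n (s + t - 1) (pdx (\<lambda>z. f z * g z)) \<longleftrightarrow>
      sing_order n (s + t - 1) (\<lambda>z. f z * pdx g z + pdx f z * g z)"
    "sing_order n (s + t - 1) (pdy (\<lambda>z. f z * g z)) \<longleftrightarrow>
      sing_order n (s + t - 1) (\<lambda>z. f z * pdy g z + pdy f z * g z)"
    by (rule sing_order_cong, rule pd_mult; (rule smooth_onD(1)[OF Suc.prems(1)] smooth_onD(1)[OF Suc.prems(2)]; simp))+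
  moreover have "sing_order n (s + t - 1) (\<lambda>z. f z * pdx g z + pdx f z * g z)"
    "sing_order n (s + t - 1) (\<lambda>z. f z * pdy g z + pdy f z * g z)"
  proof -
    note sm = Suc.prems(1,2) smooth_onD(2,3)[OF Suc.prems(1)] smooth_onD(2,3)[OF Suc.prems(2)]
    note lo = Suc.prems(3,4)[THEN sing_order_Suc_D]
    have "sing_order n (s + (t - 1)) (\<lambda>z. f z * pdx g z)" "sing_order n (s + (t - 1)) (\<lambda>z. f z * pdy g z)"
      "sing_order n (s - 1 + t) (\<lambda>z. pdx f z * g z)" "sing_order n (s - 1 + t) (\<lambda>z. pdy f z * g z)"
      using fg lo sm by (auto intro!: Suc.IH)
    then show "sing_order n (s + t - 1) (\<lambda>z. f z * pdx g z + pdx f z * g z)"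
      "sing_order n (s + t - 1) (\<lambda>z. f z * pdy g z + pdy f z * g z)"
      using sm by (auto intro!: sing_order_add smooth_on_mult U simp: algebra_simps)
  qed
  ultimately show ?case unfolding sing_order.simps(2) by blast
qed

lemma sing_order_smooth: "smooth_on UNIV \<Phi> \<Longrightarrow> sing_order n 0 \<Phi>"
proof (induction n arbitrary: \<Phi>)
  have base: "sing_order 0 0 \<Phi>" if "smooth_on UNIV \<Phi>" for \<Phi>
  proof -
    have "compact (\<Phi> ` cball 0 1)"
      by (intro compact_continuous_image continuous_on_subset[OF smooth_onD(4)[OF that]]) auto
    then obtain K where "\<And>z. z \<in> cball 0 1 \<Longrightarrow> norm (\<Phi> z) \<le> K"
      using compact_imp_bounded bounded_iff by (metis imageI)
    then show ?thesis by (intro sing_order_0I[of _ K]) auto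
  qed
  {
    case 0
    then show ?case by (rule base)
  next
    case (Suc n)
    have "sing_order n 0 (pdx \<Phi>)" "sing_order n 0 (pdy \<Phi>)"
      using Suc.IH smooth_onD(2,3)[OF Suc.prems] by blast+
    \<comment> \<open>The derivatives are even bounded; on the unit ball this implies the weaker
      exponent -1 that the recursion asks for.\<close>
    then have "sing_order n (0 - 1) (pdx \<Phi>)" "sing_order n (0 - 1) (pdy \<Phi>)"
      using sing_order_mono[of n 0 _ "0 - 1"] by auto
    then show ?case unfolding sing_order.simps(2) using base[OF Suc.prems] by blast
  }
qed

lemma sing_order_homogeneous:
  "smooth_on (UNIV - {0}) A \<Longrightarrow> homogeneous lam A \<Longrightarrow> sing_order n (Re lam) A"
proof (induction n arbitrary: A lam)
  have base: "sing_order 0 (Re lam) A" if "smooth_on (UNIV - {0}) A" "homogeneous lam A" for A lam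
    by (rule homogeneous_bound[OF smooth_onD(4)[OF that(1)] that(2)]) (rule sing_order_0I, auto)
  {
    case 0
    then show ?case by (rule base)
  next
    case (Suc n)
    have "sing_order n (Re (lam - 1)) (pdx A)" "sing_order n (Re (lam - 1)) (pdy A)"
      using Suc.IH smooth_onD(2,3)[OF Suc.prems(1)] homogeneous_pd[OF Suc.prems] by blast+
    then show ?case unfolding sing_order.simps(2) using base[OF Suc.prems] by simp
  }
qed

lemma tendsto_norm_powr_0:
  fixes K t :: real
  assumes "t > 0"
  shows "((\<lambda>z::plane. K * norm z powr t) \<longlongrightarrow> 0) (at 0)"
proof -
  have "((\<lambda>z::plane. norm z powr t) \<longlongrightarrow> 0) (at 0)"
    by (rule tendsto_zero_powrI[OF _ tendsto_const _ assms])
      (use tendsto_norm_zero[OF tendsto_ident_at] in auto)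
  from tendsto_mult_left[OF this, of K] show ?thesis by simp
qed

lemma sing_order_tendsto_0:
  assumes "sing_order 0 s h" "s > 0"
  shows "(h \<longlongrightarrow> 0) (at 0)"
proof -
  obtain K where K: "\<And>z. z \<in> ball 0 1 - {0} \<Longrightarrow> norm (h z) \<le> K * norm z powr s"
    using sing_order_0E[OF assms(1)] by blast
  have "\<forall>\<^sub>F z in at 0. norm (h z) \<le> K * norm z powr s"
    unfolding eventually_at using K by (intro exI[of _ 1]) (auto simp: dist_commute)
  then show ?thesis by (rule Lim_null_comparison[OF _ tendsto_norm_powr_0[OF assms(2)]])
qed

text \<open>The difference quotient at 0 is of size r^(s-1), which tends to 0.\<close>

lemma sing_order_deriv_0:
  assumes "sing_order 0 s h" "s > 1" "h 0 = 0"
  shows "(h has_derivative (\<lambda>_. 0)) (at 0)"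
proof -
  obtain K where K: "\<And>z. z \<in> ball 0 1 - {0} \<Longrightarrow> norm (h z) \<le> K * norm z powr s"
    using sing_order_0E[OF assms(1)] by blast
  show ?thesis
  proof (rule has_derivativeI_sandwich[of 1])
    show "((\<lambda>z::plane. K * norm z powr (s - 1)) \<longlongrightarrow> 0) (at 0)"
      using assms(2) by (intro tendsto_norm_powr_0) simp
    fix z :: plane assume z: "z \<noteq> 0" "dist z 0 < 1"
    have "norm (h z) / norm z \<le> K * norm z powr s / norm z"
      using K[of z] z by (intro divide_right_mono) auto
    then show "norm (h z - h 0 - 0) / norm (z - 0) \<le> K * norm z powr (s - 1)"
      using z assms(3) by (simp add: powr_diff)
  qed auto
qed

text \<open>Vanishing faster than r^N carries the function across the origin: for N > 0 the exponent
  exceeds 1, so the derivative at 0 exists and is zero, and the partial derivatives satisfy the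
  hypotheses again with s - 1 and N - 1.\<close>

lemma sing_order_extends:
  assumes "smooth_on (UNIV - {0}) h" "h 0 = 0" "sing_order N s h" "s > real N"
  shows "Ck_on N UNIV h" "i + j \<le> N \<Longrightarrow> (pdx ^^ i) ((pdy ^^ j) h) 0 = 0"
  using assms
proof (induction N arbitrary: h s i j)
  case 0
  {
    case 1
    have "continuous_on UNIV h"
    proof (intro continuous_at_imp_continuous_on ballI)
      fix z :: plane
      show "isCont h z"
      proof (cases "z = 0")
        case True
        then show ?thesis using sing_order_tendsto_0[OF 1(3)] 1 by (simp add: isCont_def)
      next
        case False
        then show ?thesis using smooth_onD(1)[OF 1(1), of z] by (simp add: differentiable_imp_continuous_within)
      qed
    qed
    then show ?case by simp
  next
    case 2
    then show ?case by simp
  }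
next
  case (Suc N)
  have D: "(h has_derivative (\<lambda>_. 0)) (at 0)" "pdx h 0 = 0" "pdy h 0 = 0"
    if "h 0 = 0" "sing_order (Suc N) s h" "s > real (Suc N)" for h s
  proof -
    show *: "(h has_derivative (\<lambda>_. 0)) (at 0)"
      using that by (intro sing_order_deriv_0[of s] sing_order_imp_0[of "Suc N"]) auto
    show "pdx h 0 = 0" "pdy h 0 = 0" using pdx_eq[OF *] pdy_eq[OF *] by auto
  qed
  {
    case 1
    note D = D[OF 1(2,3,4)]
    note so = 1(3)[unfolded sing_order.simps(2)]
    have "h differentiable (at z)" for z
      by (cases "z = 0") (use differentiableI[OF D(1)] smooth_onD(1)[OF 1(1), of z] in auto)
    moreover have "Ck_on N UNIV (pdx h)" "Ck_on N UNIV (pdy h)"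
      by (rule Suc.IH(1)[of _ "s - 1"]; use smooth_onD(2,3)[OF 1(1)] D so 1(4) in simp)+
    ultimately show ?case by simp
  next
    case 2
    note D = D[OF 2(3,4,5)]
    note so = 2(4)[unfolded sing_order.simps(2)]
    \<comment> \<open>The innermost derivative is \<open>pdy\<close> unless j = 0, and then
      \<open>pdx\<close>. It is peeled off from the inside, since the induction hypothesis concerns
      the jets of \<open>pdx h\<close> and \<open>pdy h\<close>.\<close>
    show ?case
    proof (cases j)
      case (Suc j')
      have "(pdx ^^ i) ((pdy ^^ j') (pdy h)) 0 = 0"
        by (rule Suc.IH(2)[of _ _ _ "s - 1"]; use smooth_onD(2,3)[OF 2(2)] D so 2 Suc in simp)
      then show ?thesis by (simp add: Suc funpow_swap1)
    next
      case 0
      show ?thesis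
      proof (cases i)
        case (Suc i')
        have "(pdx ^^ i') ((pdy ^^ 0) (pdx h)) 0 = 0"
          by (rule Suc.IH(2)[of _ _ _ "s - 1"]; use smooth_onD(2,3)[OF 2(2)] D so 2 Suc in simp)
        then show ?thesis by (simp add: Suc 0 funpow_swap1)
      qed (simp add: 0 2)
    qed
  }
qed

section \<open>Jets of test functions and the Taylor polynomial at the origin\<close>

lemma Ck_on_jet:
  "Ck_on N S \<Psi> \<Longrightarrow> i + j \<le> N \<Longrightarrow> Ck_on (N - (i + j)) S ((pdx ^^ i) ((pdy ^^ j) \<Psi>))"
proof (induction i)
  case 0
  then show ?case
  proof (induction j)
    case (Suc j)
    then have "Ck_on (Suc (N - Suc j)) S ((pdy ^^ j) \<Psi>)" by (simp add: Suc_diff_Suc)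
    then show ?case by simp
  qed simp
next
  case (Suc i)
  then have "Ck_on (Suc (N - (Suc i + j))) S ((pdx ^^ i) ((pdy ^^ j) \<Psi>))" by (simp add: Suc_diff_Suc)
  then show ?case by simp
qed

lemma jet_differentiable:
  assumes "Ck_on N UNIV \<Psi>" "i + j < N"
  shows "(pdx ^^ i) ((pdy ^^ j) \<Psi>) differentiable (at z)"
proof -
  have "Ck_on (Suc (N - Suc (i + j))) UNIV ((pdx ^^ i) ((pdy ^^ j) \<Psi>))"
    using Ck_on_jet[OF assms(1), of i j] assms(2) by (simp add: Suc_diff_Suc del: Ck_on.simps)
  then show ?thesis unfolding Ck_on.simps by blast
qed

lemma jet_add:
  assumes "Ck_on N UNIV \<Phi>" "Ck_on N UNIV \<Psi>" "i + j \<le> N"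
  shows "(pdx ^^ i) ((pdy ^^ j) (\<lambda>z. \<Phi> z + \<Psi> z)) = (\<lambda>z. (pdx ^^ i) ((pdy ^^ j) \<Phi>) z + (pdx ^^ i) ((pdy ^^ j) \<Psi>) z)"
  using assms(3)
proof (induction i)
  case 0
  then show ?case
  proof (induction j)
    case (Suc j)
    have "(pdy ^^ j) \<Phi> differentiable (at z)" "(pdy ^^ j) \<Psi> differentiable (at z)" for z
      using jet_differentiable[OF assms(1), of 0 j z] jet_differentiable[OF assms(2), of 0 j z] Suc.prems by auto
    with Suc show ?case by (auto simp: pd_add)
  qed simp
next
  case (Suc i)
  have "(pdx ^^ i) ((pdy ^^ j) \<Phi>) differentiable (at z)" "(pdx ^^ i) ((pdy ^^ j) \<Psi>) differentiable (at z)" for z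
    using jet_differentiable[OF assms(1), of i j z] jet_differentiable[OF assms(2), of i j z] Suc.prems by auto
  with Suc show ?case by (auto simp: pd_add)
qed

lemma pd_cmult:
  assumes "f differentiable (at z)"
  shows "pdx (\<lambda>z. c * f z) z = c * pdx f z" "pdy (\<lambda>z. c * f z) z = c * pdy f z"
  using has_derivative_mult_right[OF has_derivative_pd[OF assms], of c] by (simp_all add: pdx_eq pdy_eq)

lemma jet_cmult:
  assumes "Ck_on N UNIV \<Phi>" "i + j \<le> N"
  shows "(pdx ^^ i) ((pdy ^^ j) (\<lambda>z. c * \<Phi> z)) = (\<lambda>z. c * (pdx ^^ i) ((pdy ^^ j) \<Phi>) z)"
  using assms(2)
proof (induction i)
  case 0
  then show ?case
  proof (induction j)
    case (Suc j)
    have "(pdy ^^ j) \<Phi> differentiable (at z)" for z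
      using jet_differentiable[OF assms(1), of 0 j z] Suc.prems by auto
    with Suc show ?case by (auto simp: pd_cmult)
  qed simp
next
  case (Suc i)
  have "(pdx ^^ i) ((pdy ^^ j) \<Phi>) differentiable (at z)" for z
    using jet_differentiable[OF assms(1), of i j z] Suc.prems by auto
  with Suc show ?case by (auto simp: pd_cmult)
qed

lemma jet_zero_outside:
  assumes "open V" "\<And>z. z \<in> V \<Longrightarrow> \<Psi> z = 0" "z \<in> V"
  shows "(pdx ^^ i) ((pdy ^^ j) \<Psi>) z = 0"
  using assms(3)
proof (induction i arbitrary: z)
  case 0
  then show ?case
  proof (induction j arbitrary: z)
    case (Suc j)
    have "pdy ((pdy ^^ j) \<Psi>) z = pdy (\<lambda>z. 0) z"
      by (rule pd_cong_open(2)[OF assms(1) Suc.prems]) (use Suc.IH in simp)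
    then show ?case by simp
  qed (simp add: assms)
next
  case (Suc i)
  have "pdx ((pdx ^^ i) ((pdy ^^ j) \<Psi>)) z = pdx (\<lambda>z. 0) z"
    by (rule pd_cong_open(1)[OF assms(1) Suc.prems Suc.IH])
  then show ?case by simp
qed

lemma zero_off_supp: "z \<notin> supp \<Phi> \<Longrightarrow> \<Phi> z = 0"
  unfolding supp_def using closure_subset[of "{z. \<Phi> z \<noteq> 0}"] by auto

text \<open>A supremum of reals dominates only if the set is bounded above. Compact support supplies
  this: the derivatives are continuous on the support and vanish on its open complement.\<close>

lemma Ck_norm_bound:
  assumes \<Psi>: "\<Psi> \<in> Ck_c N U" and ij: "i + j \<le> N"
  shows "norm ((pdx ^^ i) ((pdy ^^ j) \<Psi>) z) \<le> Ck_norm N \<Psi>"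
proof -
  have Ck: "Ck_on N UNIV \<Psi>" and K: "compact (supp \<Psi>)" using \<Psi> by (auto simp: Ck_c_def)
  define J where "J = (\<lambda>i j z. norm ((pdx ^^ i) ((pdy ^^ j) \<Psi>) z))"
  have bdd: "bdd_above (range (J i j))" if ij: "i + j \<le> N" for i j
  proof -
    have "continuous_on UNIV ((pdx ^^ i) ((pdy ^^ j) \<Psi>))"
      using Ck_on_continuous[OF Ck_on_jet[OF Ck ij]] .
    then have "compact ((pdx ^^ i) ((pdy ^^ j) \<Psi>) ` supp \<Psi>)"
      by (intro compact_continuous_image K) (rule continuous_on_subset, auto)
    then obtain C where C: "\<And>z. z \<in> supp \<Psi> \<Longrightarrow> J i j z \<le> C"
      unfolding J_def using compact_imp_bounded bounded_iff by (metis imageI)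
    have "J i j z \<le> max C 0" for z
    proof (cases "z \<in> supp \<Psi>")
      case False
      have "open (- supp \<Psi>)" unfolding supp_def by (intro open_Compl closed_closure)
      then have "J i j z = 0"
        unfolding J_def using False zero_off_supp by (subst jet_zero_outside[of "- supp \<Psi>"]) auto
      then show ?thesis by simp
    qed (use C in fastforce)
    then show ?thesis by (intro bdd_aboveI2)
  qed
  have fin: "finite {(i, j). i + j \<le> N}"
    by (rule finite_subset[of _ "{..N} \<times> {..N}"]) auto
  have "norm ((pdx ^^ i) ((pdy ^^ j) \<Psi>) z) \<le> (SUP z. J i j z)"
    using cSUP_upper[OF UNIV_I bdd[OF ij], of z] by (simp add: J_def)
  also have "\<dots> = (\<lambda>(i, j). SUP z. J i j z) (i, j)" by simp
  also have "\<dots> \<le> (\<Sum>p\<in>{(i, j). i + j \<le> N}. (\<lambda>(i, j). SUP z. J i j z) p)"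
  proof (rule member_le_sum)
    show "(i, j) \<in> {(i, j). i + j \<le> N}" using ij by simp
    fix p assume "p \<in> {(i, j). i + j \<le> N} - {(i, j)}"
    then obtain a b where p: "p = (a, b)" "a + b \<le> N" by auto
    have "0 \<le> J a b 0" by (simp add: J_def)
    also have "\<dots> \<le> (SUP z. J a b z)" by (rule cSUP_upper[OF UNIV_I bdd[OF p(2)]])
    finally show "0 \<le> (\<lambda>(i, j). SUP z. J i j z) p" by (simp add: p)
  qed (rule fin)
  also have "\<dots> = Ck_norm N \<Psi>" by (simp add: Ck_norm_def J_def)
  finally show ?thesis .
qed

text \<open>The derivative of the remainder of order n + 1 is the remainder of order n of the
  derivative, so the induction shifts the sequence \<open>d\<close>. The factor 1/n! is given away,
  as only the power of t matters later.\<close>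

lemma real_taylor_bound:
  fixes d :: "nat \<Rightarrow> real \<Rightarrow> complex"
  assumes "\<And>i t. i < n \<Longrightarrow> (d i has_vector_derivative d (Suc i) t) (at t)"
    and "\<And>t. norm (d n t) \<le> B"
  shows "norm (d 0 t - (\<Sum>i<n. of_real (t ^ i / fact i) * d i 0)) \<le> B * \<bar>t\<bar> ^ n"
  using assms
proof (induction n arbitrary: d t)
  case 0
  then show ?case by simp
next
  case (Suc n)
  have B0: "B \<ge> 0" using order_trans[OF norm_ge_zero Suc.prems(2)] .
  define R where "R t = d 0 t - (\<Sum>i<Suc n. of_real (t ^ i / fact i) * d i 0)" for t
  define R' where "R' t = d (Suc 0) t - (\<Sum>i<n. of_real (t ^ i / fact i) * d (Suc i) 0)" for t
  have IH: "norm (R' u) \<le> B * \<bar>u\<bar> ^ n" for u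
    unfolding R'_def by (rule Suc.IH[of "\<lambda>i. d (Suc i)"]) (use Suc.prems in auto)
  have pw: "((\<lambda>t. t ^ Suc i / fact (Suc i)) has_real_derivative u ^ i / fact i) (at u)" for i and u :: real
  proof -
    have "((\<lambda>t. t ^ Suc i / fact (Suc i)) has_real_derivative (real (Suc i) * u ^ i) / fact (Suc i)) (at u)"
      using DERIV_cdivide[OF DERIV_pow[of "Suc i" u UNIV], of "fact (Suc i)"]
      by (simp del: fact_Suc power_Suc of_nat_Suc)
    moreover have "(real (Suc i) * u ^ i) / fact (Suc i) = u ^ i / fact i"
      by (simp add: divide_simps del: of_nat_Suc)
    ultimately show ?thesis by (simp only:)
  qed
  have R: "(R has_vector_derivative R' u) (at u)" for u
  proof -
    have "R = (\<lambda>t. d 0 t - (d 0 0 + (\<Sum>i<n. of_real (t ^ Suc i / fact (Suc i)) * d (Suc i) 0)))"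
      unfolding R_def sum.lessThan_Suc_shift by (rule ext) simp
    moreover have "((\<lambda>t. d 0 t - (d 0 0 + (\<Sum>i<n. of_real (t ^ Suc i / fact (Suc i)) * d (Suc i) 0)))
        has_vector_derivative d (Suc 0) u - (0 + (\<Sum>i<n. of_real (u ^ i / fact i) * d (Suc i) 0))) (at u)"
      by (intro has_vector_derivative_diff has_vector_derivative_add has_vector_derivative_const
          has_vector_derivative_sum has_vector_derivative_mult_left has_vector_derivative_of_real pw Suc.prems(1)) simp
    ultimately show ?thesis by (simp add: R'_def)
  qed
  have "norm (R t - R 0) \<le> (B * \<bar>t\<bar> ^ n) * \<bar>t - 0\<bar>"
  proof (rule vector_derivative_bound[OF R])
    fix u assume "u \<in> closed_segment 0 t"
    then have "\<bar>u\<bar> \<le> \<bar>t\<bar>" by (auto simp: closed_segment_eq_real_ivl split: if_splits)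
    then show "norm (R' u) \<le> B * \<bar>t\<bar> ^ n"
      using IH[of u] B0 mult_left_mono[OF power_mono[of "\<bar>u\<bar>" "\<bar>t\<bar>" n] B0] by auto
  qed
  moreover have "R 0 = 0" unfolding R_def sum.lessThan_Suc_shift by simp
  ultimately show ?case by (simp add: R_def mult_ac)
qed

text \<open>Only total degrees below \<open>N\<close> occur, hence the value 0 for N = 0. The
  nesting reflects an expansion in y followed by one of each coefficient in x; it fits the fixed
  order of differentiation and avoids the symmetry of mixed derivatives.\<close>

definition taylor :: "nat \<Rightarrow> (plane \<Rightarrow> complex) \<Rightarrow> plane \<Rightarrow> complex" where
  "taylor N \<Psi> z = (\<Sum>j<N. of_real (snd z ^ j / fact j) *
     (\<Sum>i<N - j. of_real (fst z ^ i / fact i) * (pdx ^^ i) ((pdy ^^ j) \<Psi>) 0))"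

text \<open>The expansion in y from (x, 0) has an error of size |y|^N; the coefficient of y^j is
  then expanded in x only to order N - j, with an error of size |y|^j |x|^(N-j). These are N + 1
  errors, each at most the norm times |z|^N.\<close>

lemma taylor_bound:
  assumes \<Psi>: "\<Psi> \<in> Ck_c N U"
  shows "norm (\<Psi> z - taylor N \<Psi> z) \<le> (real N + 1) * Ck_norm N \<Psi> * norm z ^ N"
proof -
  have Ck: "Ck_on N UNIV \<Psi>" using \<Psi> by (auto simp: Ck_c_def)
  define B where "B = Ck_norm N \<Psi>"
  have B0: "B \<ge> 0" using order_trans[OF norm_ge_zero Ck_norm_bound[OF \<Psi>, of 0 0 0]] by (simp add: B_def)
  define x y where "x = fst z" and "y = snd z"
  have x: "\<bar>x\<bar> \<le> norm z" and y: "\<bar>y\<bar> \<le> norm z"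
    using abs_fst_le_norm abs_snd_le_norm by (auto simp: x_def y_def)
  have cx: "((\<lambda>t. F (t, v)) has_vector_derivative pdx F (t, v)) (at t)" if "F differentiable (at (t, v))" for F t v
  proof -
    have "((\<lambda>t. (t, v)) has_derivative (\<lambda>h. (h, 0))) (at t)"
      by (intro has_derivative_Pair has_derivative_ident has_derivative_const)
    from has_derivative_compose[OF this has_derivative_pd[OF that]]
    show ?thesis by (simp add: has_vector_derivative_def scaleR_conv_of_real)
  qed
  have cy: "((\<lambda>t. F (u, t)) has_vector_derivative pdy F (u, t)) (at t)" if "F differentiable (at (u, t))" for F t u
  proof -
    have "((\<lambda>t. (u, t)) has_derivative (\<lambda>h. (0, h))) (at t)"
      by (intro has_derivative_Pair has_derivative_ident has_derivative_const)
    from has_derivative_compose[OF this has_derivative_pd[OF that]]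
    show ?thesis by (simp add: has_vector_derivative_def scaleR_conv_of_real)
  qed
  have Y: "norm (\<Psi> (x, y) - (\<Sum>j<N. of_real (y ^ j / fact j) * (pdy ^^ j) \<Psi> (x, 0))) \<le> B * \<bar>y\<bar> ^ N"
  proof -
    have "((\<lambda>t. (pdy ^^ j) \<Psi> (x, t)) has_vector_derivative (pdy ^^ Suc j) \<Psi> (x, t)) (at t)" if "j < N" for j t
      using cy[OF jet_differentiable[OF Ck, of 0 j "(x, t)"]] that by simp
    moreover have "norm ((pdy ^^ N) \<Psi> (x, t)) \<le> B" for t
      using Ck_norm_bound[OF \<Psi>, of 0 N] by (simp add: B_def)
    ultimately show ?thesis
      using real_taylor_bound[of N "\<lambda>j t. (pdy ^^ j) \<Psi> (x, t)" B y] by simp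
  qed
  have X: "norm ((pdy ^^ j) \<Psi> (x, 0) - (\<Sum>i<N - j. of_real (x ^ i / fact i) * (pdx ^^ i) ((pdy ^^ j) \<Psi>) 0))
      \<le> B * \<bar>x\<bar> ^ (N - j)" if "j < N" for j
  proof -
    have "((\<lambda>t. (pdx ^^ i) ((pdy ^^ j) \<Psi>) (t, 0)) has_vector_derivative (pdx ^^ Suc i) ((pdy ^^ j) \<Psi>) (t, 0)) (at t)"
      if "i < N - j" for i t
      using cx[OF jet_differentiable[OF Ck, of i j "(t, 0)"]] that by simp
    moreover have "norm ((pdx ^^ (N - j)) ((pdy ^^ j) \<Psi>) (t, 0)) \<le> B" for t
      using Ck_norm_bound[OF \<Psi>, of "N - j" j] that by (simp add: B_def)
    ultimately show ?thesis
      using real_taylor_bound[of "N - j" "\<lambda>i t. (pdx ^^ i) ((pdy ^^ j) \<Psi>) (t, 0)" B x]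
      by (simp add: zero_prod_def)
  qed
  have "\<Psi> z - taylor N \<Psi> z = (\<Psi> (x, y) - (\<Sum>j<N. of_real (y ^ j / fact j) * (pdy ^^ j) \<Psi> (x, 0))) +
     (\<Sum>j<N. of_real (y ^ j / fact j) * ((pdy ^^ j) \<Psi> (x, 0) -
        (\<Sum>i<N - j. of_real (x ^ i / fact i) * (pdx ^^ i) ((pdy ^^ j) \<Psi>) 0)))"
    by (simp add: taylor_def x_def y_def right_diff_distrib sum_subtractf)
  also have "norm \<dots> \<le> B * norm z ^ N + (\<Sum>j<N. B * norm z ^ N)"
  proof (intro norm_triangle_le add_mono sum_norm_le)
    show "norm (\<Psi> (x, y) - (\<Sum>j<N. of_real (y ^ j / fact j) * (pdy ^^ j) \<Psi> (x, 0))) \<le> B * norm z ^ N"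
      using Y mult_left_mono[OF power_mono[OF y abs_ge_zero] B0, of N] by linarith
    fix j assume "j \<in> {..<N}"
    then have j: "j < N" by simp
    have "\<bar>y ^ j / fact j\<bar> \<le> norm z ^ j"
    proof -
      have "\<bar>y ^ j / fact j\<bar> \<le> \<bar>y\<bar> ^ j"
        by (simp add: abs_divide power_abs divide_le_eq mult_le_cancel_left1 fact_ge_1)
      then show ?thesis using power_mono[OF y abs_ge_zero, of j] by linarith
    qed
    moreover have "B * \<bar>x\<bar> ^ (N - j) \<le> B * norm z ^ (N - j)"
      by (intro mult_left_mono power_mono x B0) auto
    ultimately have "norm (of_real (y ^ j / fact j) * ((pdy ^^ j) \<Psi> (x, 0) -
        (\<Sum>i<N - j. of_real (x ^ i / fact i) * (pdx ^^ i) ((pdy ^^ j) \<Psi>) 0))) \<le> norm z ^ j * (B * norm z ^ (N - j))"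
      unfolding norm_mult norm_of_real using order_trans[OF X[OF j]] by (intro mult_mono) auto
    also have "\<dots> = B * norm z ^ N" using j by (simp add: mult.left_commute flip: power_add)
    finally show "norm (of_real (y ^ j / fact j) * ((pdy ^^ j) \<Psi> (x, 0) -
        (\<Sum>i<N - j. of_real (x ^ i / fact i) * (pdx ^^ i) ((pdy ^^ j) \<Psi>) 0))) \<le> B * norm z ^ N" .
  qed
  also have "\<dots> = (real N + 1) * B * norm z ^ N" by (simp add: algebra_simps)
  finally show ?thesis by (simp add: B_def)
qed

lemma taylor_add:
  assumes "Ck_on N UNIV \<Phi>" "Ck_on N UNIV \<Psi>"
  shows "taylor N (\<lambda>z. \<Phi> z + \<Psi> z) z = taylor N \<Phi> z + taylor N \<Psi> z"
proof -
  have "taylor N (\<lambda>z. \<Phi> z + \<Psi> z) z = (\<Sum>j<N. of_real (snd z ^ j / fact j) *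
     (\<Sum>i<N - j. of_real (fst z ^ i / fact i) * ((pdx ^^ i) ((pdy ^^ j) \<Phi>) 0 + (pdx ^^ i) ((pdy ^^ j) \<Psi>) 0)))"
    unfolding taylor_def by (intro sum.cong refl arg_cong2[where f="(*)"]) (simp add: jet_add[OF assms])
  then show ?thesis by (simp add: taylor_def distrib_left sum.distrib)
qed

lemma taylor_cmult:
  assumes "Ck_on N UNIV \<Phi>"
  shows "taylor N (\<lambda>z. c * \<Phi> z) z = c * taylor N \<Phi> z"
proof -
  have "taylor N (\<lambda>z. c * \<Phi> z) z = (\<Sum>j<N. of_real (snd z ^ j / fact j) *
     (\<Sum>i<N - j. of_real (fst z ^ i / fact i) * (c * (pdx ^^ i) ((pdy ^^ j) \<Phi>) 0)))"
    unfolding taylor_def by (intro sum.cong refl arg_cong2[where f="(*)"]) (simp add: jet_cmult[OF assms])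
  then show ?thesis by (simp add: taylor_def sum_distrib_left mult_ac)
qed

lemma continuous_on_taylor: "continuous_on S (taylor N \<Psi>)"
  unfolding taylor_def[abs_def] by (intro continuous_intros) auto

lemma taylor_eq_0:
  assumes "\<And>i j. i + j < N \<Longrightarrow> (pdx ^^ i) ((pdy ^^ j) \<Psi>) 0 = 0"
  shows "taylor N \<Psi> z = 0"
  unfolding taylor_def using assms by (intro sum.neutral ballI) (simp add: sum.neutral)

section \<open>Integrals over the plane\<close>

lemma AE_plane_off_axes: "AE z in (lborel :: plane measure). fst z \<noteq> 0 \<and> snd z \<noteq> 0"
proof -
  have "AE z in lborel \<Otimes>\<^sub>M (lborel :: real measure). fst z \<noteq> (0::real) \<and> snd z \<noteq> (0::real)"
  proof (rule lborel_pair.AE_pair_measure)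
    show "AE x in lborel. AE y in lborel. fst (x, y) \<noteq> (0::real) \<and> snd (x, y) \<noteq> (0::real)"
      using AE_lborel_singleton[of "0::real"]
    proof eventually_elim
      case (elim x)
      show ?case using AE_lborel_singleton[of "0::real"] by eventually_elim (use elim in simp)
    qed
  qed measurable
  then show ?thesis unfolding lborel_prod .
qed

text \<open>On the right half the antiderivative is 2 sqrt x; the left half is its reflection,
  written as an affine substitution.\<close>

lemma integrable_inverse_sqrt:
  assumes "R > 0"
  shows "integrable lborel (\<lambda>x. indicator {0<..<R} \<bar>x\<bar> * (1 / sqrt \<bar>x\<bar>) :: real)"
proof -
  have "set_integrable lborel (einterval (ereal 0) (ereal R)) (\<lambda>x. 1 / sqrt x)"
  proof (rule interval_integral_FTC_nonneg(1)[where F="\<lambda>x. 2 * sqrt x" and A=0 and B="2 * sqrt R"])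
    show "ereal 0 < ereal R" using assms by simp
    show "DERIV (\<lambda>x. 2 * sqrt x) x :> 1 / sqrt x" if "ereal 0 < ereal x" for x
      using that by (auto intro!: derivative_eq_intros simp: field_simps)
    show "isCont (\<lambda>x. 1 / sqrt x) x" if "ereal 0 < ereal x" for x
      using that by (auto intro!: continuous_intros)
    show "AE x in lborel. ereal 0 < ereal x \<longrightarrow> ereal x < ereal R \<longrightarrow> 0 \<le> 1 / sqrt x" by simp
    have "continuous_on UNIV (\<lambda>x. 2 * sqrt x)" by (intro continuous_intros)
    then have "isCont (\<lambda>x. 2 * sqrt x) x" for x by (simp add: continuous_on_eq_continuous_at)
    then have *: "((\<lambda>x. 2 * sqrt x) \<longlongrightarrow> 2 * sqrt x) (at x)" for x using isCont_def by blast
    show "(((\<lambda>x. 2 * sqrt x) \<circ> real_of_ereal) \<longlongrightarrow> 0) (at_right (ereal 0))"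
      "(((\<lambda>x. 2 * sqrt x) \<circ> real_of_ereal) \<longlongrightarrow> 2 * sqrt R) (at_left (ereal R))"
      unfolding ereal_tendsto_simps
      using tendsto_within_subset[OF *[of 0]] tendsto_within_subset[OF *[of R]] by auto
  qed
  then have k: "integrable lborel (\<lambda>x. indicator {0<..<R} x * (1 / sqrt x))"
    by (simp add: set_integrable_def)
  have "integrable lborel (\<lambda>x. indicator {0<..<R} (0 + (-1) * x) * (1 / sqrt (0 + (-1) * x)))"
    by (rule lborel_integrable_real_affine[OF k]) simp
  from Bochner_Integration.integrable_add[OF k this]
  show ?thesis
    by (rule Bochner_Integration.integrable_cong[THEN iffD1, rotated -1]) (auto simp: indicator_def abs_if)
qed

text \<open>Instead of polar coordinates, |x| |y| <= |z|^2 gives 1/|z| <= 1 / (sqrt |x| sqrt |y|)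
  off the axes, a product of integrable functions of one variable.\<close>

lemma integrable_inverse_norm: "set_integrable lborel (ball 0 R) (\<lambda>z::plane. 1 / norm z)"
proof (cases "R > 0")
  case R: True
  define h where "h x = (indicator {0<..<R} \<bar>x\<bar> * (1 / sqrt \<bar>x\<bar>) :: real)" for x
  have h: "integrable lborel h" using integrable_inverse_sqrt[OF R] by (simp add: h_def[abs_def])
  have [measurable]: "h \<in> borel_measurable borel" using h by simp
  have "integrable (lborel \<Otimes>\<^sub>M lborel) (\<lambda>z. h (fst z) * h (snd z))"
  proof (rule lborel_pair.Fubini_integrable)
    show "(\<lambda>z. h (fst z) * h (snd z)) \<in> borel_measurable (lborel \<Otimes>\<^sub>M lborel)" by measurable
    have "integrable lborel (\<lambda>x. norm (h x) * (\<integral>y. norm (h y) \<partial>lborel))"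
      using h by (intro integrable_mult_left) auto
    then show "integrable lborel (\<lambda>x. \<integral>y. norm (h (fst (x, y)) * h (snd (x, y))) \<partial>lborel)"
      by (simp add: abs_mult)
    show "AE x in lborel. integrable lborel (\<lambda>y. h (fst (x, y)) * h (snd (x, y)))"
      using h by simp
  qed
  then have "integrable lborel (\<lambda>z::plane. h (fst z) * h (snd z))" by (simp add: lborel_prod)
  then show ?thesis unfolding set_integrable_def
  proof (rule Bochner_Integration.integrable_bound)
    show "(\<lambda>z::plane. indicator (ball 0 R) z *\<^sub>R (1 / norm z)) \<in> borel_measurable lborel"
      by (auto intro!: borel_measurable_scaleR borel_measurable_indicator borel_measurable_divide
          borel_measurable_norm)
    show "AE z in lborel. norm (indicator (ball 0 R) z *\<^sub>R (1 / norm (z::plane))) \<le> norm (h (fst z) * h (snd z))"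
      using AE_plane_off_axes
    proof eventually_elim
      case (elim z)
      show ?case
      proof (cases "z \<in> ball 0 R")
        case True
        have le: "\<bar>fst z\<bar> \<le> norm z" "\<bar>snd z\<bar> \<le> norm z" by (rule abs_fst_le_norm abs_snd_le_norm)+
        have "sqrt (\<bar>fst z\<bar> * \<bar>snd z\<bar>) \<le> sqrt (norm z * norm z)"
          using le by (intro real_sqrt_le_mono mult_mono) auto
        then have "sqrt \<bar>fst z\<bar> * sqrt \<bar>snd z\<bar> \<le> norm z" by (simp add: real_sqrt_mult)
        then have "1 / norm z \<le> 1 / (sqrt \<bar>fst z\<bar> * sqrt \<bar>snd z\<bar>)"
          using elim by (intro divide_left_mono mult_pos_pos) auto
        moreover have "\<bar>fst z\<bar> < R" "\<bar>snd z\<bar> < R" using le True by auto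
        ultimately show ?thesis using True elim by (simp add: h_def abs_mult)
      qed simp
    qed
  qed
qed (simp add: set_integrable_def ball_empty)

lemma line_integral_zero:
  fixes X G :: "real \<Rightarrow> complex"
  assumes "integrable lborel G" "R > 0"
    and "\<And>x. (X has_vector_derivative G x) (at x)"
    and "\<And>x. \<bar>x\<bar> \<ge> R \<Longrightarrow> X x = 0" "\<And>x. \<bar>x\<bar> \<ge> R \<Longrightarrow> G x = 0"
  shows "(\<integral>x. G x \<partial>lborel) = 0"
proof -
  have e: "indicator {-R..R} x *\<^sub>R G x = G x" for x
    using assms(5)[of x] by (auto simp: indicator_def)
  then have i: "set_integrable lborel {-R..R} G" using assms(1) by (simp add: set_integrable_def)
  have "(G has_integral (X R - X (- R))) {-R..R}"
    using assms(2) by (intro fundamental_theorem_of_calculus) (auto intro: has_vector_derivative_at_within assms(3))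
  then have "integral {-R..R} G = 0" using assms(2,4) by (simp add: integral_unique)
  then show ?thesis using set_borel_integral_eq_integral(2)[OF i] e by (simp add: set_lebesgue_integral_def)
qed

text \<open>Almost every horizontal line misses the origin, so differentiability along the lines
  with y nonzero suffices; the singular point enters only through the integrability of
  \<open>G\<close>.\<close>

lemma integral_pdx_zero:
  fixes X G :: "plane \<Rightarrow> complex"
  assumes G: "integrable lborel G" and R: "R > 0"
    and D: "\<And>x y. y \<noteq> 0 \<Longrightarrow> ((\<lambda>x. X (x, y)) has_vector_derivative G (x, y)) (at x)"
    and z: "\<And>z. norm z \<ge> R \<Longrightarrow> X z = 0" "\<And>z. norm z \<ge> R \<Longrightarrow> G z = 0"
  shows "(\<integral>z. G z \<partial>lborel) = 0"
proof -
  have n: "norm (x, y) \<ge> \<bar>x\<bar>" for x y :: real using abs_fst_le_norm[of "(x, y)"] by simp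
  have G': "integrable (lborel \<Otimes>\<^sub>M lborel) (\<lambda>(x, y). G (x, y))" using G by (simp add: lborel_prod)
  have "(\<integral>z. G z \<partial>lborel) = (\<integral>y. (\<integral>x. G (x, y) \<partial>lborel) \<partial>lborel)"
    using lborel_pair.integral_snd[OF G'] by (simp add: lborel_prod)
  also have "\<dots> = (\<integral>y. 0 \<partial>(lborel :: real measure))"
  proof (rule integral_cong_AE)
    have "AE y in lborel. integrable lborel (\<lambda>x. G (x, y))"
      using lborel_pair.AE_integrable_snd[OF G'] by simp
    with AE_lborel_singleton[of "0::real"]
    show "AE y in lborel. (\<integral>x. G (x, y) \<partial>lborel) = 0"
    proof eventually_elim
      case (elim y)
      show ?case using elim(2) R D[OF elim(1)]
        by (rule line_integral_zero) (use z order_trans[OF _ n] in blast)+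
    qed
  qed (use lborel_pair.integrable_snd[OF G'] in simp_all)
  finally show ?thesis by simp
qed

lemma integral_pdy_zero:
  fixes X G :: "plane \<Rightarrow> complex"
  assumes G: "integrable lborel G" and R: "R > 0"
    and D: "\<And>x y. x \<noteq> 0 \<Longrightarrow> ((\<lambda>y. X (x, y)) has_vector_derivative G (x, y)) (at y)"
    and z: "\<And>z. norm z \<ge> R \<Longrightarrow> X z = 0" "\<And>z. norm z \<ge> R \<Longrightarrow> G z = 0"
  shows "(\<integral>z. G z \<partial>lborel) = 0"
proof -
  have n: "norm (x, y) \<ge> \<bar>y\<bar>" for x y :: real using abs_snd_le_norm[of "(x, y)"] by simp
  have G': "integrable (lborel \<Otimes>\<^sub>M lborel) (\<lambda>(x, y). G (x, y))" using G by (simp add: lborel_prod)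
  have "(\<integral>z. G z \<partial>lborel) = (\<integral>x. (\<integral>y. G (x, y) \<partial>lborel) \<partial>lborel)"
    using lborel_pair.integral_fst[OF G'] by (simp add: lborel_prod)
  also have "\<dots> = (\<integral>x. 0 \<partial>(lborel :: real measure))"
  proof (rule integral_cong_AE)
    have "AE x in lborel. integrable lborel (\<lambda>y. G (x, y))"
      using lborel_pair.AE_integrable_fst[OF G'] by simp
    with AE_lborel_singleton[of "0::real"]
    show "AE x in lborel. (\<integral>y. G (x, y) \<partial>lborel) = 0"
    proof eventually_elim
      case (elim x)
      show ?case using elim(2) R D[OF elim(1)]
        by (rule line_integral_zero) (use z order_trans[OF _ n] in blast)+
    qed
  qed (use lborel_pair.integrable_fst[OF G'] in simp_all)
  finally show ?thesis by simp
qed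

section \<open>The distribution solution\<close>

lemma locally_integrable_continuous:
  assumes "continuous_on U f"
  shows "locally_integrable U f"
  unfolding locally_integrable_def set_integrable_def
  by (intro allI impI borel_integrable_compact continuous_on_subset[OF assms]) (erule conjunct1 conjunct2)+

lemma set_integrable_times_test:
  fixes f \<Phi> :: "plane \<Rightarrow> complex"
  assumes f: "locally_integrable U f" and \<Phi>: "\<And>z. norm (\<Phi> z) \<le> M" "continuous_on UNIV \<Phi>"
    and K: "compact K" "K \<subseteq> U" "\<And>z. z \<notin> K \<Longrightarrow> \<Phi> z = 0"
  shows "set_integrable lborel U (\<lambda>z. f z * \<Phi> z)"
    "norm (LINT z:U|lborel. f z * \<Phi> z) \<le> M * (LINT z:K|lborel. norm (f z))"
proof -
  have fK: "set_integrable lborel K f" using f K unfolding locally_integrable_def by blast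
  then have fK': "integrable lborel (\<lambda>z. indicator K z *\<^sub>R f z)" by (simp add: set_integrable_def)
  have eq: "indicator U z *\<^sub>R (f z * \<Phi> z) = (indicator K z *\<^sub>R f z) * \<Phi> z" for z
    using K(2) K(3)[of z] by (auto simp: indicator_def)
  have [measurable]: "\<Phi> \<in> borel_measurable borel"
    using \<Phi>(2) by (rule borel_measurable_continuous_onI)
  have b: "norm ((indicator K z *\<^sub>R f z) * \<Phi> z) \<le> norm (M * norm (indicator K z *\<^sub>R f z))" for z
  proof -
    have "M \<ge> 0" using order_trans[OF norm_ge_zero \<Phi>(1)] .
    then show ?thesis
      using mult_right_mono[OF \<Phi>(1)[of z], of "norm (indicator K z *\<^sub>R f z)"]
      by (simp add: norm_mult abs_mult mult_ac)
  qed
  have i: "integrable lborel (\<lambda>z. (indicator K z *\<^sub>R f z) * \<Phi> z)"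
  proof (rule Bochner_Integration.integrable_bound)
    show "integrable lborel (\<lambda>z. M * norm (indicator K z *\<^sub>R f z))"
      using fK' by (intro integrable_mult_right integrable_norm)
    show "(\<lambda>z. (indicator K z *\<^sub>R f z) * \<Phi> z) \<in> borel_measurable lborel"
      by (intro borel_measurable_times borel_measurable_integrable[OF fK']) simp
  qed (use b in auto)
  then show "set_integrable lborel U (\<lambda>z. f z * \<Phi> z)" by (simp only: set_integrable_def eq)
  have "norm (\<integral>z. (indicator K z *\<^sub>R f z) * \<Phi> z \<partial>lborel) \<le> (\<integral>z. M * norm (indicator K z *\<^sub>R f z) \<partial>lborel)"
  proof (rule Bochner_Integration.integral_norm_bound_integral[OF i])
    show "integrable lborel (\<lambda>z. M * norm (indicator K z *\<^sub>R f z))"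
      using fK' by (intro integrable_mult_right integrable_norm)
    show "norm ((indicator K z *\<^sub>R f z) * \<Phi> z) \<le> M * norm (indicator K z *\<^sub>R f z)" for z
      using mult_right_mono[OF \<Phi>(1)[of z], of "norm (indicator K z *\<^sub>R f z)"]
      by (simp add: norm_mult mult_ac)
  qed
  then show "norm (LINT z:U|lborel. f z * \<Phi> z) \<le> M * (LINT z:K|lborel. norm (f z))"
    by (simp add: set_lebesgue_integral_def eq)
qed

lemma Cinf_c_subset_Ck_c: "Cinf_c U \<subseteq> Ck_c N U"
  by (auto simp: Cinf_c_def Ck_c_def smooth_on_def)

lemma extends_to_order_imp_distribution: "extends_to_order N U T T \<Longrightarrow> distribution U T"
  using Cinf_c_subset_Ck_c[of U N]
  unfolding extends_to_order_def distribution_def linear_functional_on_def by (meson subsetD)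

lemma Ck_c_bounds:
  assumes "\<Psi> \<in> Ck_c N U"
  shows "norm (\<Psi> z) \<le> Ck_norm N \<Psi>" "continuous_on UNIV \<Psi>" "compact (supp \<Psi>)" "supp \<Psi> \<subseteq> U"
    "z \<notin> supp \<Psi> \<Longrightarrow> \<Psi> z = 0"
  using Ck_norm_bound[OF assms, of 0 0 z] assms Ck_on_continuous[of N UNIV \<Psi>] zero_off_supp
  by (auto simp: Ck_c_def)

lemma open_off_supp: "open (- supp \<Phi>)"
  unfolding supp_def by (intro open_Compl closed_closure)

lemma compact_supp_subset:
  assumes "compact K" "supp \<Psi> \<subseteq> K"
  shows "compact (supp \<Psi>)"
  using compact_Int_closed[OF assms(1) closed_closure[of "{z. \<Psi> z \<noteq> 0}"]] assms(2)
  by (simp add: supp_def Int_absorb1)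

lemma pd_off_supp: "z \<notin> supp \<Phi> \<Longrightarrow> pdx \<Phi> z = 0 \<and> pdy \<Phi> z = 0"
proof -
  assume z: "z \<notin> supp \<Phi>"
  have "(pdx ^^ i) ((pdy ^^ j) \<Phi>) z = 0" for i j
    by (rule jet_zero_outside[OF open_off_supp[of \<Phi>]]) (use z zero_off_supp in auto)
  from this[of 1 0] this[of 0 1] show ?thesis by simp
qed

text \<open>The finite part integral: subtracting the Taylor polynomial of degree \<open>N - 1\<close> makes the
  integrand \<open>O(1 / norm z)\<close>. When \<open>h\<close> is locally integrable the subtraction would add a
  distribution supported at the origin, so it is omitted.\<close>

definition finite_part ::
    "plane set \<Rightarrow> nat \<Rightarrow> (plane \<Rightarrow> complex) \<Rightarrow> (plane \<Rightarrow> complex) \<Rightarrow> complex" where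
  "finite_part U N h \<Psi> = (if locally_integrable U h then LINT z:U|lborel. h z * \<Psi> z
     else LINT z:U|lborel. h z * (\<Psi> z - taylor N \<Psi> z))"

text \<open>The formula makes sense on C^N test functions, so the functional is its own extension.
  In the subtracted case the size r^-(N+1) of \<open>h\<close> meets the remainder r^N, leaving 1/r,
  and the constant does not depend on the support; in the locally integrable case the constant is
  the integral of |h| over \<open>K\<close>.\<close>

lemma finite_part_extends:
  fixes h :: "plane \<Rightarrow> complex"
  assumes e: "0 < e" "e \<le> 1" and h: "continuous_on (ball 0 e - {0}) h" "h 0 = 0"
    and b: "\<And>z. z \<in> ball 0 e - {0} \<Longrightarrow> norm (h z) \<le> C * norm z powr - (real N + 1)"
  shows "extends_to_order N (ball 0 e) (finite_part (ball 0 e) N h) (finite_part (ball 0 e) N h)"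
proof -
  define U where "U = ball (0::plane) e"
  have C0: "C \<ge> 0"
  proof -
    have "(e / 2, 0) \<in> ball (0::plane) e - {0}" using e by (simp add: norm_Pair prod_eq_iff)
    from order_trans[OF norm_ge_zero b[OF this]] show ?thesis using e
      by (simp add: zero_le_mult_iff norm_Pair zero_prod_def)
  qed
  have sub: "set_integrable lborel U (\<lambda>z. h z * (\<Psi> z - taylor N \<Psi> z))"
    "norm (LINT z:U|lborel. h z * (\<Psi> z - taylor N \<Psi> z)) \<le>
      C * (real N + 1) * (LINT z:U|lborel. 1 / norm z) * Ck_norm N \<Psi>" if \<Psi>: "\<Psi> \<in> Ck_c N U" for \<Psi>
  proof -
    define B where "B = C * (real N + 1) * Ck_norm N \<Psi>"
    have iU: "integrable lborel (\<lambda>z. indicator U z *\<^sub>R (1 / norm z))"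
      using integrable_inverse_norm[of e] by (simp add: U_def set_integrable_def)
    then have iB: "integrable lborel (\<lambda>z. B * (indicator U z *\<^sub>R (1 / norm z)))"
      by (rule integrable_mult_right)
    have bd: "norm (indicator U z *\<^sub>R (h z * (\<Psi> z - taylor N \<Psi> z))) \<le> B * (indicator U z *\<^sub>R (1 / norm z))" for z
    proof (cases "z \<in> U - {0}")
      case True
      then have z: "z \<in> ball 0 e - {0}" "norm z > 0" by (auto simp: U_def)
      have "norm (h z * (\<Psi> z - taylor N \<Psi> z)) \<le>
          (C * norm z powr - (real N + 1)) * ((real N + 1) * Ck_norm N \<Psi> * norm z ^ N)"
        unfolding norm_mult by (intro mult_mono b z taylor_bound[OF \<Psi>]) (auto simp: C0)
      also have "\<dots> = B * (norm z powr - (real N + 1) * norm z powr real N)"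
        using z by (simp add: B_def powr_realpow)
      also have "norm z powr - (real N + 1) * norm z powr real N = 1 / norm z"
        using z by (simp flip: powr_add)
      finally show ?thesis using True by simp
    next
      case False
      then show ?thesis using h(2) by (cases "z = 0") auto
    qed
    \<comment> \<open>\<open>h\<close> is continuous only off the origin; by \<open>h 0 = 0\<close>
      the punctured and the full disc give the same integrand.\<close>
    have meas: "(\<lambda>z. indicator U z *\<^sub>R (h z * (\<Psi> z - taylor N \<Psi> z))) \<in> borel_measurable lborel"
    proof -
      have "(\<lambda>z. indicator (ball 0 e - {0}) z *\<^sub>R (h z * (\<Psi> z - taylor N \<Psi> z))) \<in> borel_measurable borel"
        by (intro borel_measurable_continuous_on_indicator continuous_on_mult h continuous_on_diff
            continuous_on_taylor continuous_on_subset[OF Ck_c_bounds(2)[OF \<Psi>]]) auto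
      moreover have "(\<lambda>z. indicator (ball 0 e - {0}) z *\<^sub>R (h z * (\<Psi> z - taylor N \<Psi> z))) =
          (\<lambda>z. indicator U z *\<^sub>R (h z * (\<Psi> z - taylor N \<Psi> z)))"
        using h(2) by (auto simp: U_def indicator_def fun_eq_iff simp del: split_paired_All)
      ultimately show ?thesis by simp
    qed
    show *: "set_integrable lborel U (\<lambda>z. h z * (\<Psi> z - taylor N \<Psi> z))"
      unfolding set_integrable_def
    proof (rule Bochner_Integration.integrable_bound[OF iB meas])
      show "AE z in lborel. norm (indicator U z *\<^sub>R (h z * (\<Psi> z - taylor N \<Psi> z))) \<le>
          norm (B * (indicator U z *\<^sub>R (1 / norm z)))"
        by (rule AE_I2) (unfold real_norm_def, rule order_trans[OF bd abs_ge_self])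
    qed
    have "norm (LINT z:U|lborel. h z * (\<Psi> z - taylor N \<Psi> z)) \<le> (\<integral>z. B * (indicator U z *\<^sub>R (1 / norm z)) \<partial>lborel)"
      unfolding set_lebesgue_integral_def
      by (rule Bochner_Integration.integral_norm_bound_integral[OF *[unfolded set_integrable_def] iB]) (rule bd)
    then show "norm (LINT z:U|lborel. h z * (\<Psi> z - taylor N \<Psi> z)) \<le>
      C * (real N + 1) * (LINT z:U|lborel. 1 / norm z) * Ck_norm N \<Psi>"
      unfolding integral_mult_right_zero by (simp add: B_def set_lebesgue_integral_def mult_ac)
  qed
  have tst: "set_integrable lborel U (\<lambda>z. h z * \<Psi> z)" if "locally_integrable U h" "\<Psi> \<in> Ck_c N U" for \<Psi>
    by (rule set_integrable_times_test(1)[OF that(1) Ck_c_bounds[OF that(2)]])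
  have "linear_functional_on (Ck_c N U) (finite_part U N h)"
    unfolding linear_functional_on_def
  proof (intro conjI ballI allI)
    fix \<Phi> \<Psi> assume P: "\<Phi> \<in> Ck_c N U" "\<Psi> \<in> Ck_c N U"
    show "finite_part U N h (\<lambda>z. \<Phi> z + \<Psi> z) = finite_part U N h \<Phi> + finite_part U N h \<Psi>"
    proof (cases "locally_integrable U h")
      case True
      then show ?thesis using set_integral_add(2)[OF tst[OF True P(1)] tst[OF True P(2)]]
        by (simp add: finite_part_def distrib_left)
    next
      case False
      have "h z * (\<Phi> z + \<Psi> z - taylor N (\<lambda>z. \<Phi> z + \<Psi> z) z) =
          h z * (\<Phi> z - taylor N \<Phi> z) + h z * (\<Psi> z - taylor N \<Psi> z)" for z
        using P by (simp add: taylor_add Ck_c_def algebra_simps)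
      then show ?thesis using set_integral_add(2)[OF sub(1)[OF P(1)] sub(1)[OF P(2)]] False
        by (simp add: finite_part_def)
    qed
  next
    fix \<Phi> c assume P: "\<Phi> \<in> Ck_c N U"
    show "finite_part U N h (\<lambda>z. c * \<Phi> z) = c * finite_part U N h \<Phi>"
    proof (cases "locally_integrable U h")
      case True
      then show ?thesis using set_integral_mult_right[where a=c and f="\<lambda>z. h z * \<Phi> z" and A=U and M=lborel]
        by (simp add: finite_part_def mult.left_commute)
    next
      case False
      have "h z * (c * \<Phi> z - taylor N (\<lambda>z. c * \<Phi> z) z) = c * (h z * (\<Phi> z - taylor N \<Phi> z))" for z
        using P by (simp add: taylor_cmult Ck_c_def algebra_simps)
      then show ?thesis using False by (simp only: finite_part_def if_False set_integral_mult_right)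
    qed
  qed
  moreover have "\<exists>C. \<forall>\<Psi>\<in>Ck_c N U. supp \<Psi> \<subseteq> K \<longrightarrow> norm (finite_part U N h \<Psi>) \<le> C * Ck_norm N \<Psi>"
    if K: "compact K" "K \<subseteq> U" for K
  proof (cases "locally_integrable U h")
    case True
    have "norm (finite_part U N h \<Psi>) \<le> (LINT z:K|lborel. norm (h z)) * Ck_norm N \<Psi>"
      if \<Psi>: "\<Psi> \<in> Ck_c N U" "supp \<Psi> \<subseteq> K" for \<Psi>
      using set_integrable_times_test(2)[OF True Ck_c_bounds(1,2)[OF \<Psi>(1)] K] Ck_c_bounds(5)[OF \<Psi>(1)] \<Psi>(2) True
      by (auto simp: finite_part_def mult.commute)
    then show ?thesis by blast
  next
    case False
    have "norm (finite_part U N h \<Psi>) \<le> (C * (real N + 1) * (LINT z:U|lborel. 1 / norm z)) * Ck_norm N \<Psi>"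
      if "\<Psi> \<in> Ck_c N U" for \<Psi>
      using sub(2)[OF that] False by (simp add: finite_part_def)
    then show ?thesis by blast
  qed
  ultimately show ?thesis unfolding extends_to_order_def U_def by blast
qed

text \<open>With a zero Taylor polynomial both branches of \<open>finite_part\<close> are the plain
  integral. This serves test functions supported off the origin as well as transposed ones.\<close>

lemma finite_part_flat:
  assumes "\<And>i j. i + j < N \<Longrightarrow> (pdx ^^ i) ((pdy ^^ j) \<Psi>) 0 = 0"
  shows "finite_part U N h \<Psi> = (LINT z:U|lborel. h z * \<Psi> z)"
  by (simp add: finite_part_def taylor_eq_0[OF assms])

lemma finite_part_singular:
  fixes h :: "plane \<Rightarrow> complex"
  assumes e: "0 < e" "e \<le> 1" and h: "continuous_on (ball 0 e - {0}) h" "h 0 = 0"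
    and b: "\<And>z. z \<in> ball 0 e - {0} \<Longrightarrow> norm (h z) \<le> C * norm z powr - (real N + 1)"
  shows "distribution_of_singular (ball 0 e) (finite_part (ball 0 e) N h) h"
  unfolding distribution_of_singular_def
proof (intro conjI impI)
  let ?U = "ball (0::plane) e"
  show "distribution ?U (finite_part ?U N h)"
    by (rule extends_to_order_imp_distribution[OF finite_part_extends[OF assms]])
  show "coincides_on ?U (finite_part ?U N h) h" if "locally_integrable ?U h"
    using that by (simp add: coincides_on_def finite_part_def)
  show "coincides_on (?U - {0}) (finite_part ?U N h) h"
    unfolding coincides_on_def
  proof (intro conjI ballI)
    show "locally_integrable (?U - {0}) h" by (rule locally_integrable_continuous[OF h(1)])
    fix \<Phi> assume \<Phi>: "\<Phi> \<in> Cinf_c (?U - {0})"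
    then have 0: "0 \<in> - supp \<Phi>" by (auto simp: Cinf_c_def)
    have "finite_part ?U N h \<Phi> = (LINT z:?U|lborel. h z * \<Phi> z)"
      by (rule finite_part_flat, rule jet_zero_outside[OF open_off_supp[of \<Phi>] _ 0])
        (simp add: zero_off_supp)
    also have "\<dots> = (LINT z:?U - {0}|lborel. h z * \<Phi> z)"
      unfolding set_lebesgue_integral_def using h(2)
      by (intro Bochner_Integration.integral_cong) (auto simp: indicator_def)
    finally show "finite_part ?U N h \<Phi> = (LINT z:?U - {0}|lborel. h z * \<Phi> z)" .
  qed
qed

section \<open>The transposed field acting on test functions\<close>

context homogeneous_field
begin

text \<open>In the sense of \<open>sing_order\<close>, \<open>A\<close> and \<open>B\<close> have
  exponent Re lam, their first derivatives Re lam - 1, and test functions 0. Every term thus has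
  exponent at least Re lam - 1 > N.\<close>

lemma transpose_vfield_order:
  assumes \<Phi>: "\<Phi> \<in> Cinf_c U" and N: "real N < Re lam - 1"
  shows "transpose_vfield A B \<Phi> \<in> Ck_c N U"
    "i + j \<le> N \<Longrightarrow> (pdx ^^ i) ((pdy ^^ j) (transpose_vfield A B \<Phi>)) 0 = 0"
proof -
  define \<Psi> where "\<Psi> = transpose_vfield A B \<Phi>"
  define \<Psi>' where "\<Psi>' z = (-1) * ((A z * pdx \<Phi> z + B z * pdy \<Phi> z) + (pdx A z + pdy B z) * \<Phi> z)" for z
  have eq: "\<Psi> z = \<Psi>' z" if "z \<noteq> 0" for z
    using that by (simp add: \<Psi>_def \<Psi>'_def transpose_vfield_def vfield_def divergence_def)
  have U: "open (UNIV - {0::plane})" by (simp add: open_delete)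
  have sm: "smooth_on UNIV \<Phi>" "compact (supp \<Phi>)" "supp \<Phi> \<subseteq> U" using \<Phi> by (auto simp: Cinf_c_def)
  note sm\<Phi> = sm(1) smooth_onD(2,3)[OF sm(1)]
  note sm0 = sm\<Phi>[THEN smooth_on_subset, of "UNIV - {0}", OF subset_UNIV]
  note smA = smooth_A smooth_onD(2)[OF smooth_A] and smB = smooth_B smooth_onD(3)[OF smooth_B]
  have s1: "smooth_on (UNIV - {0}) \<Psi>'" unfolding \<Psi>'_def[abs_def]
    by (intro smooth_on_mult smooth_on_add smooth_on_const U sm0 smA smB)
  have "sing_order N (0 + (Re lam - 1)) \<Psi>'"
    unfolding \<Psi>'_def[abs_def]
  proof (intro sing_order_mult sing_order_add smooth_on_mult smooth_on_add smooth_on_const U sm0 smA smB)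
    show "sing_order N 0 (\<lambda>z. -1)" by (rule sing_order_smooth[OF smooth_on_const])
    have "sing_order N (Re lam + 0) (\<lambda>z. A z * pdx \<Phi> z)" "sing_order N (Re lam + 0) (\<lambda>z. B z * pdy \<Phi> z)"
      by (intro sing_order_mult sing_order_homogeneous sing_order_smooth hom_A hom_B smA smB sm0 sm\<Phi>)+
    then show "sing_order N (Re lam - 1) (\<lambda>z. A z * pdx \<Phi> z)" "sing_order N (Re lam - 1) (\<lambda>z. B z * pdy \<Phi> z)"
      by (auto elim: sing_order_mono)
    have "sing_order N (Re (lam - 1)) (pdx A)" "sing_order N (Re (lam - 1)) (pdy B)"
      by (intro sing_order_homogeneous smA smB homogeneous_pd hom_A hom_B)+
    from sing_order_add[OF smA(2) smB(2) this]
    have "sing_order N (Re lam - 1 + 0) (\<lambda>z. (pdx A z + pdy B z) * \<Phi> z)"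
      by (intro sing_order_mult smooth_on_add U sm0 smA smB sing_order_smooth sm\<Phi>) simp
    then show "sing_order N (Re lam - 1) (\<lambda>z. (pdx A z + pdy B z) * \<Phi> z)" by simp
  qed
  then have so: "sing_order N (Re lam - 1) \<Psi>" using sing_order_cong[of \<Psi> \<Psi>'] eq by simp
  have s: "smooth_on (UNIV - {0}) \<Psi>" using s1 smooth_on_cong[OF U, of \<Psi> \<Psi>'] eq by auto
  have \<Psi>0: "\<Psi> 0 = 0" by (simp add: \<Psi>_def transpose_vfield_def)
  note ext = sing_order_extends[OF s \<Psi>0 so N]
  have "\<Psi> z = 0" if "z \<notin> supp \<Phi>" for z
    using that pd_off_supp[OF that] zero_off_supp[OF that]
    by (simp add: \<Psi>_def transpose_vfield_def vfield_def)
  then have "{z. \<Psi> z \<noteq> 0} \<subseteq> supp \<Phi>" by blast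
  then have sub: "supp \<Psi> \<subseteq> supp \<Phi>"
    unfolding supp_def[of \<Psi>] by (rule closure_minimal) (simp add: supp_def)
  moreover have "compact (supp \<Psi>)" by (rule compact_supp_subset[OF sm(2) sub])
  ultimately show "transpose_vfield A B \<Phi> \<in> Ck_c N U"
    using ext(1) sm(3) by (auto simp: Ck_c_def \<Psi>_def)
  show "i + j \<le> N \<Longrightarrow> (pdx ^^ i) ((pdy ^^ j) (transpose_vfield A B \<Phi>)) 0 = 0"
    using ext(2) by (simp add: \<Psi>_def)
qed

end

lemma norm_powr_of_real: "r > 0 \<Longrightarrow> norm (of_real r powr c :: complex) = r powr Re c"
  by (simp add: norm_powr_real_powr)

text \<open>Meant for a singular factor, a coefficient of the field and a test function, with at
  most one derivative among them: the exponents s + t that occur are 1 and 0, so the powers of r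
  cancel.\<close>

lemma triple_product_bound:
  fixes a b c :: complex
  assumes "norm a \<le> P * r powr s" "norm b \<le> Q * r powr t" "norm c \<le> F" "0 < r" "r \<le> 1" "s + t \<ge> 0"
    "P \<ge> 0" "Q \<ge> 0"
  shows "norm (a * b * c) \<le> P * Q * F"
proof -
  have F: "F \<ge> 0" using order_trans[OF norm_ge_zero assms(3)] .
  have "norm (a * b * c) \<le> (P * r powr s) * (Q * r powr t) * F"
    unfolding norm_mult using assms F by (intro mult_mono mult_nonneg_nonneg) auto
  also have "\<dots> = (P * Q * F) * r powr (s + t)" by (simp add: powr_add)
  also have "\<dots> \<le> (P * Q * F) * 1"
    using assms F powr_mono'[of 0 "s + t" r] by (intro mult_left_mono) auto
  finally show ?thesis by simp
qed

lemma test_function_bound: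
  assumes "\<Phi> \<in> Cinf_c U"
  obtains F where "\<And>z. norm (\<Phi> z) \<le> F" "\<And>z. norm (pdx \<Phi> z) \<le> F" "\<And>z. norm (pdy \<Phi> z) \<le> F"
proof -
  have \<Phi>: "\<Phi> \<in> Ck_c 1 U" using assms Cinf_c_subset_Ck_c by blast
  show ?thesis
    using that[of "Ck_norm 1 \<Phi>"] Ck_norm_bound[OF \<Phi>, of 0 0] Ck_norm_bound[OF \<Phi>, of 1 0]
      Ck_norm_bound[OF \<Phi>, of 0 1] by simp
qed

section \<open>Verification of the equation\<close>

context homogeneous_field
begin

text \<open>The series enters only through what is assumed of \<open>w\<close>: boundedness, a
  gradient of size 1/r and the transport equation.\<close>

lemma finite_part_solution:
  fixes w f :: "plane \<Rightarrow> complex" and e C0 C1 :: real and N :: nat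
  defines "U \<equiv> ball 0 e" and "h \<equiv> \<lambda>z. w z / of_real (norm z) powr (lam - 1)"
  assumes e: "0 < e" "e \<le> 1"
    and w: "smooth_on (U - {0}) w" "\<And>z. z \<in> U - {0} \<Longrightarrow> norm (w z) \<le> C0"
      "\<And>z. z \<in> U - {0} \<Longrightarrow> norm (pdx w z) \<le> C1 / norm z"
      "\<And>z. z \<in> U - {0} \<Longrightarrow> norm (pdy w z) \<le> C1 / norm z"
    and f: "continuous_on U f"
    and transport: "\<And>z. z \<in> U - {0} \<Longrightarrow> A z * pdx w z + B z * pdy w z =
      (lam - 1) * radial z / of_real ((norm z)\<^sup>2) * w z + of_real (norm z) powr (lam - 1) * f z"
    and N: "real N < Re lam - 1" "Re lam - 1 \<le> real N + 1"
  shows "distribution_of_singular U (finite_part U N h) h"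
    "distribution_solution U A B (finite_part U N h) f"
proof -
  have U: "open (U - {0})" by (simp add: U_def open_delete)
  have p: "(e / 2, 0) \<in> U - {0}" using e by (simp add: U_def norm_Pair prod_eq_iff)
  have C0: "C0 \<ge> 0" using order_trans[OF norm_ge_zero w(2)[OF p]] .
  have C1: "C1 \<ge> 0" using order_trans[OF norm_ge_zero w(3)[OF p]] e by (simp add: norm_Pair zero_le_divide_iff)
  have r: "0 < norm z" "norm z \<le> 1" "z \<noteq> 0" if "z \<in> U - {0}" for z
    using that e by (auto simp: U_def)
  have heq: "h = (\<lambda>z. w z * of_real (norm z) powr (1 - lam))"
  proof
    fix z show "h z = w z * of_real (norm z) powr (1 - lam)"
      using powr_minus[of "of_real (norm z)" "lam - 1"] by (simp add: h_def field_simps)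
  qed
  \<comment> \<open>A complex power of 0 is 0 and so is a quotient by 0; hence the value is 0
    whatever \<open>w 0\<close> is, and integrands over the full and the punctured disc
    coincide.\<close>
  have h0: "h 0 = 0" by (simp add: h_def)
  have smp: "smooth_on (U - {0}) (\<lambda>z. of_real (norm z) powr c)" for c
    by (rule smooth_on_subset[OF smooth_on_norm_powr]) auto
  have smh: "smooth_on (U - {0}) h" unfolding heq by (intro smooth_on_mult U w(1) smp)
  have hb: "norm (h z) \<le> C0 * norm z powr (1 - Re lam)" if "z \<in> U - {0}" for z
    using mult_right_mono[OF w(2)[OF that], of "norm z powr (1 - Re lam)"] r[OF that]
    by (simp add: heq norm_mult norm_powr_of_real)
  \<comment> \<open>Here Re lam - 1 <= N + 1 is used, together with r <= 1.\<close>
  have hb': "norm (h z) \<le> C0 * norm z powr - (real N + 1)" if "z \<in> U - {0}" for z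
    using hb[OF that] by (rule order_trans) (use r[OF that] N C0 in \<open>auto intro!: mult_left_mono powr_mono'\<close>)
  show sing: "distribution_of_singular U (finite_part U N h) h"
    unfolding U_def
    by (rule finite_part_singular[OF e smooth_onD(4)[OF smh[unfolded U_def]] h0 hb'[unfolded U_def]])
  have ext: "extends_to_order N U (finite_part U N h) (finite_part U N h)"
    unfolding U_def
    by (rule finite_part_extends[OF e smooth_onD(4)[OF smh[unfolded U_def]] h0 hb'[unfolded U_def]])

  have wd: "w differentiable (at z)" if "z \<in> U - {0}" for z by (rule smooth_onD(1)[OF w(1) that])
  have pd_h: "pdx h z = w z * ((1 - lam) * of_real (fst z) * of_real (norm z) powr (- 1 - lam)) +
        pdx w z * of_real (norm z) powr (1 - lam)"
    "pdy h z = w z * ((1 - lam) * of_real (snd z) * of_real (norm z) powr (- 1 - lam)) +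
        pdy w z * of_real (norm z) powr (1 - lam)" if z: "z \<in> U - {0}" for z
  proof -
    have "(\<lambda>z. complex_of_real (norm z) powr (1 - lam)) differentiable (at z)"
      by (rule smooth_onD(1)[OF smp z])
    from pd_mult[OF wd[OF z] this] pd_norm_powr[OF r(3)[OF z], of "1 - lam"]
    show "pdx h z = w z * ((1 - lam) * of_real (fst z) * of_real (norm z) powr (- 1 - lam)) +
        pdx w z * of_real (norm z) powr (1 - lam)"
      "pdy h z = w z * ((1 - lam) * of_real (snd z) * of_real (norm z) powr (- 1 - lam)) +
        pdy w z * of_real (norm z) powr (1 - lam)"
      unfolding heq by simp_all
  qed
  \<comment> \<open>L r^(1-lam) is (1 - lam) radial / r^2 times r^(1-lam), which cancels the
    multiple of \<open>w\<close> in the transport equation.\<close>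
  have Lh: "A z * pdx h z + B z * pdy h z = f z" if z: "z \<in> U - {0}" for z
  proof -
    let ?p = "of_real (norm z) powr (1 - lam) :: complex"
    have 1: "of_real (norm z) powr (- 1 - lam) = ?p / of_real ((norm z)\<^sup>2)"
    proof -
      have "of_real (norm z) powr ((1 - lam) - 2) = ?p / of_real ((norm z)\<^sup>2)"
        unfolding powr_diff using r[OF z] by simp
      then show ?thesis by simp
    qed
    have 2: "of_real (norm z) powr (lam - 1) * ?p = 1"
      using r[OF z] by (simp flip: powr_add)
    have "A z * pdx h z + B z * pdy h z =
        ?p * (A z * pdx w z + B z * pdy w z) - (lam - 1) * radial z / of_real ((norm z)\<^sup>2) * w z * ?p"
      unfolding pd_h[OF z] 1 by (simp add: radial_def algebra_simps add_divide_distrib diff_divide_distrib)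
    also have "\<dots> = (of_real (norm z) powr (lam - 1) * ?p) * f z"
      unfolding transport[OF z] by (simp only: algebra_simps)
    finally show ?thesis using 2 by simp
  qed
  define Ch where "Ch = C0 * norm (1 - lam) + C1"
  have pd_hb: "norm (pdx h z) \<le> Ch * norm z powr (- Re lam)" "norm (pdy h z) \<le> Ch * norm z powr (- Re lam)"
    if z: "z \<in> U - {0}" for z
  proof -
    have *: "norm (w z * ((1 - lam) * of_real x * of_real (norm z) powr (- 1 - lam)) +
        v * of_real (norm z) powr (1 - lam)) \<le> Ch * norm z powr (- Re lam)"
      if x: "\<bar>x\<bar> \<le> norm z" and v: "norm v \<le> C1 / norm z" for x :: real and v
    proof -
      have e1: "norm z powr - Re lam = norm z * norm z powr (- 1 - Re lam)"
        "norm z powr - Re lam = norm z powr (1 - Re lam) / norm z"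
        using r(1)[OF z] by (simp_all add: powr_diff powr_minus field_simps)
      have "norm (w z * ((1 - lam) * of_real x * of_real (norm z) powr (- 1 - lam))) \<le>
          C0 * (norm (1 - lam) * norm z * norm z powr (- 1 - Re lam))"
        unfolding norm_mult norm_of_real norm_powr_of_real[OF r(1)[OF z]]
        using w(2)[OF z] x by (intro mult_mono) (auto intro: C0)
      also have "\<dots> = C0 * norm (1 - lam) * norm z powr - Re lam" unfolding e1(1) by simp
      finally have 1: "norm (w z * ((1 - lam) * of_real x * of_real (norm z) powr (- 1 - lam))) \<le>
          C0 * norm (1 - lam) * norm z powr - Re lam" .
      have "norm (v * of_real (norm z) powr (1 - lam)) \<le> C1 / norm z * norm z powr (1 - Re lam)"
        unfolding norm_mult norm_powr_of_real[OF r(1)[OF z]]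
        using v order_trans[OF norm_ge_zero v] by (intro mult_mono) auto
      also have "\<dots> = C1 * norm z powr - Re lam" unfolding e1(2) by simp
      finally have 2: "norm (v * of_real (norm z) powr (1 - lam)) \<le> C1 * norm z powr - Re lam" .
      show ?thesis using norm_triangle_mono[OF 1 2] by (simp add: Ch_def algebra_simps)
    qed
    show "norm (pdx h z) \<le> Ch * norm z powr (- Re lam)" "norm (pdy h z) \<le> Ch * norm z powr (- Re lam)"
      unfolding pd_h[OF z] by (intro * abs_fst_le_norm abs_snd_le_norm w(3,4) z)+
  qed
  have Ch: "Ch \<ge> 0" using C0 C1 by (simp add: Ch_def)
  obtain CA where CA: "CA \<ge> 0" "\<And>z. z \<noteq> 0 \<Longrightarrow> norm (A z) \<le> CA * norm z powr Re lam"
    using homogeneous_bound[OF smooth_onD(4)[OF smooth_A] hom_A] by blast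
  obtain CB where CB: "CB \<ge> 0" "\<And>z. z \<noteq> 0 \<Longrightarrow> norm (B z) \<le> CB * norm z powr Re lam"
    using homogeneous_bound[OF smooth_onD(4)[OF smooth_B] hom_B] by blast
  obtain CA' where "CA' \<ge> 0" "\<And>z. z \<noteq> 0 \<Longrightarrow> norm (pdx A z) \<le> CA' * norm z powr Re (lam - 1)"
    using homogeneous_bound[OF smooth_onD(4)[OF smooth_onD(2)[OF smooth_A]] homogeneous_pd(1)[OF smooth_A hom_A]]
    by blast
  then have CA': "CA' \<ge> 0" "\<And>z. z \<noteq> 0 \<Longrightarrow> norm (pdx A z) \<le> CA' * norm z powr (Re lam - 1)" by simp_all
  obtain CB' where "CB' \<ge> 0" "\<And>z. z \<noteq> 0 \<Longrightarrow> norm (pdy B z) \<le> CB' * norm z powr Re (lam - 1)"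
    using homogeneous_bound[OF smooth_onD(4)[OF smooth_onD(3)[OF smooth_B]] homogeneous_pd(2)[OF smooth_B hom_B]]
    by blast
  then have CB': "CB' \<ge> 0" "\<And>z. z \<noteq> 0 \<Longrightarrow> norm (pdy B z) \<le> CB' * norm z powr (Re lam - 1)" by simp_all

  have "transpose_vfield A B \<Phi> \<in> Ck_c N U \<and>
      finite_part U N h (transpose_vfield A B \<Phi>) = (LINT z:U|lborel. f z * \<Phi> z)"
    if \<Phi>: "\<Phi> \<in> Cinf_c U" for \<Phi>
  proof
    define \<Psi> where "\<Psi> = transpose_vfield A B \<Phi>"
    show \<Psi>: "transpose_vfield A B \<Phi> \<in> Ck_c N U" by (rule transpose_vfield_order(1)[OF \<Phi> N(1)])
    have flat: "finite_part U N h \<Psi> = (LINT z:U|lborel. h z * \<Psi> z)"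
      unfolding \<Psi>_def by (rule finite_part_flat[OF transpose_vfield_order(2)[OF \<Phi> N(1)]]) simp
    have sm\<Phi>: "smooth_on UNIV \<Phi>" "supp \<Phi> \<subseteq> U" "compact (supp \<Phi>)" using \<Phi> by (auto simp: Cinf_c_def)
    have sub: "smooth_on UNIV F \<Longrightarrow> smooth_on (U - {0}) F" for F by (rule smooth_on_subset) auto
    have subA: "smooth_on (UNIV - {0}) F \<Longrightarrow> smooth_on (U - {0}) F" for F by (rule smooth_on_subset) auto
    obtain F where F: "\<And>z. norm (\<Phi> z) \<le> F" "\<And>z. norm (pdx \<Phi> z) \<le> F" "\<And>z. norm (pdy \<Phi> z) \<le> F"
      using test_function_bound[OF \<Phi>] by blast
    \<comment> \<open>\<open>X\<close> and \<open>Y\<close> are the components of h \<Phi> (A, B),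
      whose divergence off the origin is f \<Phi> - h \<Psi>.\<close>
    define X where "X z = h z * (A z * \<Phi> z)" for z
    define Y where "Y z = h z * (B z * \<Phi> z)" for z
    have smX: "smooth_on (U - {0}) X" unfolding X_def[abs_def]
      by (intro smooth_on_mult U smh subA[OF smooth_A] sub[OF sm\<Phi>(1)])
    have smY: "smooth_on (U - {0}) Y" unfolding Y_def[abs_def]
      by (intro smooth_on_mult U smh subA[OF smooth_B] sub[OF sm\<Phi>(1)])
    \<comment> \<open>Set to 0 at the origin and off the disc, the derivatives become bounded
      functions on the whole plane that can be integrated line by line.\<close>
    define GX where "GX z = indicator (U - {0}) z *\<^sub>R pdx X z" for z
    define GY where "GY z = indicator (U - {0}) z *\<^sub>R pdy Y z" for z
    have dA: "A differentiable (at z)" "B differentiable (at z)" "\<Phi> differentiable (at z)" "h differentiable (at z)"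
      if "z \<in> U - {0}" for z
      using smooth_onD(1)[OF subA[OF smooth_A] that] smooth_onD(1)[OF subA[OF smooth_B] that]
        smooth_onD(1)[OF sub[OF sm\<Phi>(1)] that] smooth_onD(1)[OF smh that] by blast+
    have pdX: "pdx X z = h z * (A z * pdx \<Phi> z) + h z * (pdx A z * \<Phi> z) + pdx h z * (A z * \<Phi> z)"
      and pdY: "pdy Y z = h z * (B z * pdy \<Phi> z) + h z * (pdy B z * \<Phi> z) + pdy h z * (B z * \<Phi> z)"
      if z: "z \<in> U - {0}" for z
      unfolding X_def[abs_def] Y_def[abs_def]
      using pd_mult(1)[OF dA(4)[OF z] differentiable_mult[OF dA(1,3)[OF z]]] pd_mult(1)[OF dA(1,3)[OF z]]
        pd_mult(2)[OF dA(4)[OF z] differentiable_mult[OF dA(2,3)[OF z]]] pd_mult(2)[OF dA(2,3)[OF z]]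
      by (simp_all add: distrib_left)
    have GXb: "norm (GX z) \<le> (C0 * CA * F + C0 * CA' * F + Ch * CA * F) * indicator U z" for z
    proof (cases "z \<in> U - {0}")
      case True
      note rr = r[OF True]
      have "norm (h z * A z * pdx \<Phi> z) \<le> C0 * CA * F"
        by (rule triple_product_bound[OF hb[OF True] CA(2)[OF rr(3)] F(2) rr(1,2)]) (use C0 CA in auto)
      moreover have "norm (h z * pdx A z * \<Phi> z) \<le> C0 * CA' * F"
        by (rule triple_product_bound[OF hb[OF True] CA'(2)[OF rr(3)] F(1) rr(1,2)]) (use C0 CA' in auto)
      moreover have "norm (pdx h z * A z * \<Phi> z) \<le> Ch * CA * F"
        by (rule triple_product_bound[OF pd_hb(1)[OF True] CA(2)[OF rr(3)] F(1) rr(1,2)]) (use Ch CA in auto)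
      ultimately have "norm (h z * A z * pdx \<Phi> z + h z * pdx A z * \<Phi> z + pdx h z * A z * \<Phi> z)
          \<le> C0 * CA * F + C0 * CA' * F + Ch * CA * F"
        by (intro norm_triangle_mono)
      then show ?thesis using True by (simp add: GX_def pdX mult.assoc)
    next
      case False
      have "F \<ge> 0" using order_trans[OF norm_ge_zero F(1)] .
      then show ?thesis using False C0 CA(1) CA'(1) Ch by (simp add: GX_def)
    qed
    have GYb: "norm (GY z) \<le> (C0 * CB * F + C0 * CB' * F + Ch * CB * F) * indicator U z" for z
    proof (cases "z \<in> U - {0}")
      case True
      note rr = r[OF True]
      have "norm (h z * B z * pdy \<Phi> z) \<le> C0 * CB * F"
        by (rule triple_product_bound[OF hb[OF True] CB(2)[OF rr(3)] F(3) rr(1,2)]) (use C0 CB in auto)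
      moreover have "norm (h z * pdy B z * \<Phi> z) \<le> C0 * CB' * F"
        by (rule triple_product_bound[OF hb[OF True] CB'(2)[OF rr(3)] F(1) rr(1,2)]) (use C0 CB' in auto)
      moreover have "norm (pdy h z * B z * \<Phi> z) \<le> Ch * CB * F"
        by (rule triple_product_bound[OF pd_hb(2)[OF True] CB(2)[OF rr(3)] F(1) rr(1,2)]) (use Ch CB in auto)
      ultimately have "norm (h z * B z * pdy \<Phi> z + h z * pdy B z * \<Phi> z + pdy h z * B z * \<Phi> z)
          \<le> C0 * CB * F + C0 * CB' * F + Ch * CB * F"
        by (intro norm_triangle_mono)
      then show ?thesis using True by (simp add: GY_def pdY mult.assoc)
    next
      case False
      have "F \<ge> 0" using order_trans[OF norm_ge_zero F(1)] .
      then show ?thesis using False C0 CB(1) CB'(1) Ch by (simp add: GY_def)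
    qed
    have bnd: "integrable lborel (\<lambda>z::plane. c * indicator U z :: real)" for c
      using emeasure_lborel_ball_finite[of "0::plane" e]
      by (intro integrable_mult_right integrable_real_indicator) (simp_all add: U_def)
    have bSU: "U - {0} \<in> sets borel" using U by (rule borel_open)
    have iX: "integrable lborel GX"
    proof (rule Bochner_Integration.integrable_bound[OF bnd])
      show "GX \<in> borel_measurable lborel" unfolding GX_def[abs_def]
        using borel_measurable_continuous_on_indicator[OF bSU smooth_onD(4)[OF smooth_onD(2)[OF smX]]] by simp
      show "AE z in lborel. norm (GX z) \<le> norm ((C0 * CA * F + C0 * CA' * F + Ch * CA * F) * indicator U z)"
        by (rule AE_I2) (unfold real_norm_def, rule order_trans[OF GXb abs_ge_self])
    qed
    have iY: "integrable lborel GY"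
    proof (rule Bochner_Integration.integrable_bound[OF bnd])
      show "GY \<in> borel_measurable lborel" unfolding GY_def[abs_def]
        using borel_measurable_continuous_on_indicator[OF bSU smooth_onD(4)[OF smooth_onD(3)[OF smY]]] by simp
      show "AE z in lborel. norm (GY z) \<le> norm ((C0 * CB * F + C0 * CB' * F + Ch * CB * F) * indicator U z)"
        by (rule AE_I2) (unfold real_norm_def, rule order_trans[OF GYb abs_ge_self])
    qed
    have off: "X z = 0" "Y z = 0" if "z \<notin> supp \<Phi>" for z
      using zero_off_supp[OF that] by (simp_all add: X_def Y_def)
    have offU: "X z = 0" "Y z = 0" "GX z = 0" "GY z = 0" if "norm z \<ge> e" for z
    proof -
      have "z \<notin> U" using that by (simp add: U_def)
      then show "X z = 0" "Y z = 0" "GX z = 0" "GY z = 0"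
        using off[of z] sm\<Phi>(2) by (auto simp: GX_def GY_def)
    qed
    \<comment> \<open>Off the disc, its boundary included, the fields vanish in a neighbourhood,
      because the support of \<Phi> is closed and lies in the open disc.\<close>
    have dX: "(X has_derivative (\<lambda>k. of_real (fst k) * GX z + of_real (snd k) * pdy X z)) (at z)"
      "(Y has_derivative (\<lambda>k. of_real (fst k) * pdx Y z + of_real (snd k) * GY z)) (at z)" if "z \<noteq> 0" for z
    proof -
      have "(X has_derivative (\<lambda>k. of_real (fst k) * GX z + of_real (snd k) * pdy X z)) (at z) \<and>
        (Y has_derivative (\<lambda>k. of_real (fst k) * pdx Y z + of_real (snd k) * GY z)) (at z)"
      proof (cases "z \<in> U")
        case True
        then have z: "z \<in> U - {0}" using that by simp
        then show ?thesis
          using has_derivative_pd[OF smooth_onD(1)[OF smX z]] has_derivative_pd[OF smooth_onD(1)[OF smY z]]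
          by (simp add: GX_def GY_def)
      next
        case False
        then have z: "z \<in> - supp \<Phi>" using sm\<Phi>(2) by auto
        have 0: "((\<lambda>z. 0) has_derivative (\<lambda>k. 0)) (at z)" by (rule has_derivative_const)
        have D: "(X has_derivative (\<lambda>k. 0)) (at z)" "(Y has_derivative (\<lambda>k. 0)) (at z)"
          by (rule has_derivative_transform_within_open[OF 0 open_off_supp z], simp add: off)+
        have "GX z = 0" "GY z = 0" using False by (simp_all add: GX_def GY_def)
        moreover have "pdy X z = 0" "pdx Y z = 0" using pdy_eq[OF D(1)] pdx_eq[OF D(2)] by simp_all
        ultimately show ?thesis using D by simp
      qed
      then show "(X has_derivative (\<lambda>k. of_real (fst k) * GX z + of_real (snd k) * pdy X z)) (at z)"
        "(Y has_derivative (\<lambda>k. of_real (fst k) * pdx Y z + of_real (snd k) * GY z)) (at z)" by blast+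
    qed
    have IX: "(\<integral>z. GX z \<partial>lborel) = 0"
    proof (rule integral_pdx_zero[OF iX e(1)])
      fix x y :: real assume "y \<noteq> 0"
      then have "(x, y) \<noteq> 0" by (simp add: prod_eq_iff)
      from has_derivative_compose[OF has_derivative_Pair[OF has_derivative_ident has_derivative_const] dX(1)[OF this]]
      show "((\<lambda>x. X (x, y)) has_vector_derivative GX (x, y)) (at x)"
        by (simp add: has_vector_derivative_def scaleR_conv_of_real)
    qed (use offU in auto)
    have IY: "(\<integral>z. GY z \<partial>lborel) = 0"
    proof (rule integral_pdy_zero[OF iY e(1)])
      fix x y :: real assume "x \<noteq> 0"
      then have "(x, y) \<noteq> 0" by (simp add: prod_eq_iff)
      from has_derivative_compose[OF has_derivative_Pair[OF has_derivative_const has_derivative_ident] dX(2)[OF this]]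
      show "((\<lambda>y. Y (x, y)) has_vector_derivative GY (x, y)) (at y)"
        by (simp add: has_vector_derivative_def scaleR_conv_of_real)
    qed (use offU in auto)
    have if\<Phi>: "integrable lborel (\<lambda>z. indicator U z *\<^sub>R (f z * \<Phi> z))"
      using set_integrable_times_test(1)[OF locally_integrable_continuous[OF f] F(1) smooth_onD(4)[OF sm\<Phi>(1)]
          sm\<Phi>(3,2) zero_off_supp[of _ \<Phi>]]
      by (simp add: set_integrable_def)
    \<comment> \<open>By the product rule the divergence is \<Phi> times L h, which is f \<Phi>,
      plus h times L \<Phi> + (div L) \<Phi>, which is - h \<Psi>.\<close>
    have pt: "indicator U z *\<^sub>R (h z * \<Psi> z) = indicator U z *\<^sub>R (f z * \<Phi> z) - GX z - GY z" if "z \<noteq> 0" for z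
    proof (cases "z \<in> U")
      case True
      then have z: "z \<in> U - {0}" using that by simp
      have "f z * \<Phi> z - pdx X z - pdy Y z = h z * \<Psi> z"
        unfolding pdX[OF z] pdY[OF z] Lh[OF z, symmetric] using that
        by (simp add: \<Psi>_def transpose_vfield_def vfield_def divergence_def algebra_simps)
      then show ?thesis using z by (simp add: GX_def GY_def)
    qed (simp add: GX_def GY_def)
    have "(LINT z:U|lborel. h z * \<Psi> z) = (\<integral>z. indicator U z *\<^sub>R (f z * \<Phi> z) - GX z - GY z \<partial>lborel)"
      unfolding set_lebesgue_integral_def
    proof (rule integral_cong_AE)
      show "(\<lambda>z. indicator U z *\<^sub>R (f z * \<Phi> z) - GX z - GY z) \<in> borel_measurable lborel"
        using if\<Phi> iX iY by (intro borel_measurable_diff borel_measurable_integrable)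
      have "continuous_on UNIV \<Psi>" using Ck_c_bounds(2)[OF \<Psi>] by (simp add: \<Psi>_def)
      then have "(\<lambda>z. indicator (U - {0}) z *\<^sub>R (h z * \<Psi> z)) \<in> borel_measurable borel"
        by (intro borel_measurable_continuous_on_indicator bSU continuous_on_mult smooth_onD(4)[OF smh])
          (rule continuous_on_subset, auto)
      moreover have "(\<lambda>z. indicator (U - {0}) z *\<^sub>R (h z * \<Psi> z)) = (\<lambda>z. indicator U z *\<^sub>R (h z * \<Psi> z))"
        using h0 by (auto simp: indicator_def fun_eq_iff simp del: split_paired_All)
      ultimately show "(\<lambda>z. indicator U z *\<^sub>R (h z * \<Psi> z)) \<in> borel_measurable lborel" by simp
      show "AE z in lborel. indicator U z *\<^sub>R (h z * \<Psi> z) = indicator U z *\<^sub>R (f z * \<Phi> z) - GX z - GY z"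
        using AE_lborel_singleton[of "0::plane"] by eventually_elim (rule pt)
    qed
    also have "\<dots> = (\<integral>z. indicator U z *\<^sub>R (f z * \<Phi> z) \<partial>lborel) - (\<integral>z. GX z \<partial>lborel) - (\<integral>z. GY z \<partial>lborel)"
      using if\<Phi> iX iY by (simp only: Bochner_Integration.integral_diff Bochner_Integration.integrable_diff)
    finally have "(LINT z:U|lborel. h z * \<Psi> z) = (LINT z:U|lborel. f z * \<Phi> z)"
      by (simp add: IX IY set_lebesgue_integral_def)
    then show "finite_part U N h (transpose_vfield A B \<Phi>) = (LINT z:U|lborel. f z * \<Phi> z)"
      using flat by (simp add: \<Psi>_def)
  qed
  then show "distribution_solution U A B (finite_part U N h) f"
    unfolding distribution_solution_def
    using ext extends_to_order_imp_distribution[OF ext] locally_integrable_continuous[OF f] by blast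
qed

end

theorem theorem6p1:
  fixes A B f :: "real \<times> real \<Rightarrow> complex" and lam \<mu> :: complex
  assumes "Re lam > 1"
    and "smooth_on (UNIV - {0}) A" and "smooth_on (UNIV - {0}) B"
    and "homogeneous lam A" and "homogeneous lam B"
    and "interior {z. z \<noteq> 0 \<and> Im (A z * cnj (B z)) = 0} = {}"
    and "\<And>x y. (x, y) \<noteq> 0 \<Longrightarrow> A (x, y) * of_real y - B (x, y) * of_real x \<noteq> 0"
    and "\<mu> = mu A B"
    and "Re \<mu> \<ge> 0"
    and "\<mu> \<noteq> 0"
    and "\<not> resonant \<mu> lam"
    and "DC \<mu> lam"
    and "real_analytic_at_0 f"
  shows "\<exists>\<epsilon>>0. \<exists>w. smooth_on (ball 0 \<epsilon> - {0}) w \<and> bounded (w ` (ball 0 \<epsilon> - {0})) \<and>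
           (\<exists>u. distribution_of_singular (ball 0 \<epsilon>) u
                  (\<lambda>z. w z / of_real (norm z) powr (lam - 1)) \<and>
                distribution_solution (ball 0 \<epsilon>) A B u f)"
proof -
  interpret H: homogeneous_field A B lam
    using assms(1-5,7) by unfold_locales
  obtain \<rho> c where \<rho>: "\<rho> > 0" "rapid_decay \<rho> c" and f: "\<And>z. z \<in> ball 0 \<rho> \<Longrightarrow> f z = (\<Sum>j. hpoly c j z)"
    using real_analytic_expansion[OF assms(13)] by metis
  have "DC (mu A B) lam" using assms(8,12) by simp
  from H.exists_formal_solution[OF this \<rho>] obtain g K M Kk Km where
    F: "formal_solution g c H.kk H.mm lam \<rho> K M Kk Km" by blast
  interpret F: formal_solution g c H.kk H.mm lam \<rho> K M Kk Km by (rule F)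
  \<comment> \<open>Radius at most 1, because comparing powers of r with different exponents needs r
    <= 1.\<close>
  define e where "e = min F.eps 1"
  have e: "0 < e" "e \<le> 1" using F.eps_pos by (auto simp: e_def)
  have sub: "ball 0 e - {0} \<subseteq> ball 0 F.eps - {0::plane}" by (auto simp: e_def)
  have sub\<rho>: "ball 0 e \<subseteq> ball (0::plane) \<rho>" by (auto simp: e_def F.eps_def)
  obtain C0 where C0: "\<And>z. z \<in> ball 0 F.eps - {0} \<Longrightarrow> norm (F.W 0 z) \<le> C0" using F.W_bound by blast
  obtain C1 where C1: "\<And>z. z \<in> ball 0 F.eps - {0} \<Longrightarrow> norm (pdx (F.W 0) z) \<le> C1 / norm z"
    "\<And>z. z \<in> ball 0 F.eps - {0} \<Longrightarrow> norm (pdy (F.W 0) z) \<le> C1 / norm z" using F.pd_W_bound by blast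
  have sm: "smooth_on (ball 0 e - {0}) (F.W 0)" by (rule smooth_on_subset[OF F.smooth_on_W sub])
  have "continuous_on (ball 0 \<rho>) (\<lambda>z. \<Sum>j. hpoly c j z)"
    by (rule smooth_onD(4)[OF smooth_on_psum[OF \<rho>]])
  then have "continuous_on (ball 0 \<rho>) f" by (rule continuous_on_eq) (simp add: f)
  then have cf: "continuous_on (ball 0 e) f" by (rule continuous_on_subset[OF _ sub\<rho>])
  \<comment> \<open>The largest integer strictly below Re lam - 1. Ceiling minus one, rather than
    the floor, keeps the inequality strict when Re lam is an integer; it is nonnegative because Re
    lam > 1.\<close>
  define N where "N = nat (\<lceil>Re lam - 1\<rceil> - 1)"
  have N: "real N < Re lam - 1" "Re lam - 1 \<le> real N + 1"
    using assms(1) by (simp_all add: N_def) linarith+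
  have tr: "A z * pdx (F.W 0) z + B z * pdy (F.W 0) z =
      (lam - 1) * H.radial z / of_real ((norm z)\<^sup>2) * F.W 0 z + of_real (norm z) powr (lam - 1) * f z"
    if "z \<in> ball 0 e - {0}" for z
  proof -
    have "z \<in> ball 0 F.eps - {0}" "z \<in> ball 0 \<rho>" using that sub sub\<rho> by blast+
    from H.formal_solution_transport[OF F this(1)] f[OF this(2)] show ?thesis by simp
  qed
  note sol = H.finite_part_solution[OF e sm C0 C1 cf tr N]
  have "bounded (F.W 0 ` (ball 0 e - {0}))"
    unfolding bounded_iff using C0 sub by blast
  moreover have "distribution_of_singular (ball 0 e)
      (finite_part (ball 0 e) N (\<lambda>z. F.W 0 z / of_real (norm z) powr (lam - 1)))
      (\<lambda>z. F.W 0 z / of_real (norm z) powr (lam - 1))"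
    "distribution_solution (ball 0 e) A B
      (finite_part (ball 0 e) N (\<lambda>z. F.W 0 z / of_real (norm z) powr (lam - 1))) f"
    using sol sub by blast+
  ultimately show ?thesis using e(1) sm by blast
qed

end
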